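(* Let $n\ge 2$, $s\in(\tfrac12,1)$ and $M>0$. There exists a constant $\alpha>0$ depending only on $n$, $s$ and $M$ such that the following holds. Let $x_0\in\mathbb{R}^n$, $0<r\le1$, and let $\vec b:B_r(x_0)\to\mathbb{R}^n$ and $c:B_r(x_0)\to\mathbb{R}$ satisfy $\|\vec b\|_{C^1(B_r(x_0))}\le M$ and $c(x)\le M$ in $B_r(x_0)$. Let $m>0$ and let $u\in\mathcal{L}_{2s}$ satisfy $$\begin{cases}(-\Delta)^su+\vec b\cdot\nabla u+c\,u\ge 0 & \text{in }\mathcal{D}'(B_r(x_0)\setminus\{x_0\}),\\ u\ge m & \text{in }B_r(x_0)\setminus B_{r/2}(x_0),\\ u\ge 0 & \text{in }\mathbb{R}^n.\end{cases}$$ Then $u\ge\alpha m$ in $B_r(x_0)$. Moreover, if $\vec b\equiv0$, the same statement holds for every $s\in(0,1)$.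
   Context: $B_r(x_0)$ is the open ball of radius $r$ centered at $x_0$; pointwise inequalities for $u$ are understood almost everywhere. $\mathcal{L}_{\alpha}=\{u:\mathbb{R}^n\to\mathbb{R}\ :\ \int_{\mathbb{R}^n}\frac{|u(y)|}{1+|y|^{n+\alpha}}\,dy<\infty\}$. For $\varphi\in C_c^\infty(\mathbb{R}^n)$, $(-\Delta)^s\varphi(x)=C_{n,s}\,\mathrm{P.V.}\int_{\mathbb{R}^n}\frac{\varphi(x)-\varphi(y)}{|x-y|^{n+2s}}\,dy$, where $C_{n,s}>0$ is the usual normalization constant. The function $c$ is measurable and such that $cu$ is locally integrable on $B_r(x_0)\setminus\{x_0\}$, so that the inequality makes sense. For an open set $U$, $(-\Delta)^su+\vec b\cdot\nabla u+cu\ge0$ in $\mathcal{D}'(U)$ means $\int_{\mathbb{R}^n}u\,(-\Delta)^s\varphi\,dx+\int_U u\,[-\mathrm{div}(\vec b\,\varphi)+c\,\varphi]\,dx\ge0$ for every nonnegative $\varphi\in C_c^\infty(U)$. *)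

theory Defs
  imports "HOL-Analysis.Analysis"
begin

text \<open>Functions of class \<open>C\<^sup>k\<close> on an open set \<open>U\<close>, by recursion on the partial derivatives.\<close>

primrec C_on :: "nat \<Rightarrow> 'a::euclidean_space set \<Rightarrow> ('a \<Rightarrow> 'b::real_normed_vector) \<Rightarrow> bool" where
  "C_on 0 U f \<longleftrightarrow> continuous_on U f"
| "C_on (Suc k) U f \<longleftrightarrow>
     (\<forall>x\<in>U. f differentiable (at x)) \<and>
     (\<forall>i\<in>Basis. C_on k U (\<lambda>x. frechet_derivative f (at x) i))"

text \<open>The \<open>C\<^sup>1\<close> norm takes values in \<open>[0, \<infinity>]\<close>, so that an upper bound by a real number
  includes the boundedness of the function and of its derivative.\<close>

definition C1_norm :: "'a::euclidean_space set \<Rightarrow> ('a \<Rightarrow> 'b::real_normed_vector) \<Rightarrow> ennreal" where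
  "C1_norm U f =
     (SUP x\<in>U. ennreal (norm (f x))) + (SUP x\<in>U. ennreal (onorm (frechet_derivative f (at x))))"

definition test_function :: "'a::euclidean_space set \<Rightarrow> ('a \<Rightarrow> real) \<Rightarrow> bool" where
  "test_function U \<phi> \<longleftrightarrow>
     (\<forall>k. C_on k UNIV \<phi>) \<and>
     compact (closure {x. \<phi> x \<noteq> 0}) \<and> closure {x. \<phi> x \<noteq> 0} \<subseteq> U"

definition divergence :: "('a::euclidean_space \<Rightarrow> 'a) \<Rightarrow> 'a \<Rightarrow> real" where
  "divergence F x = (\<Sum>i\<in>Basis. frechet_derivative F (at x) i \<bullet> i)"

definition weighted_L1 :: "real \<Rightarrow> ('a::euclidean_space \<Rightarrow> real) set" where
  "weighted_L1 \<alpha> = {u. u \<in> borel_measurable lebesgue \<and>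
     integrable lebesgue (\<lambda>y. \<bar>u y\<bar> / (1 + norm y powr (real DIM('a) + \<alpha>)))}"

definition locally_integrable_on :: "('a::euclidean_space \<Rightarrow> real) \<Rightarrow> 'a set \<Rightarrow> bool" where
  "locally_integrable_on f U \<longleftrightarrow>
     (\<forall>K. compact K \<and> K \<subseteq> U \<longrightarrow> set_integrable lebesgue K f)"

text \<open>The constant for which \<open>(-\<Delta>)\<^sup>s\<close> has Fourier symbol \<open>|\<xi>|\<^sup>2\<^sup>s\<close>, that is
  \<open>4\<^sup>s \<Gamma>(n/2 + s) / (\<pi>\<^sup>n\<^sup>/\<^sup>2 |\<Gamma>(-s)|)\<close>, rewritten with \<open>|\<Gamma>(-s)| = \<Gamma>(1 - s) / s\<close>
  for \<open>0 < s < 1\<close>.\<close>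

definition frac_laplacian_const :: "nat \<Rightarrow> real \<Rightarrow> real" where
  "frac_laplacian_const n s =
     s * 4 powr s * Gamma (real n / 2 + s) / (pi powr (real n / 2) * Gamma (1 - s))"

definition frac_laplacian :: "real \<Rightarrow> ('a::euclidean_space \<Rightarrow> real) \<Rightarrow> 'a \<Rightarrow> real" where
  "frac_laplacian s \<phi> x =
     frac_laplacian_const DIM('a) s *
     Lim (at_right 0) (\<lambda>\<epsilon>. LINT y:(- ball x \<epsilon>)|lebesgue.
       (\<phi> x - \<phi> y) / norm (x - y) powr (real DIM('a) + 2 * s))"

text \<open>The inequality \<open>(-\<Delta>)\<^sup>s u + b \<bullet> \<nabla>u + c u \<ge> 0\<close> in the sense of distributions on the
  open set \<open>U\<close>. Only the values of \<open>b\<close> and \<open>c\<close> on \<open>U\<close> matter.\<close>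

definition distr_supersolution ::
    "real \<Rightarrow> ('a::euclidean_space \<Rightarrow> 'a) \<Rightarrow> ('a \<Rightarrow> real) \<Rightarrow> 'a set \<Rightarrow> ('a \<Rightarrow> real) \<Rightarrow> bool" where
  "distr_supersolution s b c U u \<longleftrightarrow>
     (\<forall>\<phi>. test_function U \<phi> \<and> (\<forall>x. 0 \<le> \<phi> x) \<longrightarrow>
        0 \<le> (LINT x|lebesgue. u x * frac_laplacian s \<phi> x) +
            (LINT x:U|lebesgue. u x * (- divergence (\<lambda>y. \<phi> y *\<^sub>R b y) x + c x * \<phi> x)))"

end

theory Submission
  imports Defs
begin

text \<open>
  A smooth supersolution would be handled by evaluating the equation at an interior minimum point
  \<open>z\<close>: the gradient vanishes there, and the fractional Laplacian at \<open>z\<close> is at most a constant times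
  \<open>u(z)\<close> minus the contribution of the annulus, where \<open>u \<ge> m\<close>. If \<open>u(z) < \<alpha> m\<close> with \<open>\<alpha>\<close> small, the
  annulus wins and the inequality fails. The nonlocality of the operator makes this a one step
  argument, without a Harnack inequality. Three obstacles have to be removed.

  \<^item> \<^bold>\<open>No regularity.\<close> The inequality is tested with the bump \<open>\<phi>\<close> of radius \<open>e\<close> centred at \<open>z\<close>,
    and the minimum is taken of the mollification \<open>U(z) = \<integral> u \<phi>\<close>, for which testing with
    \<open>(-\<Delta>)\<^sup>s \<phi>\<close> is applying \<open>(-\<Delta>)\<^sup>s\<close> (\<open>frac_op_mollify\<close>). The drift does not commute with the
    mollification; the error is at most the Lipschitz constant of \<open>b\<close> times
    \<open>\<integral> u(x) |x - z| |\<nabla>\<phi>(x)| dx\<close>. Here \<open>|x - z| |\<nabla>\<phi>|\<close> is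
    bounded by \<open>A \<phi> - e\<^sup>2\<^sup>s (-\<Delta>)\<^sup>s \<phi>\<close>, up to the normalisation of the operator, because near the
    edge of its support, where \<open>\<phi>\<close> does not control its gradient, \<open>(-\<Delta>)\<^sup>s \<phi>\<close> is negative
    (\<open>bump_commutator_absorbed\<close>). So the error is a zero order term plus a small fraction of the
    leading term.

  \<^item> \<^bold>\<open>The singular point.\<close> Bumps centred close to \<open>x0\<close> are not admissible. A small multiple \<open>\<delta>\<close> of
    a barrier \<open>\<Phi>\<close> that is large near \<open>x0\<close> is added to \<open>U\<close>, which keeps low minima away from \<open>x0\<close>.
    The barrier has to satisfy \<open>(-\<Delta>)\<^sup>s \<Phi> \<ge> K |\<nabla>\<Phi>| - C\<close> with constants that do not depend on its
    height. A truncation of \<open>- 2 ln |x - x0|\<close> does so: in dimension \<open>n \<ge> 2\<close> it is superharmonic, which makes its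
    fractional Laplacian at least \<open>c |x - x0|\<^sup>-\<^sup>2\<^sup>s - C\<close>, while its gradient is of order \<open>1 / |x - x0|\<close>, and
    \<open>2 s > 1\<close>. Writing the logarithm as a superposition of Gaussians, and the kernel as a mixture of
    heat kernels, turns this into an explicit computation (\<open>frac_op_barrier_ge\<close>,
    \<open>barrier_dominates_drift\<close>). Without drift no gradient has to be dominated, and any \<open>s\<close> between
    \<open>0\<close> and \<open>1\<close> is allowed.

  \<^item> \<^bold>\<open>The return to \<open>u\<close>.\<close> The minimum principle (\<open>nonlocal_minimum_principle\<close>) bounds \<open>U + \<delta> \<Phi>\<close>
    from below for every small \<open>e\<close>. Since \<open>\<Phi>\<close> is bounded by \<open>1 / |x - x0|\<^sup>2\<close>, integrating over a box
    that avoids \<open>x0\<close> and letting \<open>e\<close> and then \<open>\<delta>\<close> tend to zero bounds the average of \<open>u\<close> over the box, and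
    Lebesgue's differentiation theorem gives the pointwise bound almost everywhere.
\<close>

section \<open>The singular kernel\<close>

lemma integrable_affine_euclidean:
  fixes t :: "'a::euclidean_space" and f :: "'a \<Rightarrow> real"
  assumes f: "integrable lborel f" and c: "c \<noteq> 0"
  shows "integrable lborel (\<lambda>x. f (t + c *\<^sub>R x))"
proof -
  have [measurable]: "f \<in> borel_measurable borel" using f by auto
  have "integrable (density (distr lborel borel (\<lambda>x. t + c *\<^sub>R x)) (\<lambda>_. ennreal (\<bar>c\<bar>^DIM('a)))) f"
    using f lborel_affine[OF c, of t] by simp
  then have "integrable (distr lborel borel (\<lambda>x. t + c *\<^sub>R x)) (\<lambda>x. \<bar>c\<bar>^DIM('a) *\<^sub>R f x)"
    by (subst (asm) integrable_density) auto
  then have "integrable lborel (\<lambda>x. \<bar>c\<bar>^DIM('a) * f (t + c *\<^sub>R x))"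
    by (subst (asm) integrable_distr_eq) auto
  then show ?thesis using c by simp
qed

lemma integral_affine_euclidean:
  fixes t :: "'a::euclidean_space" and f :: "'a \<Rightarrow> real"
  assumes f[measurable]: "f \<in> borel_measurable borel" and c: "c \<noteq> 0"
  shows "(\<integral>x. f x \<partial>lborel) = \<bar>c\<bar>^DIM('a) * (\<integral>x. f (t + c *\<^sub>R x) \<partial>lborel)"
  by (subst lborel_affine[OF c, of t])
     (simp add: integral_density integral_distr)

lemma integral_reflect_euclidean:
  fixes f :: "'a::euclidean_space \<Rightarrow> real"
  assumes f[measurable]: "f \<in> borel_measurable borel"
  shows "(\<integral>x. f (t - x) \<partial>lborel) = (\<integral>x. f x \<partial>lborel)"
  using integral_affine_euclidean[OF f, of "-1" t] by simp

text \<open>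
  Every integrability statement below reduces to this one on the half line: the singular kernel
  and the Gaussian mixtures all have a power singularity that is cut off on one side.
\<close>

lemma integrable_powr_cut:
  assumes "0 < p" "p < (q::real)"
  shows "integrable lborel (\<lambda>t::real. indicator {0<..} t * (t powr (-1 - p) * min 1 (t powr q)))"
proof -
  have a1: "(\<lambda>t. t powr (q - p - 1)) integrable_on {0<..1}"
    by (rule integrable_on_powr_from_0') (use assms in auto)
  have a2: "(\<lambda>t::real. t powr (-1-p)) integrable_on {1..}"
    using has_integral_powr_to_inf[of "-1-p" 1] assms by (auto simp: integrable_on_def)
  have b1: "set_integrable lebesgue {0<..1} (\<lambda>t. t powr (q - p - 1))"
    by (rule nonnegative_absolutely_integrable_1[OF a1]) auto
  have b2: "set_integrable lebesgue {1..} (\<lambda>t::real. t powr (-1-p))"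
    by (rule nonnegative_absolutely_integrable_1[OF a2]) auto
  have c1: "integrable lborel (\<lambda>t. indicator {0<..1} t *\<^sub>R t powr (q - p - 1))"
    using b1 unfolding set_integrable_def by (subst (asm) integrable_completion) measurable
  have c2: "integrable lborel (\<lambda>t::real. indicator {1..} t *\<^sub>R t powr (-1-p))"
    using b2 unfolding set_integrable_def by (subst (asm) integrable_completion) measurable
  show ?thesis
  proof (rule Bochner_Integration.integrable_bound[OF Bochner_Integration.integrable_add[OF c1 c2]])
    show "AE t in lborel. norm (indicator {0<..} t * (t powr (-1 - p) * min 1 (t powr q)))
        \<le> norm (indicator {0<..1} t *\<^sub>R t powr (q - p - 1) + indicator {1..} t *\<^sub>R t powr (-1-p))"
    proof (rule AE_I2)
      fix t :: real
      show "norm (indicator {0<..} t * (t powr (-1 - p) * min 1 (t powr q)))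
        \<le> norm (indicator {0<..1} t *\<^sub>R t powr (q - p - 1) + indicator {1..} t *\<^sub>R t powr (-1-p))"
      proof (cases "t \<le> 0")
        case True then show ?thesis by auto
      next
        case False
        then have t: "t > 0" by simp
        have e: "t powr (-1-p) * t powr q = t powr (q - p - 1)"
          by (simp add: powr_add[symmetric] algebra_simps)
        have m: "t powr (-1-p) * min 1 (t powr q) \<le> t powr (q-p-1)"
          unfolding e[symmetric] by (intro mult_left_mono) auto
        have m2: "t powr (-1-p) * min 1 (t powr q) \<le> t powr (-1-p)"
          using mult_left_mono[of "min 1 (t powr q)" 1 "t powr (-1-p)"] by simp
        show ?thesis
        proof (cases "t \<le> 1")
          case True
          then show ?thesis using t m by (auto simp: indicator_def abs_mult intro: order_trans)
        next
          case False
          then show ?thesis using t m2 by (auto simp: indicator_def abs_mult)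
        qed
      qed
    qed
  qed measurable
qed

text \<open>
  The value at the origin is \<open>0\<close>, because \<open>0 powr a = 0\<close>; this keeps statements about all
  \<open>y\<close> free of exceptions.
\<close>

definition frac_kernel :: "real \<Rightarrow> 'a::euclidean_space \<Rightarrow> real" where
  "frac_kernel s y = norm y powr - (real DIM('a) + 2 * s)"

lemma kernel_nonneg [simp]: "0 \<le> frac_kernel s y"
  and kernel_zero [simp]: "frac_kernel s 0 = 0"
  and kernel_minus [simp]: "frac_kernel s (- y) = frac_kernel s y"
  by (simp_all add: frac_kernel_def)

lemma kernel_measurable [measurable]: "frac_kernel s \<in> borel_measurable borel"
  unfolding frac_kernel_def[abs_def] by measurable

lemma kernel_scale:
  fixes y :: "'a::euclidean_space"
  assumes "0 < e"
  shows "frac_kernel s (e *\<^sub>R y) = e powr - (real DIM('a) + 2 * s) * frac_kernel s y"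
  using assms by (simp add: frac_kernel_def powr_mult)

lemma kernel_mono:
  fixes y :: "'a::euclidean_space"
  assumes "0 < d" "d \<le> norm y" "0 < s"
  shows "frac_kernel s y \<le> d powr - (real DIM('a) + 2 * s)"
  unfolding frac_kernel_def using assms by (intro powr_mono2') auto

lemma kernel_ge:
  fixes y :: "'a::euclidean_space"
  assumes "y \<noteq> 0" "norm y \<le> d" "0 < s"
  shows "d powr - (real DIM('a) + 2 * s) \<le> frac_kernel s y"
  unfolding frac_kernel_def using assms by (intro powr_mono2') auto

text \<open>
  The kernel is integrable against \<open>min 1 |y|\<^sup>2\<close> because \<open>0 < s < 1\<close>. Polar coordinates are
  avoided: up to a constant, the integrand at \<open>y\<close> is at most the integral of a function \<open>h\<close> of the
  radius \<open>R\<close> over \<open>|y| \<le> R \<le> 2 |y|\<close>. Exchanging the integrals leaves the volume of the balls of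
  radius \<open>R\<close> and a power integral on the half line.
\<close>

lemma integrable_kernel_cut:
  assumes "0 < s" "s < 1"
  shows "integrable lborel (\<lambda>y::'a::euclidean_space. min 1 ((norm y)\<^sup>2) * frac_kernel s y)"
proof -
  let ?n = "real DIM('a)"
  let ?C = "2 powr (?n + 2 * s + 1)"
  define h where "h R = indicator {0<..} R * (R powr (-?n - 2 * s - 1) * min 1 (R\<^sup>2))" for R :: real
  have [measurable]: "h \<in> borel_measurable borel" unfolding h_def[abs_def] by measurable
  have h0: "0 \<le> h R" for R by (simp add: h_def)
  \<comment> \<open>On the radii between |y| and 2|y|, h is at least its value at |y| up to the factor 2 powr (n + 2s + 1).\<close>
  have pt: "ennreal (min 1 ((norm y)\<^sup>2) * frac_kernel s y)
      \<le> ennreal ?C * (\<integral>\<^sup>+R. ennreal (h R) * indicator {y. norm y \<le> R} y \<partial>lborel)" for y :: 'a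
  proof (cases "y = 0")
    case False
    define a where "a = norm y"
    have a: "a > 0" using False by (simp add: a_def)
    have "ennreal ((2*a) powr (-?n - 2 * s - 1) * min 1 (a\<^sup>2)) * ennreal a
        = (\<integral>\<^sup>+R. ennreal ((2*a) powr (-?n - 2 * s - 1) * min 1 (a\<^sup>2)) * indicator {a..2*a} R \<partial>lborel)"
      using a by (subst nn_integral_cmult_indicator) auto
    also have "\<dots> \<le> (\<integral>\<^sup>+R. ennreal (h R) * indicator {y. norm y \<le> R} y \<partial>lborel)"
    proof (intro nn_integral_mono)
      fix R
      show "ennreal ((2*a) powr (-?n - 2 * s - 1) * min 1 (a\<^sup>2)) * indicator {a..2*a} R
        \<le> ennreal (h R) * indicator {y. norm y \<le> R} y"
      proof (cases "R \<in> {a..2*a}")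
        case True
        then have "(2*a) powr (-?n - 2 * s - 1) * min 1 (a\<^sup>2) \<le> R powr (-?n - 2 * s - 1) * min 1 (R\<^sup>2)"
          using a assms by (intro mult_mono powr_mono2' min.mono power_mono) auto
        moreover have "0 < R" using True a by auto
        ultimately show ?thesis using True a by (auto simp: h_def a_def indicator_def intro!: ennreal_leI)
      qed auto
    qed
    finally have 1: "ennreal ((2*a) powr (-?n - 2 * s - 1) * min 1 (a\<^sup>2)) * ennreal a
       \<le> (\<integral>\<^sup>+R. ennreal (h R) * indicator {y. norm y \<le> R} y \<partial>lborel)" .
    have "a powr (-?n - 2 * s - 1) * a = a powr (-?n-2 * s)"
      using a powr_add[of a "-?n-2 * s-1" 1] by simp
    moreover have "?C * 2 powr (-?n - 2 * s - 1) = 1"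
      by (simp add: powr_add[symmetric])
    ultimately have e: "min 1 (a\<^sup>2) * a powr (-?n-2 * s) = ?C * (((2*a) powr (-?n - 2 * s - 1) * min 1 (a\<^sup>2)) * a)"
      using a by (simp add: powr_mult)
    have "ennreal (min 1 (a\<^sup>2) * a powr (-?n-2 * s)) = ennreal ?C * (ennreal ((2*a) powr (-?n - 2 * s - 1) * min 1 (a\<^sup>2)) * ennreal a)"
      unfolding e using a by (simp add: ennreal_mult)
    also have "\<dots> \<le> ennreal ?C * (\<integral>\<^sup>+R. ennreal (h R) * indicator {y. norm y \<le> R} y \<partial>lborel)"
      by (intro mult_left_mono 1) auto
    finally show ?thesis by (simp add: frac_kernel_def a_def algebra_simps)
  qed simp
  have "(\<integral>\<^sup>+y. ennreal (min 1 ((norm y)\<^sup>2) * frac_kernel s (y::'a)) \<partial>lborel)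
      \<le> (\<integral>\<^sup>+y. ennreal ?C * (\<integral>\<^sup>+R. ennreal (h R) * indicator {y. norm y \<le> R} (y::'a) \<partial>lborel) \<partial>lborel)"
    by (intro nn_integral_mono pt)
  also have "\<dots> = ennreal ?C * (\<integral>\<^sup>+y. (\<integral>\<^sup>+R. ennreal (h R) * indicator {y. norm y \<le> R} (y::'a) \<partial>lborel) \<partial>lborel)"
    by (rule nn_integral_cmult) measurable
  also have "(\<integral>\<^sup>+y. (\<integral>\<^sup>+R. ennreal (h R) * indicator {y. norm y \<le> R} (y::'a) \<partial>lborel) \<partial>lborel)
     = (\<integral>\<^sup>+R. (\<integral>\<^sup>+y. ennreal (h R) * indicator {y. norm y \<le> R} (y::'a) \<partial>lborel) \<partial>lborel)"
    by (rule lborel_pair.Fubini'[symmetric]) measurable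
  also have "\<dots> = (\<integral>\<^sup>+R. ennreal (unit_ball_vol ?n * (indicator {0<..} R * (R powr (-1 - 2 * s) * min 1 (R powr 2)))) \<partial>lborel)"
  proof (intro nn_integral_cong)
    fix R :: real
    show "(\<integral>\<^sup>+y. ennreal (h R) * indicator {y. norm y \<le> R} (y::'a) \<partial>lborel)
       = ennreal (unit_ball_vol ?n * (indicator {0<..} R * (R powr (-1 - 2 * s) * min 1 (R powr 2))))"
    proof (cases "R > 0")
      case True
      have "(\<integral>\<^sup>+y. ennreal (h R) * indicator {y. norm y \<le> R} (y::'a) \<partial>lborel)
         = ennreal (h R) * emeasure lborel (cball (0::'a) R)"
        by (subst nn_integral_cmult_indicator) (auto simp: cball_def)
      also have "\<dots> = ennreal (h R * (unit_ball_vol ?n * R ^ DIM('a)))"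
        using True h0 by (subst emeasure_cball) (auto simp: ennreal_mult)
      also have "h R * (unit_ball_vol ?n * R ^ DIM('a)) = unit_ball_vol ?n * (indicator {0<..} R * (R powr (-1 - 2 * s) * min 1 (R powr 2)))"
      proof -
        have "R powr (-?n - 2 * s - 1) * R ^ DIM('a) = R powr (-1-2 * s)"
        proof -
          have "R powr (-1 - 2 * s) = R powr ((- ?n - 2 * s - 1) + ?n)" by (rule arg_cong) simp
          then show ?thesis by (simp only: powr_add powr_realpow[OF True])
        qed
        then show ?thesis using True by (simp add: h_def powr_numeral)
      qed
      finally show ?thesis .
    qed (simp add: h_def)
  qed
  finally have le: "(\<integral>\<^sup>+y. ennreal (min 1 ((norm y)\<^sup>2) * frac_kernel s (y::'a)) \<partial>lborel)
     \<le> ennreal ?C * (\<integral>\<^sup>+R. ennreal (unit_ball_vol ?n * (indicator {0<..} R * (R powr (-1 - 2 * s) * min 1 (R powr 2)))) \<partial>lborel)" .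
  have "(\<integral>\<^sup>+R. ennreal (unit_ball_vol ?n * (indicator {0<..} R * (R powr (-1 - 2 * s) * min 1 (R powr 2)))) \<partial>lborel) < \<infinity>"
  proof -
    have "integrable lborel (\<lambda>R. unit_ball_vol ?n * (indicator {0<..} R * (R powr (-1 - 2 * s) * min 1 (R powr 2))))"
      by (intro integrable_mult_right integrable_powr_cut) (use assms in auto)
    then show ?thesis
      by (subst (asm) integrable_iff_bounded) (auto simp: abs_mult)
  qed
  then have "(\<integral>\<^sup>+y. ennreal (min 1 ((norm y)\<^sup>2) * frac_kernel s (y::'a)) \<partial>lborel) < \<infinity>"
    by (intro le_less_trans[OF le]) (simp add: ennreal_mult_less_top)
  then show ?thesis
    by (intro integrableI_bounded) (auto simp: abs_mult)
qed

lemma integrable_kernel_outside: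
  fixes S :: "'a::euclidean_space set"
  assumes s: "0 < s" "s < 1" and [measurable]: "S \<in> sets borel" and d: "0 < d" and S: "\<And>y. y \<in> S \<Longrightarrow> d \<le> norm y"
  shows "integrable lborel (\<lambda>y. indicator S y * frac_kernel s y)"
proof (rule Bochner_Integration.integrable_bound[OF integrable_mult_right[OF integrable_kernel_cut[OF s], of "1 / min 1 (d\<^sup>2)"]])
  show "AE y in lborel. norm (indicator S y * frac_kernel s y :: real)
     \<le> norm (1 / min 1 (d\<^sup>2) * (min 1 ((norm y)\<^sup>2) * frac_kernel s y))"
  proof (rule AE_I2)
    fix y :: 'a
    show "norm (indicator S y * frac_kernel s y :: real) \<le> norm (1 / min 1 (d\<^sup>2) * (min 1 ((norm y)\<^sup>2) * frac_kernel s y))"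
    proof (cases "y \<in> S")
      case True
      then have "d\<^sup>2 \<le> (norm y)\<^sup>2" using S d by (intro power_mono) auto
      then have "min 1 (d\<^sup>2) \<le> min 1 ((norm y)\<^sup>2)" by (intro min.mono) auto
      then have "1 \<le> min 1 ((norm y)\<^sup>2) / min 1 (d\<^sup>2)" using d by (subst le_divide_eq_1_pos) auto
      then have "frac_kernel s y \<le> min 1 ((norm y)\<^sup>2) / min 1 (d\<^sup>2) * frac_kernel s y"
        using mult_right_mono[of 1 _ "frac_kernel s y"] by fastforce
      then show ?thesis using True d by (simp add: abs_mult)
    qed simp
  qed
qed measurable

lemma kernel_outside_ball_scale:
  fixes d :: real
  assumes s: "0 < s" "s < 1" and d: "0 < d"
  shows "(\<integral>y. indicator (- ball 0 d) y * frac_kernel s (y::'a::euclidean_space) \<partial>lborel)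
     = d powr (- 2 * s) * (\<integral>y. indicator (- ball 0 1) y * frac_kernel s (y::'a) \<partial>lborel)"
proof -
  have "(\<integral>y. indicator (- ball 0 d) y * frac_kernel s (y::'a) \<partial>lborel)
     = \<bar>d\<bar> ^ DIM('a) * (\<integral>y. indicator (- ball 0 d) (0 + d *\<^sub>R y) * frac_kernel s (0 + d *\<^sub>R y::'a) \<partial>lborel)"
    by (rule integral_affine_euclidean) (use d in auto)
  also have "(\<lambda>y::'a. indicator (- ball 0 d) (0 + d *\<^sub>R y) * frac_kernel s (0 + d *\<^sub>R y))
     = (\<lambda>y. d powr - (real DIM('a) + 2 * s) * (indicator (- ball 0 1) y * frac_kernel s y))"
    using d by (auto simp: fun_eq_iff indicator_def kernel_scale)
  also have "\<bar>d\<bar> ^ DIM('a) * (\<integral>y. d powr - (real DIM('a) + 2 * s) * (indicator (- ball 0 1) y * frac_kernel s (y::'a)) \<partial>lborel)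
     = (\<bar>d\<bar> ^ DIM('a) * d powr - (real DIM('a) + 2 * s)) * (\<integral>y. (indicator (- ball 0 1) y * frac_kernel s (y::'a)) \<partial>lborel)"
    by simp
  also have "\<bar>d\<bar> ^ DIM('a) * d powr - (real DIM('a) + 2 * s) = d powr (-2 * s)"
    using d by (simp add: powr_realpow[symmetric] powr_add[symmetric])
  finally show ?thesis .
qed

section \<open>Gaussian mixtures\<close>

text \<open>
  This is \<open>\<Gamma>(p)\<close>, in the variable \<open>1 / t\<close>. Only its positivity matters here.
\<close>

definition inv_gamma_integral :: "real \<Rightarrow> real" where
  "inv_gamma_integral p = (\<integral>t. indicator {0<..} t * (t powr (-1 - p) * exp (- 1 / t)) \<partial>lborel)"

lemma exp_minus_inverse_le:
  assumes "0 < t" "0 < k"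
  shows "exp (- 1 / t) \<le> real k ^ k * min 1 (t ^ k)"
proof -
  have "(1 / t / real k)^k \<le> (1 + 1 / t / real k)^k"
    by (rule power_mono) (use assms in auto)
  also have "\<dots> \<le> exp (1 / t)"
    using exp_ge_one_plus_x_over_n_power_n[of k "1/t"] assms by (simp add: order_trans[of _ 0])
  finally have "exp (- (1 / t)) \<le> real k ^ k * t^k"
    using assms by (simp add: exp_minus field_simps power_divide power_mult_distrib)
  moreover have "exp (- (1 / t)) \<le> real k ^ k"
  proof -
    have "exp (- (1 / t)) \<le> 1" using assms by simp
    also have "1 \<le> real k ^ k" by (rule one_le_power) (use assms in auto)
    finally show ?thesis .
  qed
  ultimately show ?thesis by (simp add: min_def)
qed

lemma inv_gamma_integrable:
  assumes "0 < p"
  shows "integrable lborel (\<lambda>t::real. indicator {0<..} t * (t powr (-1 - p) * exp (- 1 / t)))"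
proof -
  obtain k :: nat where k: "p < real k" using reals_Archimedean2 by blast
  then have k0: "0 < k" using assms by (intro Nat.gr0I) auto
  show ?thesis
  proof (rule Bochner_Integration.integrable_bound[OF integrable_mult_right[OF integrable_powr_cut[OF assms k], of "real k ^ k"]])
    show "AE t in lborel. norm (indicator {0<..} t * (t powr (-1 - p) * exp (- 1 / t)))
      \<le> norm (real k ^ k * (indicator {0<..} t * (t powr (-1 - p) * min 1 (t powr real k))))"
    proof (rule AE_I2)
      fix t :: real
      show "norm (indicator {0<..} t * (t powr (-1 - p) * exp (- 1 / t)))
      \<le> norm (real k ^ k * (indicator {0<..} t * (t powr (-1 - p) * min 1 (t powr real k))))"
      proof (cases "t > 0")
        case True
        have "t powr (-1-p) * exp (-1/t) \<le> t powr (-1-p) * (real k ^ k * min 1 (t^k))"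
          by (intro mult_left_mono exp_minus_inverse_le True k0) auto
        then show ?thesis using True by (simp add: abs_mult powr_realpow algebra_simps)
      qed simp
    qed
  qed measurable
qed

lemma inv_gamma_integral_pos:
  assumes "0 < p" shows "0 < inv_gamma_integral p"
proof -
  let ?f = "\<lambda>t::real. indicator {0<..} t * (t powr (-1 - p) * exp (- 1 / t))"
  have nn: "0 \<le> ?f t" for t by simp
  have "inv_gamma_integral p \<noteq> 0"
  proof
    assume "inv_gamma_integral p = 0"
    then have "AE t in lborel. ?f t = 0"
      using integral_nonneg_eq_0_iff_AE[OF inv_gamma_integrable[OF assms]] nn
      unfolding inv_gamma_integral_def by auto
    then have "AE t in lborel. t \<notin> {0<..<1::real}"
      by eventually_elim auto
    then have "{0<..<1::real} \<in> null_sets lborel"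
      by (subst (asm) AE_iff_null_sets[symmetric]) auto
    then show False by (auto simp: null_sets_def)
  qed
  moreover have "0 \<le> inv_gamma_integral p"
    unfolding inv_gamma_integral_def by (rule Bochner_Integration.integral_nonneg) simp
  ultimately show ?thesis by simp
qed

lemma inv_gamma_scale:
  assumes "0 < p" "0 < a"
  shows "integrable lborel (\<lambda>t. indicator {0<..} t * (t powr (-1 - p) * exp (- a / t)))"
    and "(\<integral>t. indicator {0<..} t * (t powr (-1 - p) * exp (- a / t)) \<partial>lborel) = a powr (-p) * inv_gamma_integral p"
proof -
  have e: "(\<lambda>t. indicator {0<..} (0 + a * t) * ((0 + a * t) powr (-1 - p) * exp (- a / (0 + a * t))))
     = (\<lambda>t. a powr (-1-p) * (indicator {0<..} t * (t powr (-1 - p) * exp (- 1 / t))))"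
    using assms by (auto simp: fun_eq_iff indicator_def powr_mult zero_less_mult_iff)
  show "integrable lborel (\<lambda>t. indicator {0<..} t * (t powr (-1 - p) * exp (- a / t)))"
    by (subst lborel_integrable_real_affine_iff[where c=a and t=0, symmetric])
       (use assms e inv_gamma_integrable in auto)
  have "(\<integral>t. indicator {0<..} t * (t powr (-1 - p) * exp (- a / t)) \<partial>lborel)
     = \<bar>a\<bar> *\<^sub>R (\<integral>t. indicator {0<..} (0 + a * t) * ((0 + a * t) powr (-1 - p) * exp (- a / (0 + a * t))) \<partial>lborel)"
    by (rule lborel_integral_real_affine) (use assms in auto)
  also have "\<dots> = a * (a powr (-1-p) * inv_gamma_integral p)"
    unfolding e inv_gamma_integral_def using assms by simp
  also have "\<dots> = (a * a powr (-1-p)) * inv_gamma_integral p" by simp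
  also have "a * a powr (-1-p) = a powr (-p)"
    using assms powr_add[of a 1 "-1-p"] by simp
  finally show "(\<integral>t. indicator {0<..} t * (t powr (-1 - p) * exp (- a / t)) \<partial>lborel) = a powr (-p) * inv_gamma_integral p" .
qed

text \<open>
  The kernel is a superposition of heat kernels, by scaling \<open>t\<close> with \<open>|y|\<^sup>2\<close>. It reduces the sign of
  the fractional Laplacian to the effect of Gaussian averages, which are explicit on Gaussians.
\<close>

lemma kernel_gaussian_mixture:
  fixes y :: "'a::euclidean_space"
  assumes "y \<noteq> 0" "0 < s" and p: "p = real DIM('a) / 2 + s"
  shows "integrable lborel (\<lambda>t. indicator {0<..} t * (t powr (-1 - p) * exp (- (norm y)\<^sup>2 / t)))"
    and "(\<integral>t. indicator {0<..} t * (t powr (-1 - p) * exp (- (norm y)\<^sup>2 / t)) \<partial>lborel)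
       = frac_kernel s y * inv_gamma_integral p"
proof -
  have p0: "p > 0" using assms by (auto intro: add_nonneg_pos)
  show "integrable lborel (\<lambda>t. indicator {0<..} t * (t powr (-1 - p) * exp (- (norm y)\<^sup>2 / t)))"
    using inv_gamma_scale(1)[OF p0, of "(norm y)\<^sup>2"] assms by simp
  have "(norm y)\<^sup>2 powr (-p) = (norm y powr 2) powr (-p)"
    by (simp add: powr_numeral)
  also have "\<dots> = frac_kernel s y"
    unfolding frac_kernel_def powr_powr p by (rule arg_cong[where f="\<lambda>x. norm y powr x"]) (simp add: algebra_simps)
  finally show "(\<integral>t. indicator {0<..} t * (t powr (-1 - p) * exp (- (norm y)\<^sup>2 / t)) \<partial>lborel)
       = frac_kernel s y * inv_gamma_integral p"
    using inv_gamma_scale(2)[OF p0, of "(norm y)\<^sup>2"] assms by simp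
qed

text \<open>
  Away from the unit ball a Gaussian is dominated by the singular kernel.
\<close>

lemma integrable_gaussian: "integrable lborel (\<lambda>y::'a::euclidean_space. exp (- c * (norm y)\<^sup>2))" if "0 < c"
proof -
  have "integrable lborel (\<lambda>y::'a. exp (- (norm y)\<^sup>2))"
  proof -
    \<comment> \<open>Any exponent 2k beyond the decay n + 1 of the kernel with s = 1/2 would do.\<close>
    obtain k where k: "k \<ge> DIM('a) + 2" by blast
    have i1: "integrable lborel (\<lambda>y::'a. indicator (cball 0 1) y :: real)"
      by (intro integrable_real_indicator) (auto simp: emeasure_cball)
    have i2: "integrable lborel (\<lambda>y::'a. real k ^ k * (indicator (- ball 0 1) y * frac_kernel (1/2) y))"
      by (intro integrable_mult_right integrable_kernel_outside[where d=1]) auto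
    show ?thesis
    proof (rule Bochner_Integration.integrable_bound[OF Bochner_Integration.integrable_add[OF i1 i2]])
      show "AE y::'a in lborel. norm (exp (- (norm y)\<^sup>2)) \<le>
         norm (indicator (cball 0 1) y + real k ^ k * (indicator (- ball 0 1) y * frac_kernel (1/2) y))"
      proof (rule AE_I2)
        fix y :: 'a
        show "norm (exp (- (norm y)\<^sup>2)) \<le>
          norm (indicator (cball 0 1) y + real k ^ k * (indicator (- ball 0 1) y * frac_kernel (1/2) y))"
        proof (cases "norm y \<le> 1")
          case True
          have "exp (-(norm y)\<^sup>2) \<le> 1" by simp
          moreover have "1 \<le> indicator (cball 0 1) y + real k ^ k * (indicator (- ball 0 1) y * frac_kernel (1/2) y)"
            using True by simp
          ultimately show ?thesis unfolding real_norm_def abs_exp_cancel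
            by (smt (verit) abs_ge_self)
        next
          case False
          then have y: "norm y > 1" by simp
          let ?a = "norm y"
          have "exp (- 1/(1/?a\<^sup>2)) \<le> real k ^ k * min 1 ((1/?a\<^sup>2)^k)"
            by (rule exp_minus_inverse_le) (use y k in auto)
          also have "\<dots> \<le> real k ^ k * ((1/?a\<^sup>2)^k)" by (intro mult_left_mono) auto
          finally have e: "exp (- 1/(1/?a\<^sup>2)) \<le> real k ^ k * ((1/?a\<^sup>2)^k)" .
          have "(1/?a\<^sup>2)^k \<le> frac_kernel (1/2) y"
          proof -
            have "(1/?a\<^sup>2)^k = ?a powr (- 2 * real k)"
              using y by (auto simp: powr_minus powr_realpow[symmetric] divide_simps power_mult[symmetric])
            also have "\<dots> \<le> frac_kernel (1/2) y"
              unfolding frac_kernel_def using y k by (intro powr_mono) auto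
            finally show ?thesis .
          qed
          then have "real k ^ k * ((1/?a\<^sup>2)^k) \<le> real k ^ k * frac_kernel (1/2) y"
            by (intro mult_left_mono) auto
          with e have "exp (- (norm y)\<^sup>2) \<le> real k ^ k * frac_kernel (1/2) y" by simp
          then show ?thesis using y by (auto simp: indicator_def)
        qed
      qed
    qed measurable
  qed
  from integrable_affine_euclidean[OF this, of "sqrt c" 0] that
  show ?thesis by (simp add: power_mult_distrib)
qed

definition gaussian_mass :: "'a::euclidean_space itself \<Rightarrow> real" where
  "gaussian_mass _ = (\<integral>y. exp (- (norm (y::'a))\<^sup>2) \<partial>lborel)"

lemma gaussian_mass_pos: "0 < gaussian_mass TYPE('a::euclidean_space)"
proof -
  have i: "integrable lborel (\<lambda>y::'a. exp (- (norm y)\<^sup>2))"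
    using integrable_gaussian[of 1] by simp
  have "gaussian_mass TYPE('a) \<noteq> 0"
  proof
    assume "gaussian_mass TYPE('a) = 0"
    then have "AE y::'a in lborel. exp (- (norm y)\<^sup>2) = 0"
      using integral_nonneg_eq_0_iff_AE[OF i] unfolding gaussian_mass_def by auto
    then have "AE y::'a in lborel. False" by simp
    then show False by (simp add: eventually_False ae_filter_eq_bot_iff)
  qed
  moreover have "0 \<le> gaussian_mass TYPE('a)"
    unfolding gaussian_mass_def by (rule Bochner_Integration.integral_nonneg) simp
  ultimately show ?thesis by simp
qed

lemma gaussian_integral:
  assumes "0 < c"
  shows "(\<integral>y. exp (- c * (norm (t + y::'a::euclidean_space))\<^sup>2) \<partial>lborel) = c powr (- real DIM('a) / 2) * gaussian_mass TYPE('a)"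
proof -
  have "gaussian_mass TYPE('a) = \<bar>sqrt c\<bar>^DIM('a) * (\<integral>y. exp (- (norm (sqrt c *\<^sub>R t + sqrt c *\<^sub>R y::'a))\<^sup>2) \<partial>lborel)"
    unfolding gaussian_mass_def by (rule integral_affine_euclidean) (use assms in auto)
  also have "(\<lambda>y::'a. exp (- (norm (sqrt c *\<^sub>R t + sqrt c *\<^sub>R y::'a))\<^sup>2)) = (\<lambda>y. exp (- c * (norm (t + y))\<^sup>2))"
    using assms by (simp add: scaleR_add_right[symmetric] power_mult_distrib del: scaleR_add_right)
  also have "\<bar>sqrt c\<bar>^DIM('a) = c powr (real DIM('a) / 2)"
    using assms by (simp add: powr_half_sqrt[symmetric] powr_realpow[symmetric] powr_powr)
  finally have "gaussian_mass TYPE('a) = c powr (real DIM('a) / 2) * (\<integral>y. exp (- c * (norm (t + y::'a))\<^sup>2) \<partial>lborel)" .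
  then show ?thesis using assms by (simp add: powr_minus field_simps)
qed

section \<open>The fractional Laplacian through second differences\<close>

definition second_diff :: "('a::euclidean_space \<Rightarrow> real) \<Rightarrow> 'a \<Rightarrow> 'a \<Rightarrow> real" where
  "second_diff f x y = 2 * f x - f (x + y) - f (x - y)"

text \<open>
  The fractional Laplacian without its normalising constant, as an absolutely convergent integral of
  second differences instead of a principal value.
\<close>

definition frac_op :: "real \<Rightarrow> ('a::euclidean_space \<Rightarrow> real) \<Rightarrow> 'a \<Rightarrow> real" where
  "frac_op s f x = (\<integral>y. second_diff f x y * frac_kernel s y \<partial>lborel) / 2"

lemma second_diff_measurable [measurable]:
  assumes [measurable]: "f \<in> borel_measurable borel"
  shows "second_diff f x \<in> borel_measurable borel"
  unfolding second_diff_def[abs_def] by measurable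

lemma second_diff_zero [simp]: "second_diff f x 0 = 0"
  by (simp add: second_diff_def)

lemma integrable_second_diff_kernel:
  fixes f :: "'a::euclidean_space \<Rightarrow> real"
  assumes s: "0 < s" "s < 1" and [measurable]: "f \<in> borel_measurable borel"
    and B: "\<And>y. \<bar>second_diff f x y\<bar> \<le> B * min 1 ((norm y)\<^sup>2)"
  shows "integrable lborel (\<lambda>y. second_diff f x y * frac_kernel s y)"
proof (rule Bochner_Integration.integrable_bound[OF integrable_mult_right[OF integrable_kernel_cut[OF s], of B]])
  show "AE y in lborel. norm (second_diff f x y * frac_kernel s y) \<le> norm (B * (min 1 ((norm y)\<^sup>2) * frac_kernel s y))"
  proof (rule AE_I2)
    fix y :: 'a
    have "\<bar>second_diff f x y\<bar> * frac_kernel s y \<le> (B * min 1 ((norm y)\<^sup>2)) * frac_kernel s y"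
      by (intro mult_right_mono B) simp
    also have "\<dots> \<le> \<bar>B * (min 1 ((norm y)\<^sup>2) * frac_kernel s y)\<bar>"
      by (simp add: mult.assoc abs_ge_self)
    finally show "norm (second_diff f x y * frac_kernel s y) \<le> norm (B * (min 1 ((norm y)\<^sup>2) * frac_kernel s y))"
      by (simp add: abs_mult)
  qed
qed measurable

text \<open>
  Two applications of the mean value theorem, to \<open>h t + h (- t)\<close> and then to \<open>h'\<close>.
\<close>

lemma second_diff_real_bound:
  fixes h :: "real \<Rightarrow> real"
  assumes h1: "\<And>t. (h has_real_derivative h' t) (at t)"
    and h2: "\<And>t. (h' has_real_derivative h'' t) (at t)"
    and B: "\<And>t. \<bar>h'' t\<bar> \<le> B"
  shows "\<bar>2 * h 0 - h 1 - h (-1)\<bar> \<le> 2 * B"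
proof -
  have g: "((\<lambda>t. h t + h (- t)) has_real_derivative (h' t - h' (- t))) (at t)" for t
    by (auto intro!: derivative_eq_intros DERIV_chain2[OF h1] h1)
  obtain z where z: "0 < z" "z < 1" and e1: "(h 1 + h (-1)) - (h 0 + h (-0)) = (1 - 0) * (h' z - h' (-z))"
    using MVT2[of 0 1 "\<lambda>t. h t + h (- t)" "\<lambda>t. h' t - h' (- t)"] g by auto
  obtain w where w: "-z < w" "w < z" and e2: "h' z - h' (-z) = (z - (-z)) * h'' w"
    using MVT2[of "-z" z h' h''] h2 z by auto
  have "\<bar>2 * h 0 - h 1 - h (-1)\<bar> = \<bar>2 * z * h'' w\<bar>" using e1 e2 by simp
  also have "\<dots> = 2 * z * \<bar>h'' w\<bar>" using z by (simp add: abs_mult)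
  also have "\<dots> \<le> 2 * 1 * B" using z B[of w] by (intro mult_mono) auto
  finally show ?thesis by simp
qed

lemma x_exp_minus_le_1: "(u::real) * exp (- u) \<le> 1"
proof -
  have "u \<le> exp u" using exp_ge_add_one_self[of u] by linarith
  then show ?thesis by (simp add: exp_minus field_simps)
qed

text \<open>
  The Hessian of a Gaussian of exponent \<open>l\<close> is of order \<open>l\<close>, since \<open>u exp (- u) \<le> 1\<close>.
\<close>

lemma second_diff_gaussian:
  fixes x y :: "'a::euclidean_space"
  assumes "1 \<le> l"
  shows "\<bar>second_diff (\<lambda>x. exp (- l * (norm x)\<^sup>2)) x y\<bar> \<le> 12 * l * min 1 ((norm y)\<^sup>2)"
proof -
  let ?g = "\<lambda>x::'a. exp (- l * (norm x)\<^sup>2)"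
  define h where "h t = exp (- l * ((x + t *\<^sub>R y) \<bullet> (x + t *\<^sub>R y)))" for t :: real
  define h' where "h' t = - 2 * l * ((x + t *\<^sub>R y) \<bullet> y) * h t" for t
  define h'' where "h'' t = (4 * l^2 * ((x + t *\<^sub>R y) \<bullet> y)^2 - 2 * l * (y \<bullet> y)) * h t" for t
  have h1: "(h has_real_derivative h' t) (at t)" for t
    unfolding h_def h'_def
    by (auto intro!: derivative_eq_intros simp: has_real_derivative_iff_has_vector_derivative[symmetric] inner_commute algebra_simps inner_add_left inner_add_right)
  have h2: "(h' has_real_derivative h'' t) (at t)" for t
    unfolding h'_def h''_def
    by (auto intro!: derivative_eq_intros h1 simp: h'_def power2_eq_square inner_commute algebra_simps)
  have B: "\<bar>h'' t\<bar> \<le> 6 * l * (norm y)\<^sup>2" for t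
  proof -
    let ?w = "x + t *\<^sub>R y"
    have ht: "h t = exp (- (l * (norm ?w)\<^sup>2))" by (simp add: h_def dot_square_norm)
    have h0: "0 \<le> h t" "h t \<le> 1" using assms by (auto simp: ht)
    have "(?w \<bullet> y)^2 \<le> (norm ?w)\<^sup>2 * (norm y)\<^sup>2"
      using Cauchy_Schwarz_ineq[of ?w y] by (simp add: dot_square_norm)
    then have "4 * l^2 * (?w \<bullet> y)^2 * h t \<le> 4 * l^2 * ((norm ?w)\<^sup>2 * (norm y)\<^sup>2) * h t"
      using h0 assms by (intro mult_right_mono mult_left_mono) auto
    also have "\<dots> = (4 * l * (norm y)\<^sup>2) * ((l * (norm ?w)\<^sup>2) * exp (- (l * (norm ?w)\<^sup>2)))"
      by (simp add: ht power2_eq_square)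
    also have "\<dots> \<le> (4 * l * (norm y)\<^sup>2) * 1"
      using assms by (intro mult_left_mono x_exp_minus_le_1) auto
    finally have 1: "4 * l^2 * (?w \<bullet> y)^2 * h t \<le> 4 * l * (norm y)\<^sup>2" by simp
    have 2: "2 * l * (norm y)\<^sup>2 * h t \<le> 2 * l * (norm y)\<^sup>2 * 1"
      using h0 assms by (intro mult_left_mono) auto
    have 3: "0 \<le> 4 * l^2 * (?w \<bullet> y)^2 * h t" "0 \<le> 2 * l * (norm y)\<^sup>2 * h t" using h0 assms by auto
    have "h'' t = 4 * l^2 * (?w \<bullet> y)^2 * h t - 2 * l * (norm y)\<^sup>2 * h t"
      by (simp add: h''_def algebra_simps dot_square_norm)
    then show ?thesis using 1 2 3 by linarith
  qed
  have e: "second_diff ?g x y = 2 * h 0 - h 1 - h (-1)"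
    by (simp add: second_diff_def h_def dot_square_norm)
  have 1: "\<bar>second_diff ?g x y\<bar> \<le> 12 * l * (norm y)\<^sup>2"
    unfolding e using second_diff_real_bound[OF h1 h2 B] by simp
  have "0 \<le> ?g z \<and> ?g z \<le> 1" for z using assms by auto
  from this[of x] this[of "x+y"] this[of "x-y"]
  have 2: "\<bar>second_diff ?g x y\<bar> \<le> 12 * l * 1"
    unfolding second_diff_def using assms by linarith
  show ?thesis using 1 2 by (simp add: min_def)
qed

section \<open>A logarithmic barrier\<close>

text \<open>
  As \<open>L\<close> grows, \<open>barrier_profile L (|x|\<^sup>2)\<close> approximates \<open>- 2 ln |x|\<close> near the origin, smoothly, with
  value \<open>ln L\<close> at the origin. The function \<open>- ln |x|\<close> is superharmonic in every dimension \<open>n \<ge> 2\<close>, and being a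
  superposition of Gaussians makes its Gaussian averages explicit.
\<close>

definition barrier_profile :: "real \<Rightarrow> real \<Rightarrow> real" where
  "barrier_profile L a = (\<integral>l. indicator {1..L} l * (exp (- l * a) / l) \<partial>lborel)"

abbreviation barrier :: "real \<Rightarrow> 'a::euclidean_space \<Rightarrow> real" where
  "barrier L x \<equiv> barrier_profile L ((norm x)\<^sup>2)"

lemma integrable_Icc_continuous:
  fixes f :: "real \<Rightarrow> real"
  assumes "continuous_on {p..q} f"
  shows "integrable lborel (\<lambda>l. indicator {p..q} l * f l)"
    and "(\<integral>l. indicator {p..q} l * f l \<partial>lborel) = integral {p..q} f"
proof -
  have "set_integrable lborel {p..q} f" by (rule borel_integrable_atLeastAtMost'[OF assms])
  then show "integrable lborel (\<lambda>l. indicator {p..q} l * f l)" 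
    "(\<integral>l. indicator {p..q} l * f l \<partial>lborel) = integral {p..q} f"
    using set_borel_integral_eq_integral(2)[of "{p..q}" f]
    by (auto simp: set_integrable_def set_lebesgue_integral_def)
qed

lemma barrier_integrable: "integrable lborel (\<lambda>l. indicator {1..L} l * (exp (- l * a) / l))"
  and barrier_eq_integral: "barrier_profile L a = integral {1..L} (\<lambda>l. exp (- l * a) / l)"
  unfolding barrier_profile_def
  by (intro integrable_Icc_continuous continuous_intros; auto)+

lemma barrier_profile_measurable [measurable]: "barrier_profile L \<in> borel_measurable borel"
  unfolding barrier_profile_def[abs_def] by measurable

lemma barrier_profile_nonneg: "0 \<le> barrier_profile L a"
  unfolding barrier_profile_def by (rule Bochner_Integration.integral_nonneg) (auto simp: indicator_def)

lemma integral_exp_le: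
  fixes L a :: real
  assumes "1 \<le> L" "0 \<le> a"
  shows "integral {1..L} (\<lambda>l. exp (- l * a)) \<le> L"
    and "0 < a \<Longrightarrow> integral {1..L} (\<lambda>l. exp (- l * a)) \<le> 1 / a"
proof -
  have "integral {1..L} (\<lambda>l. exp (- l * a)) \<le> integral {1..L} (\<lambda>l. 1)"
    by (intro integral_le integrable_continuous_real continuous_intros) (use assms in auto)
  then show "integral {1..L} (\<lambda>l. exp (- l * a)) \<le> L" using assms by simp
  assume a: "0 < a"
  have "((\<lambda>l. exp (- l * a)) has_integral (- exp (- L * a) / a) - (- exp (- 1 * a) / a)) {1..L}"
    using assms a
    by (intro fundamental_theorem_of_calculus)
       (auto intro!: derivative_eq_intros simp: has_real_derivative_iff_has_vector_derivative[symmetric])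
  then have "integral {1..L} (\<lambda>l. exp (- l * a)) = exp (- a) / a - exp (- L * a) / a"
    by (simp add: integral_unique)
  also have "\<dots> \<le> 1 / a"
  proof -
    have "exp (-a) / a \<le> 1 / a" using a by (intro divide_right_mono) auto
    moreover have "0 \<le> exp (- L * a) / a" using a by simp
    ultimately show ?thesis by linarith
  qed
  finally show "integral {1..L} (\<lambda>l. exp (- l * a)) \<le> 1 / a" .
qed

text \<open>
  Convexity of the exponential bounds the difference by the derivative at the new point, in either
  order of the two points; the derivative is the integral of \<open>exp (- l c)\<close>.
\<close>

lemma barrier_profile_diff:
  assumes "\<And>c. d \<le> c \<Longrightarrow> integral {1..L} (\<lambda>l. exp (- l * c)) \<le> K" 
    "d \<le> a" "d \<le> a'"
  shows "barrier_profile L a' - barrier_profile L a \<le> K * \<bar>a' - a\<bar>"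
proof -
  have pt: "exp (- l * a') / l - exp (- l * a) / l \<le> (a - a') * exp (- l * a')" if l: "l \<in> {1..L}" for l
  proof -
    have "1 + l * (a' - a) \<le> exp (l * (a' - a))" by simp
    then have "exp (- l * a') * (1 + l * (a' - a)) \<le> exp (- l * a') * exp (l * (a' - a))"
      by (intro mult_left_mono) auto
    also have "\<dots> = exp (- l * a)" by (simp add: exp_add[symmetric] algebra_simps)
    finally show ?thesis using l by (simp add: field_simps)
  qed
  have "barrier_profile L a' - barrier_profile L a
     = integral {1..L} (\<lambda>l. exp (- l * a') / l - exp (- l * a) / l)"
    unfolding barrier_eq_integral
    by (intro Henstock_Kurzweil_Integration.integral_diff[symmetric] integrable_continuous_real continuous_intros) auto
  also have "\<dots> \<le> integral {1..L} (\<lambda>l. (a - a') * exp (- l * a'))"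
    by (intro integral_le integrable_continuous_real continuous_intros pt) auto
  also have "\<dots> = (a - a') * integral {1..L} (\<lambda>l. exp (- l * a'))" by simp
  also have "\<dots> \<le> \<bar>a' - a\<bar> * integral {1..L} (\<lambda>l. exp (- l * a'))"
    by (intro mult_right_mono Henstock_Kurzweil_Integration.integral_nonneg integrable_continuous_real continuous_intros) auto
  also have "\<dots> \<le> \<bar>a' - a\<bar> * K"
    by (intro mult_left_mono assms) auto
  finally show ?thesis by (simp add: mult.commute)
qed

lemma barrier_profile_lipschitz:
  assumes "1 \<le> L" "0 \<le> a" "0 \<le> a'"
  shows "\<bar>barrier_profile L a' - barrier_profile L a\<bar> \<le> L * \<bar>a' - a\<bar>"
  using barrier_profile_diff[of 0 L L a a'] barrier_profile_diff[of 0 L L a' a] integral_exp_le(1)[of L] assms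
  by (auto simp: abs_minus_commute abs_le_iff)

lemma barrier_profile_lipschitz':
  assumes "1 \<le> L" "0 < d" "d \<le> a" "d \<le> a'"
  shows "\<bar>barrier_profile L a' - barrier_profile L a\<bar> \<le> (1 / d) * \<bar>a' - a\<bar>"
proof -
  have *: "integral {1..L} (\<lambda>l. exp (- l * c)) \<le> 1 / d" if "d \<le> c" for c
  proof -
    have "1 / c \<le> 1 / d" using that assms by (intro divide_left_mono) auto
    then show ?thesis using integral_exp_le(2)[of L c] that assms by auto
  qed
  show ?thesis
    using barrier_profile_diff[of d L "1/d" a a'] barrier_profile_diff[of d L "1/d" a' a] * assms
    by (auto simp: abs_minus_commute abs_le_iff)
qed

lemma barrier_profile_le:
  assumes "1 \<le> L" "0 < a"
  shows "barrier_profile L a \<le> 1 / a"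
proof -
  have "barrier_profile L a \<le> integral {1..L} (\<lambda>l. exp (- l * a))"
    unfolding barrier_eq_integral
    by (intro integral_le integrable_continuous_real continuous_intros) (auto simp: divide_le_eq mult_le_cancel_left1)
  then show ?thesis using integral_exp_le(2)[of L a] assms by linarith
qed

lemma barrier_profile_0:
  assumes "1 \<le> L" shows "barrier_profile L 0 = ln L"
proof -
  have "((\<lambda>l. exp (- l * 0) / l) has_integral (ln L - ln 1)) {1..L}"
    using assms by (intro fundamental_theorem_of_calculus)
       (auto intro!: derivative_eq_intros simp: has_real_derivative_iff_has_vector_derivative[symmetric])
  then show ?thesis unfolding barrier_eq_integral by (simp add: integral_unique)
qed

lemma barrier_continuous:
  assumes L: "1 \<le> L" shows "continuous_on UNIV (\<lambda>x::'a::euclidean_space. barrier L x)"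
proof -
  have "L-lipschitz_on {0..} (barrier_profile L)"
    using L barrier_profile_lipschitz[OF L] by (intro lipschitz_onI) (auto simp: dist_real_def)
  then have "continuous_on {0..} (barrier_profile L)" by (rule lipschitz_on_continuous_on)
  then show ?thesis
    by (rule continuous_on_compose2) (auto intro!: continuous_intros)
qed

lemma second_diff_barrier:
  fixes x y :: "'a::euclidean_space"
  assumes L: "1 \<le> L"
  shows "\<bar>second_diff (\<lambda>x. barrier L x) x y\<bar> \<le> 12 * L * min 1 ((norm y)\<^sup>2)"
proof -
  let ?m = "min 1 ((norm y)\<^sup>2)"
  have e: "second_diff (\<lambda>x. barrier L x) x y
     = (\<integral>l. indicator {1..L} l * (second_diff (\<lambda>x. exp (- l * (norm x)\<^sup>2)) x y / l) \<partial>lborel)"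
  proof -
    let ?F = "\<lambda>z l. indicator {1..L} l * (exp (- l * (norm (z::'a))\<^sup>2) / l) :: real"
    have i: "integrable lborel (?F z)" for z by (rule barrier_integrable)
    have "second_diff (\<lambda>x. barrier L x) x y = (\<integral>l. 2 * ?F x l - ?F (x + y) l - ?F (x - y) l \<partial>lborel)"
      unfolding second_diff_def barrier_profile_def
      by (subst Bochner_Integration.integral_diff Bochner_Integration.integral_mult_right, intro i Bochner_Integration.integrable_diff integrable_mult_right, (intro i)?)+ simp
    also have "\<dots> = (\<integral>l. indicator {1..L} l * (second_diff (\<lambda>x. exp (- l * (norm x)\<^sup>2)) x y / l) \<partial>lborel)"
      by (intro Bochner_Integration.integral_cong) (auto simp: second_diff_def indicator_def diff_divide_distrib)
    finally show ?thesis .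
  qed
  have "\<bar>second_diff (\<lambda>x. barrier L x) x y\<bar>
     \<le> (\<integral>l. norm (indicator {1..L} l * (second_diff (\<lambda>x. exp (- l * (norm x)\<^sup>2)) x y / l)) \<partial>lborel)"
    unfolding e real_norm_def[symmetric] by (rule integral_norm_bound)
  also have "\<dots> \<le> (\<integral>l. indicator {1..L} l * (12 * ?m) \<partial>lborel)"
  proof (intro integral_mono_AE' integrable_Icc_continuous AE_I2)
    fix l :: real
    show "norm (indicator {1..L} l * (second_diff (\<lambda>x. exp (- l * (norm x)\<^sup>2)) x y / l)) \<le> indicator {1..L} l * (12 * ?m)"
    proof (cases "l \<in> {1..L}")
      case True
      then show ?thesis using second_diff_gaussian[of l x y] by (simp add: divide_le_eq algebra_simps)
    qed simp
  qed (auto intro!: continuous_intros)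
  also have "\<dots> = (L - 1) * (12 * ?m)"
    using L by (subst integrable_Icc_continuous) auto
  also have "\<dots> \<le> L * (12 * ?m)" by (intro mult_right_mono) auto
  finally show ?thesis by (simp add: algebra_simps)
qed

text \<open>
  Heat flow for time \<open>t\<close> turns the exponent \<open>l\<close> into \<open>m = l / (1 + l t)\<close>, and
  \<open>dm / m = dl / (l (1 + l t))\<close>. So in the superposition with weight \<open>dl / l\<close> the flow only shifts
  the interval of exponents.
\<close>

lemma integral_exp_div_shift:
  assumes L: "1 \<le> L" and t: "0 < t" and a: "0 \<le> (a::real)"
  shows "integral {1..L} (\<lambda>l. exp (- (a * (l / (1 + l * t)))) / (l * (1 + l * t)))
     = integral {1 / (1 + t)..L / (1 + L * t)} (\<lambda>m. exp (- (m * a)) / m)"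
proof -
  define g where "g l = l / (1 + l * t)" for l
  have pos: "1 + l * t > 0" if "l \<ge> 1" for l using that t by (auto intro!: add_pos_nonneg)
  have mono: "g l \<le> g l'" if "1 \<le> l" "l \<le> l'" for l l'
    unfolding g_def using pos[of l] pos[of l'] that by (simp add: field_simps)
  have "((\<lambda>l. (1 / (1 + l * t)^2) *\<^sub>R (exp (- (g l * a)) / g l)) has_integral
      (integral {g 1..g L} (\<lambda>m. exp (- (m * a)) / m))) {1..L}"
  proof (rule has_integral_substitution[where c="g 1" and d="g L"])
    show "g ` {1..L} \<subseteq> {g 1..g L}" using mono L by auto
    have "g 1 > 0" using t by (simp add: g_def)
    then show "continuous_on {g 1..g L} (\<lambda>m. exp (- (m * a)) / m)"
      by (intro continuous_intros) auto
    show "(g has_real_derivative 1 / (1 + l * t)^2) (at l within {1..L})" if "l \<in> {1..L}" for l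
      unfolding g_def using pos[of l] that
      by (auto intro!: derivative_eq_intros simp: power2_eq_square algebra_simps)
  qed (use L mono in auto)
  then have i: "integral {1..L} (\<lambda>l. (1 / (1 + l * t)^2) *\<^sub>R (exp (- (g l * a)) / g l)) = integral {g 1..g L} (\<lambda>m. exp (- (m * a)) / m)"
    by (rule integral_unique)
  have "integral {1..L} (\<lambda>l. exp (- (a * (l / (1 + l * t)))) / (l * (1 + l * t)))
     = integral {1..L} (\<lambda>l. (1 / (1 + l * t)^2) *\<^sub>R (exp (- (g l * a)) / g l))"
  proof (rule integral_cong)
    fix l assume "l \<in> {1..L}"
    then have "l > 0" "1 + l * t > 0" using pos[of l] by auto
    then show "exp (- (a * (l / (1 + l * t)))) / (l * (1 + l * t)) = (1 / (1 + l * t)^2) *\<^sub>R (exp (- (g l * a)) / g l)"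
      by (simp add: g_def power2_eq_square mult.commute)
  qed
  then show ?thesis using i by (simp add: g_def)
qed

text \<open>
  By the shift of exponents, the barrier minus its average is an integral of \<open>exp (- m a) / m\<close> over
  the exponents lost at the top, minus the same integral over those gained at the bottom. The bottom
  part is at most \<open>ln (1 + t)\<close>. The top part contains the interval from \<open>1 / (2 T)\<close> to \<open>1 / T\<close>, with
  \<open>T = max a (1 / L)\<close>, as soon as \<open>t \<ge> 2 T\<close>, and there the integrand is at least \<open>exp (- 1) T\<close>.
\<close>

lemma barrier_heat_gain:
  assumes L: "1 \<le> L" and t: "0 < t" and a: "0 \<le> a"
  shows "(if 2 * max a (1 / L) \<le> t then exp (- 1) / 2 else 0) - ln (1 + t)
    \<le> barrier_profile L a - integral {1..L} (\<lambda>l. exp (- (a * (l / (1 + l * t)))) / (l * (1 + l * t)))"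
proof -
  define f where "f m = exp (- (m * a)) / m" for m :: real
  define p where "p = 1 / (1 + t)"
  define q where "q = L / (1 + L * t)"
  have p0: "0 < p" "p \<le> 1" using t by (auto simp: p_def)
  have pos: "1 + L * t > 0" using t L by (auto intro!: add_pos_nonneg)
  have q0: "p \<le> q" "q \<le> L" using t L pos by (auto simp: p_def q_def field_simps)
  have int: "f integrable_on {c..d}" if "0 < c" for c d
    unfolding f_def using that by (intro integrable_continuous_real continuous_intros) auto
  have fpos: "0 \<le> f m" if "0 < m" for m using that by (simp add: f_def)
  \<comment> \<open>The interval from p to L is cut at 1 and at q.\<close>
  have c1: "integral {p..1} f + integral {1..L} f = integral {p..L} f"
    using p0 L by (intro Henstock_Kurzweil_Integration.integral_combine int) auto
  have c2: "integral {p..q} f + integral {q..L} f = integral {p..L} f"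
    using p0 q0 by (intro Henstock_Kurzweil_Integration.integral_combine int) auto
  have e: "integral {1..L} (\<lambda>l. exp (- (a * (l / (1 + l * t)))) / (l * (1 + l * t))) = integral {p..q} f"
    unfolding integral_exp_div_shift[OF L t a] p_def q_def f_def by simp
  have "barrier_profile L a = integral {1..L} f"
    unfolding barrier_eq_integral f_def by simp
  then have eq: "barrier_profile L a - integral {1..L} (\<lambda>l. exp (- (a * (l / (1 + l * t)))) / (l * (1 + l * t)))
     = integral {q..L} f - integral {p..1} f"
    using c1 c2 e by linarith
  have ub: "integral {p..1} f \<le> ln (1 + t)"
  proof -
    have i: "((\<lambda>m. 1 / m) has_integral (ln 1 - ln p)) {p..1}"
      using p0 by (intro fundamental_theorem_of_calculus)
       (auto intro!: derivative_eq_intros simp: has_real_derivative_iff_has_vector_derivative[symmetric])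
    have "integral {p..1} f \<le> integral {p..1} (\<lambda>m. 1 / m)"
      using i p0 a by (intro integral_le int) (auto simp: f_def has_integral_integrable intro!: divide_right_mono)
    also have "\<dots> = ln (1 + t)" using i t by (simp add: integral_unique p_def ln_div)
    finally show ?thesis .
  qed
  have lb: "(if 2 * max a (1 / L) \<le> t then exp (- 1) / 2 else 0) \<le> integral {q..L} f"
  proof (cases "2 * max a (1 / L) \<le> t")
    case False
    then show ?thesis using p0 q0 fpos by (auto intro!: Henstock_Kurzweil_Integration.integral_nonneg int)
  next
    case True
    define T where "T = max a (1 / L)"
    have T0: "1 / L \<le> T" "a \<le> T" by (auto simp: T_def)
    have T1: "0 < T" using T0 L by (intro less_le_trans[of 0 "1/L" T]) auto
    have T: "0 < T" "a \<le> T" "1 / T \<le> L" using T0 T1 L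
      by (auto simp: field_simps)
    have "q \<le> 1 / t" using pos t L by (simp add: q_def field_simps)
    also have "1 / t \<le> 1 / (2 * T)" using True T t by (intro divide_left_mono) (auto simp: T_def)
    finally have q: "q \<le> 1 / (2 * T)" .
    have "exp (- 1) / 2 = integral {1/(2*T)..1/T} (\<lambda>m. exp (-1) * T)"
      using T by (simp add: field_simps)
    also have "\<dots> \<le> integral {1/(2*T)..1/T} f"
    proof (intro integral_le int)
      fix m assume m: "m \<in> {1/(2*T)..1/T}"
      then have m0: "0 < m" using T by (auto intro: less_le_trans[of 0 "1/(2*T)"])
      have "m * a \<le> 1 / T * T" using m T a m0 by (intro mult_mono) auto
      then have "exp (-1) \<le> exp (- (m * a))" using T by simp
      moreover have "T \<le> 1 / m" using m m0 T by (simp add: field_simps)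
      ultimately have "exp (-1) * T \<le> exp (-(m*a)) * (1/m)" using T by (intro mult_mono) auto
      then show "exp (-1) * T \<le> f m" by (simp add: f_def)
    qed (use T in auto)
    also have "\<dots> \<le> integral {q..L} f"
      using q T p0 q0 fpos by (intro integral_subset_le int) auto
    finally show ?thesis using True by simp
  qed
  show ?thesis unfolding eq using ub lb by linarith
qed

lemma barrier_profile_bounded:
  assumes "1 \<le> L" "0 \<le> a"
  shows "barrier_profile L a \<le> L"
proof -
  have "barrier_profile L a \<le> integral {1..L} (\<lambda>l. exp (- l * a))"
    unfolding barrier_eq_integral
    by (intro integral_le integrable_continuous_real continuous_intros) (auto simp: divide_le_eq mult_le_cancel_left1)
  then show ?thesis using integral_exp_le(1)[OF assms] by linarith
qed

text \<open>
  Completing the square in \<open>l |x + y|\<^sup>2 + |y|\<^sup>2 / t\<close>.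
\<close>

lemma gaussian_product_integral:
  fixes x :: "'a::euclidean_space"
  assumes l: "0 < l" and t: "0 < t"
  shows "(\<integral>y. exp (- l * (norm (x + y))\<^sup>2) * exp (- (norm y)\<^sup>2 / t) \<partial>lborel)
    = exp (- ((norm x)\<^sup>2 * (l / (1 + l * t)))) * ((1 + l * t) powr (- real DIM('a) / 2) * (t powr (real DIM('a) / 2) * gaussian_mass TYPE('a)))"
proof -
  define c where "c = l + 1 / t"
  have c: "0 < c" using l t by (simp add: c_def add_pos_pos)
  have ct: "c = (1 + l * t) / t" using t by (simp add: c_def field_simps)
  have pos: "0 < 1 + l * t" using l t by (simp add: add_pos_pos)
  have sq: "l * (norm (x + y))\<^sup>2 + (norm y)\<^sup>2 / t = (norm x)\<^sup>2 * (l / (1 + l * t)) + c * (norm ((l / c) *\<^sub>R x + y))\<^sup>2" for y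
  proof -
    have "(norm (x + y))\<^sup>2 = (norm x)\<^sup>2 + 2 * (x \<bullet> y) + (norm y)\<^sup>2"
      by (simp add: power2_norm_eq_inner inner_add inner_commute)
    moreover have "(norm ((l / c) *\<^sub>R x + y))\<^sup>2 = (l / c)\<^sup>2 * (norm x)\<^sup>2 + 2 * (l / c) * (x \<bullet> y) + (norm y)\<^sup>2"
      unfolding power2_norm_eq_inner by (simp add: inner_add inner_commute power2_eq_square)
    moreover have "c * ((l / c)\<^sup>2 * (norm x)\<^sup>2 + 2 * (l / c) * (x \<bullet> y) + (norm y)\<^sup>2)
       = l\<^sup>2 / c * (norm x)\<^sup>2 + 2 * l * (x \<bullet> y) + c * (norm y)\<^sup>2"
      using c by (simp add: power2_eq_square distrib_left)
    moreover have key: "l / (1 + l * t) + l\<^sup>2 / c = l"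
    proof -
      have "l\<^sup>2 / c = l\<^sup>2 * t / (1 + l * t)" using t pos by (simp add: ct)
      then have "l / (1 + l * t) + l\<^sup>2 / c = (l * (1 + l * t)) / (1 + l * t)"
        by (simp add: add_divide_distrib[symmetric] power2_eq_square algebra_simps)
      then show ?thesis using pos by simp
    qed
    moreover have "(norm x)\<^sup>2 * (l / (1 + l * t)) + l\<^sup>2 / c * (norm x)\<^sup>2 = l * (norm x)\<^sup>2"
    proof -
      have "(norm x)\<^sup>2 * (l / (1 + l * t)) + l\<^sup>2 / c * (norm x)\<^sup>2 = (l / (1 + l * t) + l\<^sup>2 / c) * (norm x)\<^sup>2"
        by (simp only: distrib_right mult.commute[of "(norm x)\<^sup>2"])
      then show ?thesis by (simp only: key)
    qed
    moreover have "l * ((norm x)\<^sup>2 + 2 * (x \<bullet> y) + (norm y)\<^sup>2) + (norm y)\<^sup>2 / t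
       = l * (norm x)\<^sup>2 + (2 * l * (x \<bullet> y) + c * (norm y)\<^sup>2)"
      by (simp add: c_def algebra_simps)
    ultimately show ?thesis by (simp only: add.assoc)
  qed
  have "(\<integral>y. exp (- l * (norm (x + y))\<^sup>2) * exp (- (norm y)\<^sup>2 / t) \<partial>lborel)
    = (\<integral>y. exp (- ((norm x)\<^sup>2 * (l / (1 + l * t)))) * exp (- c * (norm ((l / c) *\<^sub>R x + y))\<^sup>2) \<partial>lborel)"
  proof (intro Bochner_Integration.integral_cong refl)
    fix y
    let ?C = "(norm x)\<^sup>2 * (l / (1 + l * t))" and ?D = "(norm ((l / c) *\<^sub>R x + y))\<^sup>2"
    have "- l * (norm (x + y))\<^sup>2 + - (norm y)\<^sup>2 / t = - (l * (norm (x + y))\<^sup>2 + (norm y)\<^sup>2 / t)" by simp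
    also have "\<dots> = - (?C + c * ?D)" by (simp only: sq)
    also have "\<dots> = - ?C + - c * ?D" by simp
    finally show "exp (- l * (norm (x + y))\<^sup>2) * exp (- (norm y)\<^sup>2 / t) = exp (- ?C) * exp (- c * ?D)"
      by (simp only: exp_add[symmetric])
  qed
  also have "\<dots> = exp (- ((norm x)\<^sup>2 * (l / (1 + l * t)))) * (c powr (- real DIM('a) / 2) * gaussian_mass TYPE('a))"
    using gaussian_integral[OF c, of "(l / c) *\<^sub>R x"] by simp
  also have "c powr (- real DIM('a) / 2) = (1 + l * t) powr (- real DIM('a) / 2) * t powr (real DIM('a) / 2)"
    unfolding ct using t pos by (simp add: powr_divide powr_minus field_simps)
  finally show ?thesis by simp
qed

text \<open>
  This is the only place where \<open>n \<ge> 2\<close> enters: the average of the Gaussian of exponent \<open>l\<close> carries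
  the factor \<open>(1 + l t) powr (- n / 2)\<close>, which is then at most \<open>1 / (1 + l t)\<close>.
\<close>

lemma gaussian_average_barrier:
  fixes x :: "'a::euclidean_space"
  assumes L: "1 \<le> L" and t: "0 < t" and n: "2 \<le> DIM('a)"
  shows "integrable lborel (\<lambda>y. barrier L (x + y) * exp (- (norm y)\<^sup>2 / t))"
    and "(\<integral>y. barrier L (x + y) * exp (- (norm y)\<^sup>2 / t) \<partial>lborel)
      \<le> t powr (real DIM('a) / 2) * gaussian_mass TYPE('a)
        * integral {1..L} (\<lambda>l. exp (- ((norm x)\<^sup>2 * (l / (1 + l * t)))) / (l * (1 + l * t)))"
proof -
  let ?A = "t powr (real DIM('a) / 2) * gaussian_mass TYPE('a)"
  let ?a = "(norm x)\<^sup>2"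
  have A: "0 \<le> ?A" using gaussian_mass_pos[where 'a='a] by simp
  have nz: "l \<noteq> 0" "1 + l * t \<noteq> 0" if "l \<in> {1..L}" for l
  proof -
    have "0 < l" "0 < l * t" using that t by auto
    then show "l \<noteq> 0" "1 + l * t \<noteq> 0" by linarith+
  qed
  have g: "integrable lborel (\<lambda>y::'a. exp (- (norm y)\<^sup>2 / t))"
    using integrable_gaussian[of "1/t"] t by simp
  show "integrable lborel (\<lambda>y. barrier L (x + y) * exp (- (norm y)\<^sup>2 / t))"
    using barrier_profile_bounded[OF L] barrier_profile_nonneg[of L] L
    by (intro Bochner_Integration.integrable_bound[OF integrable_mult_right[OF g, of L]] AE_I2) 
       (auto simp: abs_mult)
  define f where "f l y = indicator {1..L} l * (exp (- l * (norm (x + y))\<^sup>2) / l) * exp (- (norm y)\<^sup>2 / t)" for l and y :: 'a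
  have f_bound: "norm (f l y) \<le> indicator {1..L} l * exp (- (norm y)\<^sup>2 / t)" for l y
  proof (cases "l \<in> {1..L}")
    case True
    have "exp (- l * (norm (x + y))\<^sup>2) \<le> 1" using True by simp
    then have "exp (- l * (norm (x + y))\<^sup>2) \<le> l" by (rule order_trans) (use True in auto)
    then have "exp (- l * (norm (x + y))\<^sup>2) / l \<le> 1" using True by (simp add: divide_le_eq)
    then have "(exp (- l * (norm (x + y))\<^sup>2) / l) * exp (- (norm y)\<^sup>2 / t) \<le> 1 * exp (- (norm y)\<^sup>2 / t)"
      by (intro mult_right_mono) auto
    then show ?thesis using True by (simp add: f_def abs_mult)
  qed (simp add: f_def)
  have I1: "integrable lborel (\<lambda>l. indicator {1..L} l * 1 :: real)"
    by (intro integrable_Icc_continuous continuous_intros)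
  have dom: "integrable (lborel \<Otimes>\<^sub>M lborel) (\<lambda>(l, y::'a). (indicator {1..L} l * 1) * exp (- (norm y)\<^sup>2 / t))"
  proof (rule lborel_pair.Fubini_integrable)
    show "integrable lborel (\<lambda>l. \<integral>y. norm (case (l, y::'a) of (l, y) \<Rightarrow> (indicator {1..L} l * 1) * exp (- (norm y)\<^sup>2 / t)) \<partial>lborel)"
      using integrable_mult_left[OF I1, of "(\<integral>y. exp (- (norm (y::'a))\<^sup>2 / t) \<partial>lborel)"] by (simp add: abs_mult)
    show "AE l in lborel. integrable lborel (\<lambda>y::'a. case (l, y) of (l, y) \<Rightarrow> (indicator {1..L} l * 1) * exp (- (norm y)\<^sup>2 / t))"
      unfolding prod.case by (intro AE_I2 integrable_mult_right g)
  qed measurable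
  have fi: "integrable (lborel \<Otimes>\<^sub>M lborel) (case_prod f)"
  proof (rule Bochner_Integration.integrable_bound[OF dom])
    show "case_prod f \<in> borel_measurable (lborel \<Otimes>\<^sub>M lborel)"
      unfolding f_def by measurable
    show "AE z in lborel \<Otimes>\<^sub>M lborel. norm (case_prod f z) \<le> norm (case z of (l, y::'a) \<Rightarrow> (indicator {1..L} l * 1) * exp (- (norm y)\<^sup>2 / t))"
    proof (rule AE_I2)
      fix z :: "real \<times> 'a"
      show "norm (case_prod f z) \<le> norm (case z of (l, y::'a) \<Rightarrow> (indicator {1..L} l * 1) * exp (- (norm y)\<^sup>2 / t))"
        using f_bound[of "fst z" "snd z"] by (cases z) (simp add: abs_mult)
    qed
  qed
  have "(\<integral>y. barrier L (x + y) * exp (- (norm y)\<^sup>2 / t) \<partial>lborel) = (\<integral>y. (\<integral>l. f l y \<partial>lborel) \<partial>lborel)"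
    unfolding barrier_profile_def f_def
    by (simp only: Bochner_Integration.integral_mult_left_zero)
  also have "\<dots> = (\<integral>l. (\<integral>y. f l y \<partial>lborel) \<partial>lborel)"
    by (rule lborel_pair.Fubini_integral[OF fi])
  also have "\<dots> \<le> (\<integral>l. indicator {1..L} l * (?A * (exp (- (?a * (l / (1 + l * t)))) / (l * (1 + l * t)))) \<partial>lborel)"
  proof (rule integral_mono_AE')
    show "integrable lborel (\<lambda>l. indicator {1..L} l * (?A * (exp (- (?a * (l / (1 + l * t)))) / (l * (1 + l * t)))))"
      by (intro integrable_Icc_continuous continuous_intros) (use nz in auto)
    show "AE l in lborel. (\<integral>y. f l y \<partial>lborel) \<le> indicator {1..L} l * (?A * (exp (- (?a * (l / (1 + l * t)))) / (l * (1 + l * t))))"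
    proof (rule AE_I2)
      fix l
      show "(\<integral>y. f l y \<partial>lborel) \<le> indicator {1..L} l * (?A * (exp (- (?a * (l / (1 + l * t)))) / (l * (1 + l * t))))"
      proof (cases "l \<in> {1..L}")
        case True
        then have l: "0 < l" by simp
        have p1: "1 \<le> 1 + l * t" using l t by simp
        have "(\<integral>y. f l y \<partial>lborel) = (1 / l) * (\<integral>y. exp (- l * (norm (x + y))\<^sup>2) * exp (- (norm y)\<^sup>2 / t) \<partial>lborel)"
          unfolding f_def using True by simp
        also have "\<dots> = (1 / l) * (exp (- (?a * (l / (1 + l * t)))) * ((1 + l * t) powr (- real DIM('a) / 2) * ?A))"
          by (subst gaussian_product_integral[OF l t]) simp
        also have "\<dots> \<le> (1 / l) * (exp (- (?a * (l / (1 + l * t)))) * ((1 + l * t) powr (- 1) * ?A))"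
          using p1 n l A by (intro mult_left_mono mult_right_mono powr_mono) auto
        also have "(1 + l * t) powr (-1) = 1 / (1 + l * t)"
          using p1 by (simp add: powr_minus_divide)
        finally show ?thesis using True by (simp add: algebra_simps)
      qed (simp add: f_def)
    qed
    show "AE l in lborel. 0 \<le> indicator {1..L} l * (?A * (exp (- (?a * (l / (1 + l * t)))) / (l * (1 + l * t))))"
      using A t by (auto simp: indicator_def)
  qed
  also have "\<dots> = integral {1..L} (\<lambda>l. ?A * (exp (- (?a * (l / (1 + l * t)))) / (l * (1 + l * t))))"
    by (intro integrable_Icc_continuous continuous_intros) (use nz in auto)
  also have "\<dots> = ?A * integral {1..L} (\<lambda>l. exp (- (?a * (l / (1 + l * t)))) / (l * (1 + l * t)))"
    by (rule Henstock_Kurzweil_Integration.integral_mult_right)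
  finally show "(\<integral>y. barrier L (x + y) * exp (- (norm y)\<^sup>2 / t) \<partial>lborel)
      \<le> ?A * integral {1..L} (\<lambda>l. exp (- (?a * (l / (1 + l * t)))) / (l * (1 + l * t)))" .
qed

lemma gaussian_second_diff_barrier:
  fixes x :: "'a::euclidean_space"
  assumes L: "1 \<le> L" and t: "0 < t" and n: "2 \<le> DIM('a)"
  shows "2 * (t powr (real DIM('a) / 2) * gaussian_mass TYPE('a)) *
      ((if 2 * max ((norm x)\<^sup>2) (1 / L) \<le> t then exp (- 1) / 2 else 0) - ln (1 + t))
    \<le> (\<integral>y. second_diff (\<lambda>x. barrier L x) x y * exp (- (norm y)\<^sup>2 / t) \<partial>lborel)"
proof -
  let ?A = "t powr (real DIM('a) / 2) * gaussian_mass TYPE('a)"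
  let ?I = "integral {1..L} (\<lambda>l. exp (- ((norm x)\<^sup>2 * (l / (1 + l * t)))) / (l * (1 + l * t)))"
  let ?e = "\<lambda>y::'a. exp (- (norm y)\<^sup>2 / t)"
  let ?P = "\<integral>y. barrier L (x + y) * ?e y \<partial>lborel"
  have A: "0 \<le> ?A" using gaussian_mass_pos[where 'a='a] by simp
  note av = gaussian_average_barrier[OF L t n, of x]
  have g: "integrable lborel ?e"
    using integrable_gaussian[of "1/t"] t by simp
  have gi: "(\<integral>y. ?e y \<partial>lborel) = ?A"
    using gaussian_integral[of "1/t" "0::'a"] t by (simp add: powr_divide powr_minus)
  have [measurable]: "(\<lambda>y. barrier L (x + y) * ?e y) \<in> borel_measurable borel" by measurable
  have m1: "integrable lborel (\<lambda>y. barrier L (x - y) * ?e y)"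
    using integrable_affine_euclidean[OF av(1), of "-1" 0] by simp
  have m2: "(\<integral>y. barrier L (x - y) * ?e y \<partial>lborel) = ?P"
    using integral_reflect_euclidean[of "\<lambda>y. barrier L (x + y) * ?e y" 0] by simp
  have "(\<integral>y. second_diff (\<lambda>x. barrier L x) x y * ?e y \<partial>lborel)
     = (\<integral>y. 2 * barrier L x * ?e y - barrier L (x + y) * ?e y - barrier L (x - y) * ?e y \<partial>lborel)"
    by (intro Bochner_Integration.integral_cong) (auto simp: second_diff_def algebra_simps)
  also have "\<dots> = 2 * barrier L x * ?A - ?P - ?P"
    using g av(1) m1 by (simp add: gi[simplified] m2[simplified])
  also have "\<dots> \<ge> 2 * barrier L x * ?A - ?A * ?I - ?A * ?I"
    using av(2) by linarith
  finally have 1: "2 * ?A * (barrier L x - ?I) \<le> (\<integral>y. second_diff (\<lambda>x. barrier L x) x y * ?e y \<partial>lborel)"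
    by (simp add: algebra_simps)
  have "2 * ?A * ((if 2 * max ((norm x)\<^sup>2) (1 / L) \<le> t then exp (- 1) / 2 else 0) - ln (1 + t)) \<le> 2 * ?A * (barrier L x - ?I)"
    using A by (intro mult_left_mono barrier_heat_gain[OF L t]) auto
  then show ?thesis using 1 by linarith
qed

definition log_tail_integral :: "real \<Rightarrow> real" where
  "log_tail_integral s = (\<integral>t. indicator {0<..} t * (t powr (-1 - s) * ln (1 + t)) \<partial>lborel)"

lemma ln_one_plus_le_cut:
  fixes s t :: real
  assumes s: "0 < s" "s < 1" and t: "0 < t"
  shows "ln (1 + t) \<le> 4 / s * (t powr (s / 2) * min 1 (t powr (1 - s / 2)))"
proof (cases "t \<le> 1")
  case True
  have "ln (1 + t) \<le> t" using t by (intro ln_add_one_self_le_self) auto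
  also have "t = 1 * (t powr (s/2) * t powr (1 - s/2))" using t by (simp add: powr_add[symmetric])
  also have "\<dots> \<le> 4 / s * (t powr (s/2) * t powr (1 - s/2))"
    using s by (intro mult_right_mono) auto
  also have "t powr (1 - s/2) = min 1 (t powr (1 - s/2))"
    using True t s powr_mono2[of "1 - s/2" t 1] by (auto simp: min_def)
  finally show ?thesis by simp
next
  case False
  then have t1: "1 < t" by simp
  have "ln (1 + t) \<le> ln (2 * t)" using t1 by simp
  also have "\<dots> = (2 / s) * ln ((2 * t) powr (s/2))" using t s by (simp add: ln_powr)
  also have "\<dots> \<le> (2 / s) * (2 * t) powr (s/2)"
  proof (rule mult_left_mono)
    show "ln ((2 * t) powr (s/2)) \<le> (2 * t) powr (s/2)" by (rule ln_bound) (use t in simp)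
  qed (use s in simp)
  also have "(2 * t) powr (s/2) = 2 powr (s/2) * t powr (s/2)" using t by (simp add: powr_mult)
  also have "(2 / s) * (2 powr (s/2) * t powr (s/2)) \<le> (2 / s) * (2 powr 1 * t powr (s/2))"
    using s by (intro mult_left_mono mult_right_mono powr_mono) auto
  also have "\<dots> = 4 / s * t powr (s/2)" by simp
  finally have "ln (1 + t) \<le> 4 / s * t powr (s/2)" .
  moreover have "min 1 (t powr (1 - s / 2)) = 1"
    using t1 s by (simp add: min_def ge_one_powr_ge_zero)
  ultimately show ?thesis by simp
qed

lemma log_tail_integrable:
  assumes s: "0 < s" "s < 1"
  shows "integrable lborel (\<lambda>t::real. indicator {0<..} t * (t powr (-1 - s) * ln (1 + t)))"
proof (rule Bochner_Integration.integrable_bound[OF integrable_mult_right[OF integrable_powr_cut[of "s/2" "1 - s/2"], of "4 / s"]])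
  show "AE t in lborel. norm (indicator {0<..} t * (t powr (-1 - s) * ln (1 + t)))
     \<le> norm (4 / s * (indicator {0<..} t * (t powr (-1 - s/2) * min 1 (t powr (1 - s/2)))))"
  proof (rule AE_I2)
    fix t :: real
    show "norm (indicator {0<..} t * (t powr (-1 - s) * ln (1 + t)))
     \<le> norm (4 / s * (indicator {0<..} t * (t powr (-1 - s/2) * min 1 (t powr (1 - s/2)))))"
    proof (cases "0 < t")
      case True
      have "t powr (-1 - s) * ln (1 + t) \<le> t powr (-1 - s) * (4 / s * (t powr (s/2) * min 1 (t powr (1 - s/2))))"
        by (intro mult_left_mono ln_one_plus_le_cut s True) simp
      also have "\<dots> = 4 / s * ((t powr (-1 - s) * t powr (s/2)) * min 1 (t powr (1 - s/2)))"
        by simp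
      also have "t powr (-1 - s) * t powr (s/2) = t powr (-1 - s/2)"
      proof -
        have "-1 - s + s / 2 = -1 - s / 2" by (simp add: field_simps)
        then show ?thesis by (simp only: powr_add[symmetric])
      qed
      finally show ?thesis using True s by (simp add: abs_mult)
    qed simp
  qed
qed (use s in auto)

lemma powr_tail_integral:
  assumes "0 < s" "0 < (b::real)"
  shows "integrable lborel (\<lambda>t::real. indicator {b..} t * t powr (-1 - s))"
    and "(\<integral>t. indicator {b..} t * t powr (-1 - s) \<partial>lborel) = b powr (- s) / s"
proof -
  have h: "((\<lambda>t. t powr (-1-s)) has_integral (b powr (-s) / s)) {b..}"
    using has_integral_powr_to_inf[of "-1-s" b] assms by simp
  have b2: "set_integrable lebesgue {b..} (\<lambda>t::real. t powr (-1-s))"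
    by (rule nonnegative_absolutely_integrable_1) (use h in \<open>auto simp: integrable_on_def\<close>)
  then have c: "set_integrable lborel {b..} (\<lambda>t::real. t powr (-1-s))"
    unfolding set_integrable_def by (subst (asm) integrable_completion) measurable
  then show "integrable lborel (\<lambda>t::real. indicator {b..} t * t powr (-1 - s))"
    by (simp add: set_integrable_def)
  show "(\<integral>t. indicator {b..} t * t powr (-1 - s) \<partial>lborel) = b powr (- s) / s"
    using set_borel_integral_eq_integral(2)[OF c] h
    by (simp add: set_lebesgue_integral_def integral_unique)
qed

text \<open>
  Uniformly in \<open>L\<close>, the fractional Laplacian of the barrier is at least of the order of
  \<open>max |x| (1 / sqrt L)\<close> to the power \<open>- 2 s\<close>, up to a bounded error. The heat kernel mixture writes it
  as the integral over \<open>t\<close> of \<open>t powr (- 1 - s)\<close> times the gain at time \<open>t\<close>; the positive part of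
  the gain contributes the power, and the logarithm is integrable because \<open>0 < s < 1\<close>.
\<close>

lemma frac_op_barrier_ge:
  assumes s: "0 < s" "s < 1" and n: "2 \<le> DIM('a::euclidean_space)"
  obtains c C where "0 < c"
    "\<And>L (x::'a). 1 \<le> L \<Longrightarrow> c * max ((norm x)\<^sup>2) (1 / L) powr (- s) - C \<le> frac_op s (\<lambda>x. barrier L x) x"
proof -
  let ?G = "gaussian_mass TYPE('a)"
  define p where "p = real DIM('a) / 2 + s"
  have p0: "0 < p" using s n by (simp add: p_def add_nonneg_pos)
  let ?g = "inv_gamma_integral p"
  have g0: "0 < ?g" by (rule inv_gamma_integral_pos[OF p0])
  define c where "c = ?G / ?g * (exp (-1) / 2 * (2 powr (- s) / s))"
  define C where "C = ?G / ?g * log_tail_integral s"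
  have "0 < c" using g0 gaussian_mass_pos[where 'a='a] s by (simp add: c_def)
  moreover have "c * max ((norm x)\<^sup>2) (1 / L) powr (- s) - C \<le> frac_op s (\<lambda>x. barrier L x) x"
    if L: "1 \<le> L" for L and x :: 'a
  proof -
    define T where "T = max ((norm x)\<^sup>2) (1 / L)"
    have T: "0 < T" unfolding T_def by (rule less_le_trans[of 0 "1/L"]) (use L in auto)
    let ?D = "second_diff (\<lambda>x::'a. barrier L x) x"
    have [measurable]: "?D \<in> borel_measurable borel" by measurable
    define f where "f y t = ?D y * (indicator {0<..} t * (t powr (-1 - p) * exp (- (norm y)\<^sup>2 / t)))" for y and t :: real
    have inner: "integrable lborel (f y)" "(\<integral>t. f y t \<partial>lborel) = ?D y * frac_kernel s y * ?g"
       "(\<integral>t. norm (f y t) \<partial>lborel) = \<bar>?D y * frac_kernel s y\<bar> * ?g" for y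
    proof -
      have 1: "integrable lborel (f y) \<and> (\<integral>t. f y t \<partial>lborel) = ?D y * frac_kernel s y * ?g
         \<and> (\<integral>t. norm (f y t) \<partial>lborel) = \<bar>?D y * frac_kernel s y\<bar> * ?g"
      proof (cases "y = 0")
        case False
        note k = kernel_gaussian_mixture[OF False s(1) p_def]
        have "(\<integral>t. norm (f y t) \<partial>lborel) = (\<integral>t. \<bar>?D y\<bar> * (indicator {0<..} t * (t powr (-1 - p) * exp (- (norm y)\<^sup>2 / t))) \<partial>lborel)"
          unfolding f_def by (intro Bochner_Integration.integral_cong) (auto simp: abs_mult)
        also have "\<dots> = \<bar>?D y * frac_kernel s y\<bar> * ?g" using k by (simp add: abs_mult)
        finally show ?thesis unfolding f_def using k by simp
      next
        case True
        then have "f y = (\<lambda>t. 0)" by (simp add: f_def fun_eq_iff)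
        then show ?thesis using True by simp
      qed
      then show "integrable lborel (f y)" "(\<integral>t. f y t \<partial>lborel) = ?D y * frac_kernel s y * ?g"
       "(\<integral>t. norm (f y t) \<partial>lborel) = \<bar>?D y * frac_kernel s y\<bar> * ?g" by blast+
    qed
    have Dk: "integrable lborel (\<lambda>y. ?D y * frac_kernel s y)"
      by (rule integrable_second_diff_kernel[OF s _ second_diff_barrier[OF L]]) measurable
    have fi: "integrable (lborel \<Otimes>\<^sub>M lborel) (case_prod f)"
    proof (rule lborel_pair.Fubini_integrable)
      show "case_prod f \<in> borel_measurable (lborel \<Otimes>\<^sub>M lborel)" unfolding f_def by measurable
      show "integrable lborel (\<lambda>y. \<integral>t. norm (case_prod f (y, t)) \<partial>lborel)"
        unfolding prod.case inner using Dk by (intro integrable_mult_left integrable_abs)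
      show "AE y in lborel. integrable lborel (\<lambda>t. case_prod f (y, t))"
        unfolding prod.case using inner by simp
    qed
    define h where "h t = indicator {0<..} t * (t powr (-1 - p)) * (\<integral>y. ?D y * exp (- (norm y)\<^sup>2 / t) \<partial>lborel)" for t :: real
    have hf: "(\<integral>y. f y t \<partial>lborel) = h t" for t
    proof -
      have "(\<integral>y. f y t \<partial>lborel) = (\<integral>y. (indicator {0<..} t * (t powr (-1 - p))) * (?D y * exp (- (norm y)\<^sup>2 / t)) \<partial>lborel)"
        unfolding f_def by (intro Bochner_Integration.integral_cong) auto
      then show ?thesis unfolding h_def by simp
    qed
    have "2 * frac_op s (\<lambda>x. barrier L x) x * ?g = (\<integral>y. ?D y * frac_kernel s y * ?g \<partial>lborel)"
      by (simp add: frac_op_def)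
    also have "\<dots> = (\<integral>y. (\<integral>t. f y t \<partial>lborel) \<partial>lborel)" by (simp add: inner)
    also have "\<dots> = (\<integral>t. (\<integral>y. f y t \<partial>lborel) \<partial>lborel)"
      by (rule lborel_pair.Fubini_integral[OF fi, symmetric])
    also have "\<dots> = (\<integral>t. h t \<partial>lborel)" by (simp add: hf)
    finally have e: "2 * frac_op s (\<lambda>x. barrier L x) x * ?g = (\<integral>t. h t \<partial>lborel)" .
    have hi: "integrable lborel h"
      using lborel_pair.integrable_snd[OF fi] by (simp add: hf)
    let ?q = "\<lambda>t. 2 * ?G * (exp (-1) / 2 * (indicator {2 * T..} t * t powr (-1 - s)) - indicator {0<..} t * (t powr (-1 - s) * ln (1 + t)))"
    have qi: "integrable lborel ?q"
      using T by (intro integrable_mult_right Bochner_Integration.integrable_diff powr_tail_integral log_tail_integrable s) auto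
    have "(\<integral>t. ?q t \<partial>lborel) \<le> (\<integral>t. h t \<partial>lborel)"
    proof (intro integral_mono[OF qi hi])
      fix t :: real
      show "?q t \<le> h t"
      proof (cases "0 < t")
        case True
        have "(2 * (t powr (real DIM('a) / 2) * ?G) * ((if 2 * T \<le> t then exp (- 1) / 2 else 0) - ln (1 + t))) * t powr (-1 - p)
          \<le> (\<integral>y. ?D y * exp (- (norm y)\<^sup>2 / t) \<partial>lborel) * t powr (-1 - p)"
          unfolding T_def by (intro mult_right_mono gaussian_second_diff_barrier[OF L True n]) auto
        also have "\<dots> = h t" using True by (simp add: h_def mult.commute)
        also have "(2 * (t powr (real DIM('a) / 2) * ?G) * ((if 2 * T \<le> t then exp (- 1) / 2 else 0) - ln (1 + t))) * t powr (-1 - p)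
           = 2 * ?G * ((if 2 * T \<le> t then exp (- 1) / 2 else 0) - ln (1 + t)) * (t powr (real DIM('a) / 2) * t powr (-1 - p))"
          by simp
        also have "t powr (real DIM('a) / 2) * t powr (-1 - p) = t powr (-1 - s)"
          by (simp add: powr_add[symmetric] p_def)
        finally show ?thesis using True by (auto simp: algebra_simps split: if_splits)
      next
        case False
        then show ?thesis using T by (simp add: h_def)
      qed
    qed
    moreover have "(\<integral>t. ?q t \<partial>lborel) = 2 * ?G * (exp (-1) / 2 * ((2 * T) powr (- s) / s) - log_tail_integral s)"
      unfolding log_tail_integral_def
      using powr_tail_integral[of s "2 * T"] log_tail_integrable[OF s] s T by simp
    ultimately have "2 * ?G * (exp (-1) / 2 * ((2 * T) powr (- s) / s) - log_tail_integral s) \<le> 2 * frac_op s (\<lambda>x. barrier L x) x * ?g"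
      using e by linarith
    then have "?G * (exp (-1) / 2 * ((2 * T) powr (- s) / s) - log_tail_integral s) / ?g \<le> frac_op s (\<lambda>x. barrier L x) x"
      using g0 by (simp add: pos_divide_le_eq)
    moreover have "?G * (exp (-1) / 2 * ((2 * T) powr (- s) / s) - log_tail_integral s) / ?g = c * T powr (- s) - C"
      using T by (simp add: c_def C_def powr_mult diff_divide_distrib algebra_simps)
    ultimately show ?thesis by (simp add: T_def)
  qed
  ultimately show ?thesis by (rule that)
qed

section \<open>Smooth bumps\<close>

text \<open>
  The functions \<open>exp (- 1 / t) / t ^ m\<close>, extended by zero. The exponent \<open>m\<close> is needed because the
  derivatives of the case \<open>m = 0\<close> are linear combinations of them.
\<close>

definition bump_profile :: "nat \<Rightarrow> real \<Rightarrow> real" where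
  "bump_profile m t = (if 0 < t then exp (- 1 / t) / t ^ m else 0)"

lemma bump_profile_nonneg [simp]: "0 \<le> bump_profile m t"
  by (simp add: bump_profile_def)

lemma bump_profile_nonpos [simp]: "t \<le> 0 \<Longrightarrow> bump_profile m t = 0"
  by (simp add: bump_profile_def)

lemma bump_profile_pos: "0 < t \<Longrightarrow> 0 < bump_profile m t"
  by (simp add: bump_profile_def)

lemma bump_profile_bound: "bump_profile m t \<le> real (Suc m) ^ Suc m"
proof (cases "0 < t")
  case True
  let ?k = "Suc m"
  have 1: "exp (- 1 / t) \<le> real ?k ^ ?k * min 1 (t ^ ?k)"
    by (rule exp_minus_inverse_le[OF True]) simp
  also have "\<dots> \<le> real ?k ^ ?k * t ^ m"
  proof (rule mult_left_mono)
    show "min 1 (t ^ ?k) \<le> t ^ m"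
    proof (cases "t \<le> 1")
      case t: True
      have "t ^ ?k \<le> t ^ m" using True t by (intro power_decreasing) auto
      then show ?thesis by simp
    next
      case False
      then have "1 \<le> t ^ m" by (intro one_le_power) auto
      then show ?thesis by simp
    qed
  qed simp
  finally show ?thesis using True by (simp add: bump_profile_def divide_le_eq)
qed simp

lemma bump_profile_0_le_1: "bump_profile 0 t \<le> 1"
  by (simp add: bump_profile_def)

lemma bump_profile_deriv:
  "(bump_profile m has_real_derivative (bump_profile (m + 2) t - real m * bump_profile (m + 1) t)) (at t)"
proof (cases t "0::real" rule: linorder_cases)
  case less
  have "((\<lambda>_. 0) has_real_derivative 0) (at t)" by simp
  then have "(bump_profile m has_real_derivative 0) (at t)"
    by (rule has_field_derivative_transform_within_open[of _ _ _ "{..<0}"]) (use less in auto)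
  then show ?thesis using less by simp
next
  case greater
  have "((\<lambda>t. exp (- 1 / t) / t ^ m) has_real_derivative (bump_profile (m + 2) t - real m * bump_profile (m + 1) t)) (at t)"
  proof (cases m)
    case 0
    then show ?thesis using greater
      by (auto intro!: derivative_eq_intros simp: bump_profile_def power2_eq_square)
  next
    case (Suc k)
    show ?thesis using greater unfolding Suc
      by (auto intro!: derivative_eq_intros simp: bump_profile_def field_simps power2_eq_square) (cases k; simp)
  qed
  then show ?thesis
    by (rule has_field_derivative_transform_within_open[of _ _ _ "{0<..}"]) (use greater in \<open>auto simp: bump_profile_def\<close>)
next
  case equal
  \<comment> \<open>The factor exp (- 1 / h) beats the power m + 2, so the difference quotient is of order h.\<close>
  let ?k = "m + 2"
  have b: "\<bar>bump_profile m h\<bar> \<le> real ?k ^ ?k * \<bar>h\<bar> * \<bar>h\<bar>" for h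
  proof (cases "0 < h")
    case True
    have "exp (- 1 / h) \<le> real ?k ^ ?k * min 1 (h ^ ?k)"
      by (rule exp_minus_inverse_le[OF True]) simp
    also have "\<dots> \<le> real ?k ^ ?k * h ^ ?k" by (intro mult_left_mono) auto
    finally show ?thesis using True
      by (simp add: bump_profile_def divide_le_eq power_add power2_eq_square algebra_simps)
  next
    case False
    have "0 \<le> real ?k ^ ?k * \<bar>h\<bar> * \<bar>h\<bar>" by (intro mult_nonneg_nonneg) auto
    then show ?thesis using False by simp
  qed
  have "((\<lambda>h. bump_profile m h / h) \<longlongrightarrow> 0) (at 0)"
  proof (rule Lim_null_comparison)
    show "\<forall>\<^sub>F h in at 0. norm (bump_profile m h / h) \<le> real ?k ^ ?k * \<bar>h\<bar>"
      using b by (intro eventually_at_filter[THEN iffD2] always_eventually) (auto simp: divide_le_eq)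
    show "((\<lambda>h. real ?k ^ ?k * \<bar>h\<bar>) \<longlongrightarrow> 0) (at 0)"
      by (auto intro!: tendsto_eq_intros)
  qed
  then show ?thesis using equal by (simp add: has_field_derivative_iff)
qed

lemma bump_profile_deriv_0: "(bump_profile 0 has_real_derivative bump_profile 2 t) (at t)"
  using bump_profile_deriv[of 0 t] by (simp add: numeral_2_eq_2)

lemma bump_profile_continuous: "continuous_on S (bump_profile m)"
  using bump_profile_deriv by (meson DERIV_isCont continuous_at_imp_continuous_on)

lemma bump_profile_measurable [measurable]: "bump_profile m \<in> borel_measurable borel"
  by (rule borel_measurable_continuous_onI[OF bump_profile_continuous])

text \<open>
  A family of functions closed under partial derivatives, so that smoothness of every order follows
  by one induction, without a calculus of higher derivatives of compositions.
\<close>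

inductive bump_algebra :: "'a::euclidean_space \<Rightarrow> real \<Rightarrow> ('a \<Rightarrow> real) \<Rightarrow> bool" for z e where
  const: "bump_algebra z e (\<lambda>x. c)"
| coordinate: "bump_algebra z e (\<lambda>x. (x - z) \<bullet> i)"
| profile: "bump_algebra z e (\<lambda>x. bump_profile m (1 - (norm (x - z))\<^sup>2 / e\<^sup>2))"
| add: "bump_algebra z e f \<Longrightarrow> bump_algebra z e g \<Longrightarrow> bump_algebra z e (\<lambda>x. f x + g x)"
| mult: "bump_algebra z e f \<Longrightarrow> bump_algebra z e g \<Longrightarrow> bump_algebra z e (\<lambda>x. f x * g x)"

lemma norm_sq_profile_derivative:
  fixes x z :: "'a::euclidean_space"
  shows "((\<lambda>x. 1 - (norm (x - z))\<^sup>2 / e\<^sup>2) has_derivative (\<lambda>v. - (2 / e\<^sup>2) * ((x - z) \<bullet> v))) (at x)"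
proof -
  have "((\<lambda>x. 1 - c * ((x - z) \<bullet> (x - z))) has_derivative (\<lambda>v. - (2 * c) * ((x - z) \<bullet> v))) (at x)" for c
    by (auto intro!: derivative_eq_intros simp: inner_commute)
  from this[of "1 / e\<^sup>2"] show ?thesis by (simp add: dot_square_norm)
qed

lemma bump_algebra_profile_derivative:
  fixes x z :: "'a::euclidean_space"
  shows "((\<lambda>x. bump_profile m (1 - (norm (x - z))\<^sup>2 / e\<^sup>2)) has_derivative
     (\<lambda>v. (bump_profile (m + 2) (1 - (norm (x - z))\<^sup>2 / e\<^sup>2) - real m * bump_profile (m + 1) (1 - (norm (x - z))\<^sup>2 / e\<^sup>2))
        * (- (2 / e\<^sup>2) * ((x - z) \<bullet> v)))) (at x)"
  using has_derivative_compose[OF norm_sq_profile_derivative[of z e x]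
      bump_profile_deriv[of m "1 - (norm (x - z))\<^sup>2 / e\<^sup>2", unfolded has_field_derivative_def]]
  by simp

lemma bump_algebra_derivative:
  assumes "bump_algebra z e f"
  shows "\<exists>D. (\<forall>x. (f has_derivative D x) (at x)) \<and> (\<forall>v. bump_algebra z e (\<lambda>x. D x v))"
  using assms
proof induction
  case (const c)
  show ?case by (intro exI[of _ "\<lambda>x v. 0"]) (auto intro: bump_algebra.const)
next
  case (coordinate i)
  have "((\<lambda>x. (x - z) \<bullet> i) has_derivative (\<lambda>v. v \<bullet> i)) (at x)" for x
    by (auto intro!: derivative_eq_intros)
  then show ?case by (intro exI[of _ "\<lambda>x v. v \<bullet> i"]) (auto intro: bump_algebra.const)
next
  case (profile m)
  let ?q = "\<lambda>x. 1 - (norm (x - z))\<^sup>2 / e\<^sup>2"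
  have "bump_algebra z e (\<lambda>x. (bump_profile (m + 2) (?q x) + (- real m) * bump_profile (m + 1) (?q x))
        * (- (2 / e\<^sup>2) * ((x - z) \<bullet> v)))" for v
    by (intro bump_algebra.intros)
  then show ?case
    by (intro exI[of _ "\<lambda>x v. (bump_profile (m + 2) (?q x) - real m * bump_profile (m + 1) (?q x))
        * (- (2 / e\<^sup>2) * ((x - z) \<bullet> v))"] conjI allI bump_algebra_profile_derivative) simp
next
  case (add f g)
  then obtain D E where "\<forall>x. (f has_derivative D x) (at x)" "\<forall>v. bump_algebra z e (\<lambda>x. D x v)"
    "\<forall>x. (g has_derivative E x) (at x)" "\<forall>v. bump_algebra z e (\<lambda>x. E x v)" by blast
  then show ?case
    by (intro exI[of _ "\<lambda>x v. D x v + E x v"]) (auto intro: bump_algebra.intros has_derivative_add)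
next
  case (mult f g)
  then obtain D E where DE: "\<forall>x. (f has_derivative D x) (at x)" "\<forall>v. bump_algebra z e (\<lambda>x. D x v)"
    "\<forall>x. (g has_derivative E x) (at x)" "\<forall>v. bump_algebra z e (\<lambda>x. E x v)" by blast
  have "((\<lambda>x. f x * g x) has_derivative (\<lambda>v. f x * E x v + D x v * g x)) (at x)" for x
    using has_derivative_mult[of f "D x" x UNIV g "E x"] DE by simp
  then show ?case using DE mult.hyps
    by (intro exI[of _ "\<lambda>x v. f x * E x v + D x v * g x"]) (auto intro!: bump_algebra.intros)
qed

lemma bump_algebra_C_on:
  assumes "bump_algebra z e f"
  shows "C_on k UNIV f"
  using assms
proof (induction k arbitrary: f)
  case 0
  then obtain D where "\<forall>x. (f has_derivative D x) (at x)"
    using bump_algebra_derivative by blast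
  then show ?case
    by (auto intro!: continuous_at_imp_continuous_on has_derivative_continuous)
next
  case (Suc k)
  then obtain D where D: "\<forall>x. (f has_derivative D x) (at x)" "\<forall>v. bump_algebra z e (\<lambda>x. D x v)"
    using bump_algebra_derivative by blast
  have "frechet_derivative f (at x) = D x" for x
    using D by (metis frechet_derivative_at)
  then show ?case using D Suc.IH by (auto simp: differentiable_def)
qed

definition bump :: "real \<Rightarrow> 'a::euclidean_space \<Rightarrow> 'a \<Rightarrow> real" where
  "bump e z x = bump_profile 0 (1 - (norm (x - z))\<^sup>2 / e\<^sup>2)"

lemma bump_nonneg [simp]: "0 \<le> bump e z x"
  and bump_le_1: "bump e z x \<le> 1"
  by (simp_all add: bump_def bump_profile_0_le_1)

lemma bump_outside: "0 < e \<Longrightarrow> e \<le> norm (x - z) \<Longrightarrow> bump e z x = 0"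
  unfolding bump_def by (intro bump_profile_nonpos) (auto intro!: power_mono)

lemma bump_pos: "0 < e \<Longrightarrow> norm (x - z) < e \<Longrightarrow> 0 < bump e z x"
  unfolding bump_def by (intro bump_profile_pos) (auto intro!: power_strict_mono)

lemma bump_scale: "0 < e \<Longrightarrow> bump e z x = bump 1 0 ((1 / e) *\<^sub>R (x - z))"
  by (simp add: bump_def power_divide)

lemma bump_translate: "bump e z (x + y) = bump e (z - y) x" "bump e z (x - y) = bump e (z + y) x"
  by (simp_all add: bump_def algebra_simps)

lemma bump_derivative:
  fixes x z :: "'a::euclidean_space"
  shows "(bump e z has_derivative
     (\<lambda>v. bump_profile 2 (1 - (norm (x - z))\<^sup>2 / e\<^sup>2) * (- (2 / e\<^sup>2) * ((x - z) \<bullet> v)))) (at x)"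
  using bump_algebra_profile_derivative[of 0 z e x] by (simp add: bump_def[abs_def] numeral_2_eq_2)

lemma bump_continuous: "continuous_on S (bump e z)"
  using bump_derivative by (meson continuous_at_imp_continuous_on has_derivative_continuous)

lemma bump_continuous_center: "continuous_on S (\<lambda>z. bump e z x)"
proof -
  have "(\<lambda>z. bump e z x) = bump e x"
    by (simp add: bump_def norm_minus_commute fun_eq_iff)
  then show ?thesis using bump_continuous by metis
qed

lemma bump_measurable [measurable]: "bump e z \<in> borel_measurable borel"
  by (rule borel_measurable_continuous_onI[OF bump_continuous])

lemma test_function_bump:
  fixes z :: "'a::euclidean_space"
  assumes "0 < e" "cball z e \<subseteq> U"
  shows "test_function U (bump e z)"
proof -
  have "bump_algebra z e (bump e z)"
    unfolding bump_def[abs_def] by (rule bump_algebra.profile)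
  then have "C_on k UNIV (bump e z)" for k by (rule bump_algebra_C_on)
  moreover have "{x. bump e z x \<noteq> 0} \<subseteq> cball z e"
    using bump_outside[OF assms(1)] by (force simp: dist_norm norm_minus_commute)
  then have cl: "closure {x. bump e z x \<noteq> 0} \<subseteq> cball z e"
    by (rule closure_minimal) simp
  then have "compact (closure {x. bump e z x \<noteq> 0})"
    by (meson bounded_cball bounded_subset closed_closure compact_eq_bounded_closed)
  ultimately show ?thesis unfolding test_function_def using cl assms by blast
qed

lemma second_diff_unit_bump:
  "\<exists>B\<ge>0. \<forall>x y::'a::euclidean_space. \<bar>second_diff (bump 1 0) x y\<bar> \<le> B * min 1 ((norm y)\<^sup>2)"
proof -
  define c where "c m = real (Suc m) ^ Suc m" for m
  have c: "bump_profile m t \<le> c m" for m t unfolding c_def by (rule bump_profile_bound)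
  \<comment> \<open>The bound for the second derivative along a line, where the profile has parameters 4, 3 and 2.\<close>
  define B where "B = 4 * (c 4 + 2 * c 3) + 2 * c 2"
  have B0: "0 \<le> B" unfolding B_def c_def by simp
  have "\<bar>second_diff (bump 1 0) x y\<bar> \<le> (2 * B + 2) * min 1 ((norm y)\<^sup>2)" for x y :: 'a
  proof -
    define q where "q t = 1 - ((x + t *\<^sub>R y) \<bullet> (x + t *\<^sub>R y))" for t :: real
    define h where "h t = bump_profile 0 (q t)" for t
    define h' where "h' t = bump_profile 2 (q t) * (- 2 * ((x + t *\<^sub>R y) \<bullet> y))" for t
    define h'' where "h'' t = (bump_profile 4 (q t) - 2 * bump_profile 3 (q t)) * (4 * ((x + t *\<^sub>R y) \<bullet> y)^2)
        - 2 * (y \<bullet> y) * bump_profile 2 (q t)" for t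
    have qd: "(q has_real_derivative - 2 * ((x + t *\<^sub>R y) \<bullet> y)) (at t)" for t
      unfolding q_def by (auto intro!: derivative_eq_intros simp: has_real_derivative_iff_has_vector_derivative[symmetric] inner_commute algebra_simps inner_add_left inner_add_right)
    have h1: "(h has_real_derivative h' t) (at t)" for t
      unfolding h_def h'_def by (rule DERIV_chain2[OF bump_profile_deriv_0 qd])
    have h2: "(h' has_real_derivative h'' t) (at t)" for t
    proof -
      have b2: "(bump_profile 2 has_real_derivative (bump_profile 4 s - 2 * bump_profile 3 s)) (at s)" for s
        using bump_profile_deriv[of 2 s] by (simp add: numeral_eq_Suc)
      show ?thesis unfolding h'_def h''_def
        by (auto intro!: derivative_eq_intros DERIV_chain2[OF b2 qd] simp: power2_eq_square inner_commute algebra_simps)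
    qed
    have b: "\<bar>h'' t\<bar> \<le> B * (norm y)\<^sup>2" for t
    proof (cases "0 < q t")
      case False
      then show ?thesis using B0 by (simp add: h''_def)
    next
      case True
      let ?w = "x + t *\<^sub>R y"
      have "(norm ?w)\<^sup>2 \<le> 1" using True by (simp add: q_def dot_square_norm)
      moreover have "(?w \<bullet> y)^2 \<le> (norm ?w)\<^sup>2 * (norm y)\<^sup>2"
        using Cauchy_Schwarz_ineq[of ?w y] by (simp add: dot_square_norm)
      ultimately have w: "(?w \<bullet> y)^2 \<le> (norm y)\<^sup>2"
        by (meson order_trans mult_left_le_one_le zero_le_power2)
      have 1: "\<bar>bump_profile 4 (q t) - 2 * bump_profile 3 (q t)\<bar> \<le> c 4 + 2 * c 3"
        using c[of 4 "q t"] c[of 3 "q t"] bump_profile_nonneg[of 4 "q t"] bump_profile_nonneg[of 3 "q t"] by linarith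
      have "\<bar>h'' t\<bar> \<le> \<bar>(bump_profile 4 (q t) - 2 * bump_profile 3 (q t)) * (4 * (?w \<bullet> y)^2)\<bar> + \<bar>2 * (y \<bullet> y) * bump_profile 2 (q t)\<bar>"
        unfolding h''_def by (rule abs_triangle_ineq4)
      also have "\<dots> = \<bar>bump_profile 4 (q t) - 2 * bump_profile 3 (q t)\<bar> * (4 * (?w \<bullet> y)^2) + 2 * (norm y)\<^sup>2 * bump_profile 2 (q t)"
        by (simp add: abs_mult dot_square_norm)
      also have "\<dots> \<le> (c 4 + 2 * c 3) * (4 * (norm y)\<^sup>2) + 2 * (norm y)\<^sup>2 * c 2"
        using 1 w c by (intro add_mono mult_mono) auto
      also have "\<dots> = B * (norm y)\<^sup>2" by (simp add: B_def algebra_simps)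
      finally show ?thesis .
    qed
    have e: "second_diff (bump 1 0) x y = 2 * h 0 - h 1 - h (-1)"
      by (simp add: second_diff_def h_def q_def bump_def dot_square_norm)
    have 1: "\<bar>second_diff (bump 1 0) x y\<bar> \<le> 2 * B * (norm y)\<^sup>2"
      unfolding e using second_diff_real_bound[OF h1 h2 b] by simp
    have 2: "\<bar>second_diff (bump 1 0) x y\<bar> \<le> 2"
      using bump_le_1[of 1 0 x] bump_le_1[of 1 0 "x+y"] bump_le_1[of 1 0 "x-y"]
        bump_nonneg[of 1 0 x] bump_nonneg[of 1 0 "x+y"] bump_nonneg[of 1 0 "x-y"]
      unfolding second_diff_def by linarith
    show ?thesis
    proof (cases "(norm y)\<^sup>2 \<le> 1")
      case True
      then have "(2 * B + 2) * min 1 ((norm y)\<^sup>2) = 2 * B * (norm y)\<^sup>2 + 2 * (norm y)\<^sup>2"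
        by (simp add: min_def algebra_simps)
      moreover have "0 \<le> 2 * (norm y)\<^sup>2" by simp
      ultimately show ?thesis using 1 by linarith
    next
      case False
      then show ?thesis using 2 B0 by simp
    qed
  qed
  then show ?thesis using B0 by (intro exI[of _ "2 * B + 2"]) auto
qed

lemma second_diff_bump_scale:
  assumes "0 < e"
  shows "second_diff (bump e z) x y = second_diff (bump 1 0) ((1 / e) *\<^sub>R (x - z)) ((1 / e) *\<^sub>R y)"
  unfolding second_diff_def bump_scale[OF assms, of z] by (simp add: algebra_simps)

lemma second_diff_bump:
  fixes e :: real
  assumes "0 < e"
  obtains B where "0 \<le> B" "\<And>(z::'a::euclidean_space) x y. \<bar>second_diff (bump e z) x y\<bar> \<le> B * min 1 ((norm y)\<^sup>2)"
proof -
  obtain B where B0: "0 \<le> B" and "\<forall>x y::'a. \<bar>second_diff (bump 1 0) x y\<bar> \<le> B * min 1 ((norm y)\<^sup>2)"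
    using second_diff_unit_bump by blast
  then have B: "0 \<le> B" "\<And>x y::'a. \<bar>second_diff (bump 1 0) x y\<bar> \<le> B * min 1 ((norm y)\<^sup>2)" by blast+
  have "\<bar>second_diff (bump e z) x y\<bar> \<le> (B * max 1 (1 / e\<^sup>2)) * min 1 ((norm y)\<^sup>2)" for z x y :: 'a
  proof -
    have "\<bar>second_diff (bump e z) x y\<bar> \<le> B * min 1 ((norm ((1 / e) *\<^sub>R y))\<^sup>2)"
      unfolding second_diff_bump_scale[OF assms] by (rule B(2))
    also have "\<dots> \<le> B * (max 1 (1 / e\<^sup>2) * min 1 ((norm y)\<^sup>2))"
    proof (rule mult_left_mono[OF _ B(1)])
      have "(norm ((1 / e) *\<^sub>R y))\<^sup>2 = (1 / e\<^sup>2) * (norm y)\<^sup>2" using assms by (simp add: power_mult_distrib power_divide)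
      also have "\<dots> \<le> max 1 (1 / e\<^sup>2) * (norm y)\<^sup>2" by (intro mult_right_mono) auto
      finally have "min 1 ((norm ((1 / e) *\<^sub>R y))\<^sup>2) \<le> min (max 1 (1/e\<^sup>2)) (max 1 (1 / e\<^sup>2) * (norm y)\<^sup>2)"
        by (intro min.mono) auto
      also have "\<dots> = max 1 (1 / e\<^sup>2) * min 1 ((norm y)\<^sup>2)"
        by (subst min_mult_distrib_left) auto
      finally show "min 1 ((norm ((1 / e) *\<^sub>R y))\<^sup>2) \<le> max 1 (1 / e\<^sup>2) * min 1 ((norm y)\<^sup>2)" .
    qed
    finally show ?thesis by (simp add: mult.assoc)
  qed
  then show ?thesis using B(1) by (intro that[of "B * max 1 (1 / e\<^sup>2)"]) auto
qed

lemma frac_op_bump_scale: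
  fixes x z :: "'a::euclidean_space"
  assumes e: "0 < e" and s: "0 < s"
  shows "frac_op s (bump e z) x = e powr (- 2 * s) * frac_op s (bump 1 0) ((1 / e) *\<^sub>R (x - z))"
proof -
  let ?x = "(1 / e) *\<^sub>R (x - z)"
  have "(\<integral>y. second_diff (bump e z) x y * frac_kernel s y \<partial>lborel)
    = \<bar>e\<bar> ^ DIM('a) * (\<integral>y. second_diff (bump e z) x (0 + e *\<^sub>R y) * frac_kernel s (0 + e *\<^sub>R y) \<partial>lborel)"
    by (rule integral_affine_euclidean) (use e in auto)
  also have "(\<lambda>y. second_diff (bump e z) x (0 + e *\<^sub>R y) * frac_kernel s (0 + e *\<^sub>R y))
     = (\<lambda>y. e powr - (real DIM('a) + 2 * s) * (second_diff (bump 1 0) ?x y * frac_kernel s y))"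
    by (rule ext, subst second_diff_bump_scale[OF e]) (use e in \<open>simp add: kernel_scale\<close>)
  also have "\<bar>e\<bar> ^ DIM('a) * (\<integral>y. e powr - (real DIM('a) + 2 * s) * (second_diff (bump 1 0) ?x y * frac_kernel s y) \<partial>lborel)
     = (\<bar>e\<bar> ^ DIM('a) * e powr - (real DIM('a) + 2 * s)) * (\<integral>y. second_diff (bump 1 0) ?x y * frac_kernel s y \<partial>lborel)"
    by simp
  also have "\<bar>e\<bar> ^ DIM('a) * e powr - (real DIM('a) + 2 * s) = e powr (-2 * s)"
    using e by (simp add: powr_realpow[symmetric] powr_add[symmetric])
  finally show ?thesis by (simp add: frac_op_def)
qed

text \<open>
  Dominated convergence, with the cut kernel as majorant.
\<close>

lemma frac_op_continuous:
  fixes f :: "'a::euclidean_space \<Rightarrow> real"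
  assumes s: "0 < s" "s < 1" and f: "continuous_on UNIV f"
    and B: "\<And>x y. \<bar>second_diff f x y\<bar> \<le> B * min 1 ((norm y)\<^sup>2)"
  shows "continuous_on UNIV (frac_op s f)"
proof -
  have [measurable]: "f \<in> borel_measurable borel" by (rule borel_measurable_continuous_onI[OF f])
  have "(\<lambda>k. frac_op s f (X k)) \<longlonglongrightarrow> frac_op s f x" if X: "X \<longlonglongrightarrow> x" for X x
  proof -
    have lim: "(\<lambda>k. f (X k + v)) \<longlonglongrightarrow> f (x + v)" for v
      by (rule continuous_on_tendsto_compose[OF f]) (auto intro!: tendsto_intros X)
    have "(\<lambda>k. \<integral>y. second_diff f (X k) y * frac_kernel s y \<partial>lborel) \<longlonglongrightarrow> (\<integral>y. second_diff f x y * frac_kernel s y \<partial>lborel)"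
    proof (rule integral_dominated_convergence[OF _ _ integrable_mult_right[OF integrable_kernel_cut[OF s], of B]])
      show "AE y in lborel. (\<lambda>k. second_diff f (X k) y * frac_kernel s y) \<longlonglongrightarrow> second_diff f x y * frac_kernel s y"
        unfolding second_diff_def using lim[of 0] lim lim[of "- y" for y]
        by (intro AE_I2 tendsto_intros) (auto simp: diff_conv_add_uminus simp del: add_uminus_conv_diff)
      show "AE y in lborel. norm (second_diff f (X k) y * frac_kernel s y) \<le> B * (min 1 ((norm y)\<^sup>2) * frac_kernel s y)" for k
      proof (rule AE_I2)
        fix y :: 'a
        show "norm (second_diff f (X k) y * frac_kernel s y) \<le> B * (min 1 ((norm y)\<^sup>2) * frac_kernel s y)"
          using mult_right_mono[OF B[of "X k" y] kernel_nonneg[of s y]] by (simp add: abs_mult mult.assoc)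
      qed
    qed measurable
    then show ?thesis unfolding frac_op_def by (intro tendsto_intros) auto
  qed
  then show ?thesis by (auto simp: continuous_on_sequentially o_def)
qed

text \<open>
  Where the bump vanishes it has a minimum, so the operator is nonpositive there; on the unit sphere
  it sees the positive values inside the ball, so it is negative.
\<close>

lemma frac_op_unit_bump_outside:
  fixes x :: "'a::euclidean_space"
  assumes s: "0 < s" "s < 1" and x: "1 \<le> norm x"
  shows "frac_op s (bump 1 0) x \<le> 0" and "norm x = 1 \<Longrightarrow> frac_op s (bump 1 0) x < 0"
proof -
  obtain B where "\<forall>x y::'a. \<bar>second_diff (bump 1 0) x y\<bar> \<le> B * min 1 ((norm y)\<^sup>2)"
    using second_diff_unit_bump by blast
  then have B: "\<And>x y::'a. \<bar>second_diff (bump 1 0) x y\<bar> \<le> B * min 1 ((norm y)\<^sup>2)" by blast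
  have x0: "bump 1 0 x = 0" using x by (intro bump_outside) auto
  let ?f = "\<lambda>y. - (second_diff (bump 1 0) x y * frac_kernel s y)"
  have nn: "0 \<le> ?f y" for y
    using x0 mult_nonneg_nonneg[OF add_nonneg_nonneg[OF bump_nonneg[of 1 0 "x+y"] bump_nonneg[of 1 0 "x-y"]] kernel_nonneg[of s y]]
    by (simp add: second_diff_def algebra_simps)
  have i: "integrable lborel ?f"
    by (intro Bochner_Integration.integrable_minus integrable_second_diff_kernel[OF s _ B]) measurable
  have e: "2 * frac_op s (bump 1 0) x = - (\<integral>y. ?f y \<partial>lborel)" by (simp add: frac_op_def)
  have "0 \<le> (\<integral>y. ?f y \<partial>lborel)" by (rule Bochner_Integration.integral_nonneg[OF nn])
  then show le: "frac_op s (bump 1 0) x \<le> 0" using e by linarith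
  assume x1: "norm x = 1"
  have "frac_op s (bump 1 0) x \<noteq> 0"
  proof
    assume "frac_op s (bump 1 0) x = 0"
    then have "(\<integral>y. ?f y \<partial>lborel) = 0" using e by simp
    then have "AE y in lborel. ?f y = 0"
      using integral_nonneg_eq_0_iff_AE[OF i] nn by auto
    then have "AE y in lborel. y \<notin> ball (- x) 1"
    proof eventually_elim
      fix y assume y: "?f y = 0"
      show "y \<notin> ball (- x) 1"
      proof
        assume "y \<in> ball (- x) 1"
        then have n: "norm (x + y) < 1" by (simp add: dist_norm norm_minus_commute add.commute)
        then have "y \<noteq> 0" using x1 by auto
        then have "0 < frac_kernel s y" by (simp add: frac_kernel_def)
        moreover have "0 < bump 1 0 (x + y)" using n by (intro bump_pos) auto
        ultimately have "0 < (bump 1 0 (x + y) + bump 1 0 (x - y)) * frac_kernel s y"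
          by (intro mult_pos_pos add_pos_nonneg) auto
        then show False using y x0 by (simp add: second_diff_def algebra_simps)
      qed
    qed
    then have "ball (- x) 1 \<in> null_sets lborel"
      by (subst (asm) AE_iff_null_sets[symmetric]) auto
    then show False using unit_ball_vol_pos[of "real DIM('a)"] by (simp add: null_sets_def emeasure_ball)
  qed
  then show "frac_op s (bump 1 0) x < 0" using le by simp
qed

text \<open>
  Near the edge of its support the bump is too small to control its gradient. There the operator
  helps: it is negative on the unit sphere, where the gradient term is zero. The set where the left
  side is nonnegative is therefore a compact subset of the open ball, on which the bump is bounded
  below.
\<close>

lemma bump_absorbs_gradient:
  assumes s: "0 < s" "s < 1"
  obtains A where "0 \<le> A"
    "\<And>x::'a::euclidean_space. 2 * (norm x)\<^sup>2 * bump_profile 2 (1 - (norm x)\<^sup>2) + frac_op s (bump 1 0) x \<le> A * bump 1 0 x"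
proof -
  let ?T = "\<lambda>x::'a. 2 * (norm x)\<^sup>2 * bump_profile 2 (1 - (norm x)\<^sup>2) + frac_op s (bump 1 0) x"
  obtain B where "\<forall>x y::'a. \<bar>second_diff (bump 1 0) x y\<bar> \<le> B * min 1 ((norm y)\<^sup>2)"
    using second_diff_unit_bump by blast
  then have B: "\<And>x y::'a. \<bar>second_diff (bump 1 0) x y\<bar> \<le> B * min 1 ((norm y)\<^sup>2)" by blast
  have fc: "continuous_on UNIV (frac_op s (bump 1 (0::'a)))"
    by (rule frac_op_continuous[OF s bump_continuous B])
  have Tc: "continuous_on (cball 0 1) ?T"
  proof -
    have "continuous_on UNIV (\<lambda>x::'a. bump_profile 2 (1 - (norm x)\<^sup>2))"
      by (rule continuous_on_compose2[OF bump_profile_continuous[of UNIV]]) (auto intro!: continuous_intros)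
    then have "continuous_on UNIV ?T"
      using fc by (auto intro!: continuous_intros)
    then show ?thesis by (rule continuous_on_subset) simp
  qed
  have out: "?T x \<le> 0" if "1 \<le> norm x" for x
    using frac_op_unit_bump_outside(1)[OF s that] that by (simp add: one_le_power)
  define S where "S = {x \<in> cball 0 1. 0 \<le> ?T x}"
  have S: "compact S"
  proof -
    have "S = cball 0 1 \<inter> ?T -` {0..}" by (auto simp: S_def)
    then have "closed S" using continuous_closed_preimage[OF Tc, of "{0..}"] by simp
    moreover have "bounded S" by (rule bounded_subset[OF bounded_cball[of 0 1]]) (auto simp: S_def)
    ultimately show ?thesis by (simp add: compact_eq_bounded_closed)
  qed
  have Sp: "0 < bump 1 0 x" if "x \<in> S" for x
  proof (rule bump_pos)
    have "norm x \<noteq> 1"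
    proof
      assume "norm x = 1"
      then have "?T x < 0" using frac_op_unit_bump_outside(2)[OF s, of x] by simp
      then show False using that by (simp add: S_def)
    qed
    then show "norm (x - 0) < 1" using that by (auto simp: S_def)
  qed simp
  have "compact ((\<lambda>x. ?T x / bump 1 0 x) ` S)"
  proof (intro compact_continuous_image S continuous_on_divide)
    show "continuous_on S ?T" by (rule continuous_on_subset[OF Tc]) (auto simp: S_def)
    show "\<forall>x\<in>S. bump 1 0 x \<noteq> 0" using Sp by force
  qed (rule bump_continuous)
  then have "bounded ((\<lambda>x. ?T x / bump 1 0 x) ` S)" by (rule compact_imp_bounded)
  then obtain A where "\<forall>v\<in>(\<lambda>x. ?T x / bump 1 0 x) ` S. norm v \<le> A"
    unfolding bounded_iff by (elim exE)
  then have A: "\<bar>?T x / bump 1 0 x\<bar> \<le> A" if "x \<in> S" for x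
    using that by auto
  show ?thesis
  proof (rule that[of "max 0 A"])
    fix x :: 'a
    show "?T x \<le> max 0 A * bump 1 0 x"
    proof (cases "x \<in> S")
      case True
      have "?T x / bump 1 0 x \<le> max 0 A" using A[OF True] by linarith
      then show ?thesis using Sp[OF True] by (simp add: pos_divide_le_eq)
    next
      case False
      then have "?T x \<le> 0" using out[of x] by (cases "norm x \<le> 1") (auto simp: S_def)
      also have "0 \<le> max 0 A * bump 1 0 x" by simp
      finally show ?thesis .
    qed
  qed simp
qed

text \<open>
  Reflecting \<open>y\<close> in the truncated integral symmetrises the integrand, and the second differences then
  provide an integrable majorant for the limit.
\<close>

lemma frac_laplacian_eq_frac_op:
  fixes f :: "'a::euclidean_space \<Rightarrow> real"
  assumes s: "0 < s" "s < 1" and [measurable]: "f \<in> borel_measurable borel"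
    and bd: "\<And>x. \<bar>f x\<bar> \<le> K"
    and B: "\<And>x y. \<bar>second_diff f x y\<bar> \<le> B * min 1 ((norm y)\<^sup>2)"
  shows "frac_laplacian s f x = frac_laplacian_const DIM('a) s * frac_op s f x"
proof -
  define P where "P \<rho> = (LINT y:(- ball x \<rho>)|lebesgue. (f x - f y) / norm (x - y) powr (real DIM('a) + 2 * s))" for \<rho>
  have P: "P \<rho> = (\<integral>y. indicator (- ball 0 \<rho>) y * (second_diff f x y * frac_kernel s y) \<partial>lborel) / 2" if \<rho>: "0 < \<rho>" for \<rho>
  proof -
    let ?g = "\<lambda>y. indicator (- ball x \<rho>) y * ((f x - f y) / norm (x - y) powr (real DIM('a) + 2 * s))"
    have gm: "?g \<in> borel_measurable borel" by measurable
    have P1: "P \<rho> = (\<integral>y. ?g y \<partial>lborel)"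
      unfolding P_def set_lebesgue_integral_def real_scaleR_def
      by (rule integral_completion) (use gm in simp)
    have ker: "frac_kernel s y = inverse (norm y powr (real DIM('a) + 2 * s))" for y :: 'a
      by (simp only: frac_kernel_def powr_minus)
    have g1: "(\<lambda>y. ?g (x + 1 *\<^sub>R y)) = (\<lambda>y. indicator (- ball 0 \<rho>) y * ((f x - f (x + y)) * frac_kernel s y))"
      by (auto simp: fun_eq_iff indicator_def ker divide_inverse dist_norm)
    have g2: "(\<lambda>y. ?g (x + (-1) *\<^sub>R y)) = (\<lambda>y. indicator (- ball 0 \<rho>) y * ((f x - f (x - y)) * frac_kernel s y))"
      by (auto simp: fun_eq_iff indicator_def ker divide_inverse dist_norm)
    have p1: "P \<rho> = (\<integral>y. indicator (- ball 0 \<rho>) y * ((f x - f (x + y)) * frac_kernel s y) \<partial>lborel)"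
      unfolding P1 by (subst integral_affine_euclidean[OF gm, of 1 x]) (simp_all only: g1, simp_all)
    have p2: "P \<rho> = (\<integral>y. indicator (- ball 0 \<rho>) y * ((f x - f (x - y)) * frac_kernel s y) \<partial>lborel)"
      unfolding P1 by (subst integral_affine_euclidean[OF gm, of "-1" x]) (simp_all only: g2, simp_all)
    have ki: "integrable lborel (\<lambda>y::'a. indicator (- ball 0 \<rho>) y * frac_kernel s y)"
      by (rule integrable_kernel_outside[OF s _ \<rho>]) auto
    have i: "integrable lborel (\<lambda>y. indicator (- ball 0 \<rho>) y * ((f x - f (h y)) * frac_kernel s y))"
      if [measurable]: "h \<in> borel_measurable borel" for h :: "'a \<Rightarrow> 'a"
    proof (rule Bochner_Integration.integrable_bound[OF integrable_mult_right[OF ki, of "2 * K"]])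
      show "AE y in lborel. norm (indicator (- ball 0 \<rho>) y * ((f x - f (h y)) * frac_kernel s y))
        \<le> norm (2 * K * (indicator (- ball 0 \<rho>) y * frac_kernel s y))"
      proof (rule AE_I2)
        fix y
        have "\<bar>f x - f (h y)\<bar> \<le> \<bar>2 * K\<bar>" using bd[of x] bd[of "h y"] by linarith
        then have "\<bar>f x - f (h y)\<bar> * frac_kernel s y \<le> \<bar>2 * K\<bar> * frac_kernel s y" by (intro mult_right_mono) auto
        then show "norm (indicator (- ball 0 \<rho>) y * ((f x - f (h y)) * frac_kernel s y))
        \<le> norm (2 * K * (indicator (- ball 0 \<rho>) y * frac_kernel s y))"
          by (auto simp: abs_mult indicator_def)
      qed
    qed measurable
    have "P \<rho> + P \<rho> = (\<integral>y. indicator (- ball 0 \<rho>) y * ((f x - f (x + y)) * frac_kernel s y)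
        + indicator (- ball 0 \<rho>) y * ((f x - f (x - y)) * frac_kernel s y) \<partial>lborel)"
      by (subst Bochner_Integration.integral_add) (auto intro!: i simp: p1[symmetric] p2[symmetric])
    also have "\<dots> = (\<integral>y. indicator (- ball 0 \<rho>) y * (second_diff f x y * frac_kernel s y) \<partial>lborel)"
      by (intro Bochner_Integration.integral_cong) (auto simp: second_diff_def algebra_simps)
    finally show ?thesis by simp
  qed
  have lim: "(P \<longlongrightarrow> frac_op s f x) (at_right 0)"
  proof (rule tendsto_at_right_sequentially[of 0 1])
    fix S :: "nat \<Rightarrow> real" assume S: "\<And>n. 0 < S n" "S \<longlonglongrightarrow> 0"
    have "(\<lambda>n. \<integral>y. indicator (- ball 0 (S n)) y * (second_diff f x y * frac_kernel s y) \<partial>lborel)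
       \<longlonglongrightarrow> (\<integral>y. second_diff f x y * frac_kernel s y \<partial>lborel)"
    proof (rule integral_dominated_convergence[OF _ _ integrable_norm[OF integrable_second_diff_kernel[OF s _ B]]])
      show "AE y in lborel. (\<lambda>n. indicator (- ball 0 (S n)) y * (second_diff f x y * frac_kernel s y)) \<longlonglongrightarrow> second_diff f x y * frac_kernel s y"
      proof (rule AE_I2)
        fix y :: 'a
        show "(\<lambda>n. indicator (- ball 0 (S n)) y * (second_diff f x y * frac_kernel s y)) \<longlonglongrightarrow> second_diff f x y * frac_kernel s y"
        proof (cases "y = 0")
          case False
          then have "\<forall>\<^sub>F n in sequentially. S n < norm y"
            using order_tendstoD(2)[OF S(2)] by simp
          then have "\<forall>\<^sub>F n in sequentially. indicator (- ball 0 (S n)) y * (second_diff f x y * frac_kernel s y) = second_diff f x y * frac_kernel s y"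
            by eventually_elim (auto simp: indicator_def)
          then show ?thesis by (rule tendsto_eventually)
        qed simp
      qed
      show "AE y in lborel. norm (indicator (- ball 0 (S n)) y * (second_diff f x y * frac_kernel s y)) \<le> norm (second_diff f x y * frac_kernel s y)" for n
        by (intro AE_I2) (auto simp: indicator_def)
    qed measurable
    then have "(\<lambda>n. (\<integral>y. indicator (- ball 0 (S n)) y * (second_diff f x y * frac_kernel s y) \<partial>lborel) / 2) \<longlonglongrightarrow> frac_op s f x"
      unfolding frac_op_def by (intro tendsto_intros) auto
    then show "(\<lambda>n. P (S n)) \<longlonglongrightarrow> frac_op s f x" by (simp only: P[OF S(1)])
  qed simp
  show ?thesis
    unfolding frac_laplacian_def P_def[symmetric] using tendsto_Lim[OF _ lim] by simp
qed

section \<open>Mollification\<close>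

lemma integrable_mult_bounded_support:
  fixes u g :: "'a::euclidean_space \<Rightarrow> real"
  assumes u: "integrable lborel (\<lambda>x. u x / (1 + norm x powr (real DIM('a) + 2 * s)))" and s: "0 < s"
    and [measurable]: "u \<in> borel_measurable borel" "g \<in> borel_measurable borel"
    and g: "\<And>x. \<bar>g x\<bar> \<le> K * indicator (cball 0 R) x"
  shows "integrable lborel (\<lambda>x. u x * g x)"
proof (rule Bochner_Integration.integrable_bound[OF integrable_mult_right[OF u, of "\<bar>K\<bar> * (1 + \<bar>R\<bar> powr (real DIM('a) + 2 * s))"]])
  let ?w = "\<lambda>x::'a. 1 + norm x powr (real DIM('a) + 2 * s)"
  show "AE x in lborel. norm (u x * g x) \<le> norm (\<bar>K\<bar> * (1 + \<bar>R\<bar> powr (real DIM('a) + 2 * s)) * (u x / ?w x))"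
  proof (rule AE_I2)
    fix x
    have wpos: "0 < ?w x" by (rule add_pos_nonneg) auto
    show "norm (u x * g x) \<le> norm (\<bar>K\<bar> * (1 + \<bar>R\<bar> powr (real DIM('a) + 2 * s)) * (u x / ?w x))"
    proof (cases "x \<in> cball 0 R")
      case True
      then have "norm x powr (real DIM('a) + 2 * s) \<le> \<bar>R\<bar> powr (real DIM('a) + 2 * s)"
        using s by (intro powr_mono2) auto
      then have 1: "1 \<le> (1 + \<bar>R\<bar> powr (real DIM('a) + 2 * s)) / ?w x" using wpos by simp
      have gK: "\<bar>g x\<bar> \<le> \<bar>K\<bar>" using g[of x] True by auto
      have "norm (u x * g x) = \<bar>u x\<bar> * \<bar>g x\<bar>" by (simp add: abs_mult)
      also have "\<dots> \<le> \<bar>u x\<bar> * (\<bar>K\<bar> * ((1 + \<bar>R\<bar> powr (real DIM('a) + 2 * s)) / ?w x))"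
        using mult_mono[OF gK 1] by (intro mult_left_mono) auto
      also have "\<dots> = norm (\<bar>K\<bar> * (1 + \<bar>R\<bar> powr (real DIM('a) + 2 * s)) * (u x / ?w x))"
        using wpos by (simp add: abs_mult abs_of_pos add_nonneg_nonneg)
      finally show ?thesis .
    next
      case False
      then have "g x = 0" using g[of x] by simp
      then show ?thesis by simp
    qed
  qed
qed measurable

lemma bump_le_indicator:
  assumes "0 < e" "norm z + e \<le> R"
  shows "\<bar>bump e z x\<bar> \<le> 1 * indicator (cball 0 R) x"
proof (cases "x \<in> cball 0 R")
  case True
  then show ?thesis using bump_le_1[of e z x] by simp
next
  case False
  then have "norm x > norm z + e" using assms by simp
  then have "e \<le> norm (x - z)" using norm_triangle_ineq2[of x z] by linarith
  then have "bump e z x = 0" by (rule bump_outside[OF assms(1)])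
  then show ?thesis using False by simp
qed

lemma integrable_bump: "0 < e \<Longrightarrow> integrable lborel (bump e (z::'a::euclidean_space))"
proof -
  assume e: "0 < e"
  have "integrable lborel (\<lambda>x. indicator (cball 0 (norm z + e)) x :: real)"
    by (intro integrable_real_indicator) (auto simp: emeasure_cball e less_imp_le add_nonneg_nonneg)
  then show ?thesis
  proof (rule Bochner_Integration.integrable_bound)
    show "AE x in lborel. norm (bump e z x) \<le> norm (indicator (cball 0 (norm z + e)) x :: real)"
      using bump_le_indicator[OF e order_refl, of z] by (intro AE_I2) auto
  qed measurable
qed

definition mollify :: "real \<Rightarrow> ('a::euclidean_space \<Rightarrow> real) \<Rightarrow> 'a \<Rightarrow> real" where
  "mollify e u z = (\<integral>x. u x * bump e z x \<partial>lborel)"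

text \<open>
  A nonnegative Borel function in the weighted space. Working with a Borel version gives access to
  Fubini's theorem for the product of Borel measures.
\<close>

locale weighted_nonneg =
  fixes s :: real and u :: "'a::euclidean_space \<Rightarrow> real"
  assumes s: "0 < s" "s < 1"
    and u_measurable [measurable]: "u \<in> borel_measurable borel"
    and u_nonneg: "\<And>x. 0 \<le> u x"
    and u_weighted: "integrable lborel (\<lambda>x. u x / (1 + norm x powr (real DIM('a) + 2 * s)))"
begin

lemmas integrable_u_mult = integrable_mult_bounded_support[OF u_weighted s(1) u_measurable]

lemma integrable_u_bump: "0 < e \<Longrightarrow> integrable lborel (\<lambda>x. u x * bump e z x)"
  by (rule integrable_u_mult[OF _ bump_le_indicator[OF _ order_refl]]) auto

lemma mollify_nonneg: "0 \<le> mollify e u z"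
  unfolding mollify_def by (intro Bochner_Integration.integral_nonneg mult_nonneg_nonneg u_nonneg bump_nonneg)

lemma mollify_continuous:
  assumes e: "0 < e"
  shows "continuous_on UNIV (mollify e u)"
proof -
  have "(\<lambda>k. mollify e u (X k)) \<longlonglongrightarrow> mollify e u z" if X: "X \<longlonglongrightarrow> z" for X z
  proof -
    have "Bseq X" using X by (intro convergent_imp_Bseq convergentI)
    then obtain K where "\<forall>k. norm (X k) \<le> K" unfolding Bseq_def by blast
    then have K: "\<And>k. norm (X k) \<le> K" by blast
    have ind: "integrable lborel (\<lambda>x. u x * indicator (cball 0 (K + e)) x)"
      by (rule integrable_u_mult[where K = 1 and R = "K + e"], measurable) (auto simp: indicator_def)
    show ?thesis unfolding mollify_def
    proof (rule integral_dominated_convergence[OF _ _ ind])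
      show "AE x in lborel. (\<lambda>k. u x * bump e (X k) x) \<longlonglongrightarrow> u x * bump e z x"
      proof (rule AE_I2)
        fix x
        have "(\<lambda>k. bump e (X k) x) \<longlonglongrightarrow> bump e z x"
          by (rule continuous_on_tendsto_compose[OF bump_continuous_center[of UNIV] X]) auto
        then show "(\<lambda>k. u x * bump e (X k) x) \<longlonglongrightarrow> u x * bump e z x"
          by (intro tendsto_intros)
      qed
      show "AE x in lborel. norm (u x * bump e (X k) x) \<le> u x * indicator (cball 0 (K + e)) x" for k
      proof (rule AE_I2)
        fix x
        have "\<bar>bump e (X k) x\<bar> \<le> 1 * indicator (cball 0 (K + e)) x"
          using K[of k] by (intro bump_le_indicator e) auto
        then show "norm (u x * bump e (X k) x) \<le> u x * indicator (cball 0 (K + e)) x"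
          using u_nonneg[of x] by (simp add: abs_mult mult_left_mono)
      qed
    qed measurable
  qed
  then show ?thesis by (auto simp: continuous_on_sequentially o_def)
qed

text \<open>
  The integral of the second differences decays like the weight at infinity: far from the bump only
  those \<open>y\<close> contribute for which \<open>x + y\<close> or \<open>x - y\<close> is in its support, and these have length at least
  \<open>|x| / 2\<close>. This is the majorant that makes Fubini's theorem applicable.
\<close>

lemma second_diff_bump_weight:
  assumes e: "0 < e"
  obtains C where "0 \<le> C" "\<And>x::'a. (\<integral>y. \<bar>second_diff (bump e z) x y * frac_kernel s y\<bar> \<partial>lborel) \<le> C / (1 + norm x powr (real DIM('a) + 2 * s))"
proof -
  let ?d = "real DIM('a) + 2 * s"
  obtain B where B0: "0 \<le> B" and B: "\<And>(z::'a) x y. \<bar>second_diff (bump e z) x y\<bar> \<le> B * min 1 ((norm y)\<^sup>2)"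
    using second_diff_bump[OF e] by metis
  define I where "I = (\<integral>y. B * (min 1 ((norm (y::'a))\<^sup>2) * frac_kernel s y) \<partial>lborel)"
  define N where "N = (\<integral>x. bump e z x \<partial>lborel)"
  \<comment> \<open>Beyond this radius, the distance from x to the bump is at least |x| / 2 and |x| is at least 1.\<close>
  define R where "R = 4 * norm z + 4 * e + 1"
  have R: "0 < R" using e by (simp add: R_def add_nonneg_pos)
  have I0: "0 \<le> I" unfolding I_def using B0 by (intro Bochner_Integration.integral_nonneg) auto
  have N0: "0 \<le> N" unfolding N_def by (intro Bochner_Integration.integral_nonneg) auto
  define C where "C = I * (1 + R powr ?d) + 2 * N * (2 powr ?d * 2)"
  have C1: "I * (1 + R powr ?d) \<le> C" "2 * N * (2 powr ?d * 2) \<le> C" "0 \<le> C"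
    unfolding C_def using I0 N0 by (auto simp: add_nonneg_nonneg)
  have main: "(\<integral>y. \<bar>second_diff (bump e z) x y * frac_kernel s y\<bar> \<partial>lborel) \<le> C / (1 + norm x powr ?d)" for x
  proof -
    have wpos: "0 < 1 + norm x powr ?d" by (rule add_pos_nonneg) auto
    have "integrable lborel (\<lambda>y. second_diff (bump e z) x y * frac_kernel s y)"
      by (rule integrable_second_diff_kernel[OF s bump_measurable B])
    then have i: "integrable lborel (\<lambda>y. \<bar>second_diff (bump e z) x y * frac_kernel s y\<bar>)"
      by (rule integrable_abs)
    show ?thesis
    proof (cases "norm x \<le> R")
      case True
      have "(\<integral>y. \<bar>second_diff (bump e z) x y * frac_kernel s y\<bar> \<partial>lborel) \<le> I"
        unfolding I_def
      proof (rule integral_mono[OF i integrable_mult_right[OF integrable_kernel_cut[OF s]]])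
        fix y :: 'a
        show "\<bar>second_diff (bump e z) x y * frac_kernel s y\<bar> \<le> B * (min 1 ((norm y)\<^sup>2) * frac_kernel s y)"
          using mult_right_mono[OF B[of z x y] kernel_nonneg[of s y]] by (simp add: abs_mult mult.assoc)
      qed
      also have "I * (1 + norm x powr ?d) \<le> C"
      proof -
        have "norm x powr ?d \<le> R powr ?d" using True s by (intro powr_mono2) auto
        then have "I * (1 + norm x powr ?d) \<le> I * (1 + R powr ?d)" using I0 by (intro mult_left_mono) auto
        then show ?thesis using C1 by linarith
      qed
      then have "I \<le> C / (1 + norm x powr ?d)" using wpos by (simp add: pos_le_divide_eq)
      finally show ?thesis .
    next
      case False
      define a where "a = (norm x / 2) powr - ?d"
      have nx: "1 \<le> norm x" "norm z + e \<le> norm x / 2"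
        using False e norm_ge_zero[of z] unfolding R_def by linarith+
      have x0: "bump e z x = 0"
      proof (rule bump_outside[OF e])
        show "e \<le> norm (x - z)" using norm_triangle_ineq2[of x z] nx by linarith
      qed
      have bk: "bump e z (x + y) * frac_kernel s y \<le> a * bump e z (x + y)" for y
      proof (cases "bump e z (x + y) = 0")
        case False
        then have "norm (x + y - z) < e" using bump_outside[OF e, of "x + y" z] by force
        moreover have "norm x \<le> norm (x + y - z) + norm y + norm z"
          using norm_triangle_ineq4[of "x + y - z" "y - z"] norm_triangle_ineq4[of y z] by (simp add: algebra_simps)
        ultimately have "norm x / 2 \<le> norm y" using nx by linarith
        then have "frac_kernel s y \<le> a" unfolding a_def using nx s by (intro kernel_mono) auto
        then have "bump e z (x + y) * frac_kernel s y \<le> bump e z (x + y) * a" by (intro mult_left_mono) auto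
        then show ?thesis by (simp add: mult.commute)
      qed simp
      have t1: "integrable lborel (\<lambda>y. bump e z (x + y))" "(\<integral>y. bump e z (x + y) \<partial>lborel) = N"
        using integrable_affine_euclidean[OF integrable_bump[OF e, of z], of 1 x]
          integral_affine_euclidean[OF bump_measurable, of 1 e z x] by (simp_all add: N_def)
      have t2: "integrable lborel (\<lambda>y. bump e z (x - y))" "(\<integral>y. bump e z (x - y) \<partial>lborel) = N"
        using integrable_affine_euclidean[OF integrable_bump[OF e, of z], of "-1" x]
          integral_affine_euclidean[OF bump_measurable, of "-1" e z x] by (simp_all add: N_def)
      have "(\<integral>y. \<bar>second_diff (bump e z) x y * frac_kernel s y\<bar> \<partial>lborel)
         \<le> (\<integral>y. a * (bump e z (x + y) + bump e z (x - y)) \<partial>lborel)"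
      proof (rule integral_mono[OF i])
        show "integrable lborel (\<lambda>y. a * (bump e z (x + y) + bump e z (x - y)))"
          using t1 t2 by simp
        fix y
        have "\<bar>second_diff (bump e z) x y * frac_kernel s y\<bar> = bump e z (x + y) * frac_kernel s y + bump e z (x + (- y)) * frac_kernel s (- y)"
        proof -
          have "\<bar>second_diff (bump e z) x y\<bar> = bump e z (x + y) + bump e z (x - y)"
            unfolding second_diff_def x0
            using bump_nonneg[of e z "x + y"] bump_nonneg[of e z "x - y"] by linarith
          then show ?thesis by (simp add: abs_mult distrib_right)
        qed
        also have "\<dots> \<le> a * bump e z (x + y) + a * bump e z (x + (- y))"
          by (intro add_mono bk)
        finally show "\<bar>second_diff (bump e z) x y * frac_kernel s y\<bar> \<le> a * (bump e z (x + y) + bump e z (x - y))"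
          by (simp add: distrib_left)
      qed
      also have "\<dots> = 2 * N * a" using t1 t2 by simp
      also have "2 * N * a \<le> C / (1 + norm x powr ?d)"
      proof -
        have "1 \<le> norm x powr ?d" using nx s by (intro ge_one_powr_ge_zero) auto
        moreover have "a * norm x powr ?d = 2 powr ?d"
        proof -
          have "norm x powr ?d = (norm x / 2) powr ?d * 2 powr ?d"
            using powr_mult[of "norm x / 2" 2 ?d] by simp
          moreover have "a = inverse ((norm x / 2) powr ?d)" unfolding a_def by (rule powr_minus)
          moreover have "norm x / 2 \<noteq> 0" using nx by auto
          then have "(norm x / 2) powr ?d \<noteq> 0" by simp
          ultimately show ?thesis by simp
        qed
        moreover have "0 \<le> a" by (simp add: a_def)
        ultimately have "a * (1 + norm x powr ?d) \<le> 2 powr ?d * 2"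
          using mult_left_mono[of 1 "norm x powr ?d" a] by (simp add: distrib_left)
        then have "2 * N * (a * (1 + norm x powr ?d)) \<le> 2 * N * (2 powr ?d * 2)"
          using N0 by (intro mult_left_mono) auto
        then show ?thesis using C1 wpos by (simp add: pos_le_divide_eq mult.assoc)
      qed
      finally show ?thesis .
    qed
  qed
  show ?thesis by (rule that[OF C1(3) main])
qed

text \<open>
  Translations commute with second differences, so testing with the operator applied to a bump is
  applying the operator to the mollification.
\<close>

lemma frac_op_mollify:
  assumes e: "0 < e"
  shows "integrable lborel (\<lambda>x. u x * frac_op s (bump e z) x)"
    and "integrable lborel (\<lambda>y. second_diff (mollify e u) z y * frac_kernel s y)"
    and "(\<integral>x. u x * frac_op s (bump e z) x \<partial>lborel) = frac_op s (mollify e u) z"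
proof -
  let ?w = "\<lambda>x::'a. 1 + norm x powr (real DIM('a) + 2 * s)"
  define f where "f x y = u x * (second_diff (bump e z) x y * frac_kernel s y)" for x y
  obtain B where B: "\<And>(z::'a) x y. \<bar>second_diff (bump e z) x y\<bar> \<le> B * min 1 ((norm y)\<^sup>2)"
    using second_diff_bump[OF e] by metis
  obtain C where C: "0 \<le> C" "\<And>x. (\<integral>y. \<bar>second_diff (bump e z) x y * frac_kernel s y\<bar> \<partial>lborel) \<le> C / ?w x"
    using second_diff_bump_weight[OF e, of z] by metis
  have i: "integrable lborel (\<lambda>y. second_diff (bump e z) x y * frac_kernel s y)" for x
    by (intro integrable_second_diff_kernel[OF s _ B]) measurable
  have fm [measurable]: "case_prod f \<in> borel_measurable (lborel \<Otimes>\<^sub>M lborel)"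
    unfolding f_def second_diff_def by measurable
  have fi: "integrable (lborel \<Otimes>\<^sub>M lborel) (case_prod f)"
  proof (rule lborel_pair.Fubini_integrable)
    show "integrable lborel (\<lambda>x. \<integral>y. norm (case_prod f (x, y)) \<partial>lborel)"
    proof (rule Bochner_Integration.integrable_bound[OF integrable_mult_right[OF u_weighted, of C]])
      show "AE x in lborel. norm (\<integral>y. norm (case_prod f (x, y)) \<partial>lborel) \<le> norm (C * (u x / ?w x))"
      proof (rule AE_I2)
        fix x
        have "0 < ?w x" by (rule add_pos_nonneg) auto
        have e1: "(\<integral>y. norm (case_prod f (x, y)) \<partial>lborel) = u x * (\<integral>y. \<bar>second_diff (bump e z) x y * frac_kernel s y\<bar> \<partial>lborel)"
          using u_nonneg[of x] by (simp add: f_def abs_mult)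
        have "0 \<le> u x * (\<integral>y. \<bar>second_diff (bump e z) x y * frac_kernel s y\<bar> \<partial>lborel)"
          using u_nonneg[of x] by (intro mult_nonneg_nonneg Bochner_Integration.integral_nonneg) auto
        moreover have "u x * (\<integral>y. \<bar>second_diff (bump e z) x y * frac_kernel s y\<bar> \<partial>lborel) \<le> u x * (C / ?w x)"
          by (intro mult_left_mono C u_nonneg)
        moreover have "u x * (C / ?w x) = C * (u x / ?w x)" by simp
        ultimately show "norm (\<integral>y. norm (case_prod f (x, y)) \<partial>lborel) \<le> norm (C * (u x / ?w x))"
          unfolding e1 unfolding real_norm_def by linarith
      qed
    qed measurable
    show "AE x in lborel. integrable lborel (\<lambda>y. case_prod f (x, y))"
      unfolding prod.case f_def by (intro AE_I2 integrable_mult_right i)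
  qed measurable
  have inner1: "(\<integral>y. f x y \<partial>lborel) = 2 * (u x * frac_op s (bump e z) x)" for x
    by (simp add: f_def frac_op_def)
  have inner2: "(\<integral>x. f x y \<partial>lborel) = second_diff (mollify e u) z y * frac_kernel s y" for y
  proof -
    have "(\<integral>x. f x y \<partial>lborel) = (\<integral>x. (2 * (u x * bump e z x) - u x * bump e (z - y) x - u x * bump e (z + y) x) * frac_kernel s y \<partial>lborel)"
      by (intro Bochner_Integration.integral_cong) (auto simp: f_def second_diff_def bump_translate algebra_simps)
    also have "\<dots> = (2 * mollify e u z - mollify e u (z - y) - mollify e u (z + y)) * frac_kernel s y"
      unfolding mollify_def using integrable_u_bump[OF e] by simp
    finally show ?thesis by (simp add: second_diff_def)
  qed
  have "integrable lborel (\<lambda>x. 2 * (u x * frac_op s (bump e z) x))"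
    using lborel_pair.integrable_fst[OF fi] by (simp add: inner1)
  then show "integrable lborel (\<lambda>x. u x * frac_op s (bump e z) x)" by simp
  show "integrable lborel (\<lambda>y. second_diff (mollify e u) z y * frac_kernel s y)"
    using lborel_pair.integrable_snd[OF fi] by (simp add: inner2)
  have "2 * (\<integral>x. u x * frac_op s (bump e z) x \<partial>lborel) = (\<integral>x. (\<integral>y. f x y \<partial>lborel) \<partial>lborel)"
    by (simp add: inner1)
  also have "\<dots> = (\<integral>y. (\<integral>x. f x y \<partial>lborel) \<partial>lborel)"
    by (rule lborel_pair.Fubini_integral[OF fi, symmetric])
  also have "\<dots> = 2 * frac_op s (mollify e u) z"
    by (simp add: inner2 frac_op_def)
  finally show "(\<integral>x. u x * frac_op s (bump e z) x \<partial>lborel) = frac_op s (mollify e u) z" by simp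
qed

end

section \<open>The nonlocal minimum principle\<close>

lemma second_diff_shift: "second_diff (\<lambda>x. f (x - c)) z y = second_diff f (z - c) y"
  by (simp add: second_diff_def algebra_simps)

lemma measure_annulus:
  fixes c :: "'a::euclidean_space"
  assumes "0 < r"
  shows "measure lborel (cball c (7 / 8 * r) - ball c (3 / 4 * r)) = r ^ DIM('a) * measure lborel (cball (0::'a) (7 / 8) - ball 0 (3 / 4))"
proof -
  have *: "measure lborel (cball c' (7 / 8 * r') - ball c' (3 / 4 * r')) = r' ^ DIM('a) * (unit_ball_vol (DIM('a)) * ((7 / 8) ^ DIM('a) - (3 / 4) ^ DIM('a)))"
    if "0 < r'" for c' :: 'a and r' :: real
  proof -
    have "ball c' (3 / 4 * r') \<subseteq> cball c' (7 / 8 * r')" using that by (intro subset_trans[OF ball_subset_cball subset_cball]) auto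
    then have "measure lborel (cball c' (7 / 8 * r') - ball c' (3 / 4 * r')) = measure lborel (cball c' (7 / 8 * r')) - measure lborel (ball c' (3 / 4 * r'))"
      using that by (intro measure_Diff) (auto simp: emeasure_cball)
    also have "\<dots> = unit_ball_vol (DIM('a)) * (7 / 8 * r') ^ DIM('a) - unit_ball_vol (DIM('a)) * (3 / 4 * r') ^ DIM('a)"
      using that by (simp add: content_ball content_cball)
    finally show ?thesis by (simp add: power_mult_distrib power_divide right_diff_distrib ac_simps)
  qed
  show ?thesis using *[OF assms, of c] *[of 1 "0::'a"] by simp
qed

definition annulus_const :: "real \<Rightarrow> 'a::euclidean_space itself \<Rightarrow> real" where
  "annulus_const s _ = measure lborel (cball (0::'a) (7 / 8) - ball 0 (3 / 4)) * 2 powr - (real DIM('a) + 2 * s)"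

definition kernel_tail :: "real \<Rightarrow> 'a::euclidean_space itself \<Rightarrow> real" where
  "kernel_tail s _ = (\<integral>y. indicator (- ball 0 1) y * frac_kernel s (y::'a) \<partial>lborel)"

lemma kernel_tail_nonneg: "0 \<le> kernel_tail s TYPE('a::euclidean_space)"
  unfolding kernel_tail_def by (intro Bochner_Integration.integral_nonneg) auto

lemma annulus_const_pos: "0 < annulus_const s TYPE('a::euclidean_space)"
proof -
  have "(3 / 4 :: real) ^ DIM('a) < (7 / 8) ^ DIM('a)" by (intro power_strict_mono) auto
  moreover have "measure lborel (cball (0::'a) (7 / 8) - ball 0 (3 / 4)) = unit_ball_vol (DIM('a)) * ((7 / 8) ^ DIM('a) - (3 / 4) ^ DIM('a))"
  proof -
    have "ball (0::'a) (3 / 4) \<subseteq> cball 0 (7 / 8)" by (intro subset_trans[OF ball_subset_cball subset_cball]) auto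
    then have "measure lborel (cball (0::'a) (7 / 8) - ball 0 (3 / 4)) = measure lborel (cball (0::'a) (7 / 8)) - measure lborel (ball (0::'a) (3 / 4))"
      by (intro measure_Diff) (auto simp: emeasure_cball)
    then show ?thesis by (simp add: content_ball content_cball right_diff_distrib)
  qed
  ultimately have "0 < measure lborel (cball (0::'a) (7 / 8) - ball 0 (3 / 4))"
    using unit_ball_vol_pos[of "real DIM('a)"] by simp
  then show ?thesis by (simp add: annulus_const_def)
qed

text \<open>
  At a minimum point \<open>z\<close> of \<open>U\<close> plus a multiple of the barrier, the increments of \<open>U\<close> are controlled
  by those of the barrier inside the ball of radius \<open>7 r / 8\<close>. Outside, \<open>U\<close> is only known to be
  nonnegative, which costs \<open>w\<close> times the tail of the kernel. In the annulus \<open>U\<close> is at least \<open>m\<close>,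
  which gains \<open>m\<close> times the mass of the kernel there. This nonlocal gain is what a local operator
  would not give.
\<close>

lemma frac_op_at_minimum:
  fixes U :: "'a::euclidean_space \<Rightarrow> real"
  assumes s: "0 < s" "s < 1" and r: "0 < r" and L: "1 \<le> L" and \<delta>: "0 \<le> \<delta>" and w: "0 \<le> w" and m: "0 \<le> m"
    and U: "\<And>y. 0 \<le> U y"
    and Um: "\<And>y. 5 / 8 * r \<le> norm (y - x0) \<Longrightarrow> norm (y - x0) \<le> 7 / 8 * r \<Longrightarrow> m \<le> U y"
    and z: "norm (z - x0) < 5 / 8 * r"
    and zw: "U z + \<delta> * barrier L (z - x0) \<le> w"
    and zmin: "\<And>y. norm (y - x0) \<le> 7 / 8 * r \<Longrightarrow> U z + \<delta> * barrier L (z - x0) \<le> U y + \<delta> * barrier L (y - x0)"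
    and Ui: "integrable lborel (\<lambda>y. second_diff U z y * frac_kernel s y)"
  shows "frac_op s U z \<le> - \<delta> * frac_op s (\<lambda>x. barrier L x) (z - x0)
    + w * ((1 / 8 * r) powr (- 2 * s) * kernel_tail s TYPE('a)) - m * (r powr (- 2 * s) * annulus_const s TYPE('a))"
proof -
  \<comment> \<open>Directions that leave the ball of radius 3r/4, and those that end in the annulus outside it.\<close>
  define O' where "O' = - ball (x0 - z) (3 / 4 * r)"
  define A where "A = cball (x0 - z) (7 / 8 * r) - ball (x0 - z) (3 / 4 * r)"
  have inO: "y \<in> O' \<longleftrightarrow> 3 / 4 * r \<le> norm (z + y - x0)" for y
    by (simp add: O'_def dist_norm norm_minus_commute algebra_simps not_less)
  have inA: "y \<in> A \<longleftrightarrow> 3 / 4 * r \<le> norm (z + y - x0) \<and> norm (z + y - x0) \<le> 7 / 8 * r" for y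
    by (auto simp add: A_def dist_norm norm_minus_commute algebra_simps not_less)
  have [measurable]: "O' \<in> sets borel" "A \<in> sets borel" unfolding O'_def A_def by auto
  have Od: "1 / 8 * r \<le> norm y" if "y \<in> O'" for y
  proof -
    have "norm (z + y - x0) \<le> norm (z - x0) + norm y"
      using norm_triangle_ineq[of "z - x0" y] by (simp add: algebra_simps)
    then show ?thesis using that z by (simp add: inO)
  qed
  have AO: "A \<subseteq> O'" by (auto simp: inA inO)
  define R where "R y = w * (indicator O' y * frac_kernel s y) - m * (indicator A y * frac_kernel s y)" for y
  have Oi: "integrable lborel (\<lambda>y. indicator O' y * frac_kernel s y)"
    by (rule integrable_kernel_outside[OF s _ _ Od]) (use r in auto)
  have Ai: "integrable lborel (\<lambda>y. indicator A y * frac_kernel s y)"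
    by (rule integrable_kernel_outside[OF s _ _ Od]) (use r AO in auto)
  have Ri: "integrable lborel R" unfolding R_def using Oi Ai by simp
  have Rm: "integrable lborel (\<lambda>y. R (- y))" "(\<integral>y. R (- y) \<partial>lborel) = (\<integral>y. R y \<partial>lborel)"
    using integrable_affine_euclidean[OF Ri, of "-1" 0] integral_reflect_euclidean[of R 0] borel_measurable_integrable[OF Ri] by simp_all
  have Bi: "integrable lborel (\<lambda>y. second_diff (\<lambda>x. barrier L (x - x0)) z y * frac_kernel s y)"
    unfolding second_diff_shift[of "\<lambda>x. barrier L x"]
    by (rule integrable_second_diff_kernel[OF s _ second_diff_barrier[OF L]]) measurable
  have Be: "(\<integral>y. second_diff (\<lambda>x. barrier L (x - x0)) z y * frac_kernel s y \<partial>lborel) = 2 * frac_op s (\<lambda>x. barrier L x) (z - x0)"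
    unfolding second_diff_shift[of "\<lambda>x. barrier L x"] frac_op_def by simp
  have pt: "(U z - U (z + y)) * frac_kernel s y \<le> - \<delta> * ((barrier L (z - x0) - barrier L (z + y - x0)) * frac_kernel s y) + R y" for y
  proof -
    have nb: "0 \<le> \<delta> * barrier L (z + y - x0)" using \<delta> barrier_profile_nonneg by (intro mult_nonneg_nonneg) auto
    have "U z - U (z + y) \<le> - \<delta> * (barrier L (z - x0) - barrier L (z + y - x0)) + (w * indicator O' y - m * indicator A y)"
    proof (cases "norm (z + y - x0) \<le> 7 / 8 * r")
      case True
      show ?thesis
      proof (cases "3 / 4 * r \<le> norm (z + y - x0)")
        case ann: True
        then have "m \<le> U (z + y)" using r True by (intro Um) auto
        moreover have "y \<in> O'" "y \<in> A" using True ann by (auto simp: inO inA)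
        ultimately show ?thesis using zw nb by (simp add: algebra_simps)
      next
        case False
        then have "y \<notin> O'" "y \<notin> A" by (auto simp: inO inA)
        then show ?thesis using zmin[OF True] by (simp add: algebra_simps)
      qed
    next
      case False
      then have "y \<in> O'" "y \<notin> A" using r by (auto simp: inO inA)
      then show ?thesis using zw nb U[of "z + y"] by (simp add: algebra_simps)
    qed
    then have "(U z - U (z + y)) * frac_kernel s y \<le> (- \<delta> * (barrier L (z - x0) - barrier L (z + y - x0)) + (w * indicator O' y - m * indicator A y)) * frac_kernel s y"
      by (intro mult_right_mono) auto
    then show ?thesis by (simp add: R_def algebra_simps)
  qed
  \<comment> \<open>The two directions y and - y together form the second difference.\<close>
  have "second_diff U z y * frac_kernel s y \<le> - \<delta> * (second_diff (\<lambda>x. barrier L (x - x0)) z y * frac_kernel s y) + (R y + R (- y))" for y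
    using add_mono[OF pt[of y] pt[of "- y"]] by (simp add: second_diff_def algebra_simps)
  then have "(\<integral>y. second_diff U z y * frac_kernel s y \<partial>lborel)
     \<le> (\<integral>y. - \<delta> * (second_diff (\<lambda>x. barrier L (x - x0)) z y * frac_kernel s y) + (R y + R (- y)) \<partial>lborel)"
    using Ui Bi Ri Rm by (intro integral_mono) auto
  also have "\<dots> = - \<delta> * (2 * frac_op s (\<lambda>x. barrier L x) (z - x0)) + 2 * (\<integral>y. R y \<partial>lborel)"
    using Bi Ri Rm by (simp add: Be)
  finally have 1: "frac_op s U z \<le> - \<delta> * frac_op s (\<lambda>x. barrier L x) (z - x0) + (\<integral>y. R y \<partial>lborel)"
    by (simp add: frac_op_def[of s U])
  have Oub: "(\<integral>y. indicator O' y * frac_kernel s y \<partial>lborel) \<le> (1 / 8 * r) powr (- 2 * s) * kernel_tail s TYPE('a)"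
  proof -
    have "(\<integral>y. indicator O' y * frac_kernel s y \<partial>lborel) \<le> (\<integral>y. indicator (- ball 0 (1 / 8 * r)) y * frac_kernel s (y::'a) \<partial>lborel)"
    proof (rule integral_mono[OF Oi])
      show "integrable lborel (\<lambda>y::'a. indicator (- ball 0 (1 / 8 * r)) y * frac_kernel s y)"
        by (rule integrable_kernel_outside[OF s, of _ "1 / 8 * r"]) (use r in auto)
      show "indicator O' y * frac_kernel s y \<le> indicator (- ball 0 (1 / 8 * r)) y * frac_kernel s y" for y
        using Od[of y] by (auto simp: indicator_def)
    qed
    also have "\<dots> = (1 / 8 * r) powr (- 2 * s) * kernel_tail s TYPE('a)"
      unfolding kernel_tail_def by (rule kernel_outside_ball_scale[OF s]) (use r in auto)
    finally show ?thesis .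
  qed
  have Alb: "r powr (- 2 * s) * annulus_const s TYPE('a) \<le> (\<integral>y. indicator A y * frac_kernel s y \<partial>lborel)"
  proof -
    have Af: "emeasure lborel A < \<infinity>"
      by (rule le_less_trans[OF emeasure_mono[of A "cball (x0 - z) (7 / 8 * r)"]]) (use r in \<open>auto simp: A_def emeasure_cball\<close>)
    have "measure lborel A = r ^ DIM('a) * measure lborel (cball (0::'a) (7 / 8) - ball 0 (3 / 4))"
      unfolding A_def by (rule measure_annulus[OF r])
    moreover have "r ^ DIM('a) * (2 * r) powr - (real DIM('a) + 2 * s) = r powr (- 2 * s) * 2 powr - (real DIM('a) + 2 * s)"
    proof -
      have "r ^ DIM('a) * r powr - (real DIM('a) + 2 * s) = r powr (- 2 * s)"
        using r by (simp add: powr_realpow[symmetric] powr_add[symmetric])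
      then show ?thesis using r by (simp add: powr_mult)
    qed
    ultimately have "r powr (- 2 * s) * annulus_const s TYPE('a) = measure lborel A * (2 * r) powr - (real DIM('a) + 2 * s)"
      by (simp add: annulus_const_def)
    also have "\<dots> = (\<integral>y. indicator A y * (2 * r) powr - (real DIM('a) + 2 * s) \<partial>lborel)"
      by simp
    also have "\<dots> \<le> (\<integral>y. indicator A y * frac_kernel s y \<partial>lborel)"
    proof (rule integral_mono[OF _ Ai])
      show "integrable lborel (\<lambda>y. indicator A y * (2 * r) powr - (real DIM('a) + 2 * s))"
        using Af by (intro integrable_mult_left integrable_real_indicator) auto
      fix y
      show "indicator A y * (2 * r) powr - (real DIM('a) + 2 * s) \<le> indicator A y * frac_kernel s y"
      proof (cases "y \<in> A")
        case True
        have "norm y \<le> norm (z + y - x0) + norm (z - x0)"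
          using norm_triangle_ineq4[of "z + y - x0" "z - x0"] by simp
        then have "norm y \<le> 2 * r" using True z by (simp add: inA)
        moreover have "y \<noteq> 0" using Od[of y] AO True r by auto
        ultimately show ?thesis using True kernel_ge[of y "2 * r" s] s by simp
      qed simp
    qed
    finally show ?thesis .
  qed
  have "(\<integral>y. R y \<partial>lborel) = w * (\<integral>y. indicator O' y * frac_kernel s y \<partial>lborel) - m * (\<integral>y. indicator A y * frac_kernel s y \<partial>lborel)"
    unfolding R_def using Oi Ai by simp
  also have "\<dots> \<le> w * ((1 / 8 * r) powr (- 2 * s) * kernel_tail s TYPE('a)) - m * (r powr (- 2 * s) * annulus_const s TYPE('a))"
    by (intro diff_mono mult_left_mono Oub Alb w m)
  finally show ?thesis using 1 by linarith
qed

text \<open>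
  The gradient of the barrier is of order \<open>T powr (- 1 / 2)\<close> and its fractional Laplacian of order
  \<open>T powr (- s)\<close>, with \<open>T = max |x|\<^sup>2 (1 / L)\<close>. For \<open>s > 1 / 2\<close> the latter wins as \<open>T\<close> tends to zero,
  with a constant that is uniform in \<open>L\<close>.
\<close>

lemma barrier_dominates_drift:
  assumes s: "0 < s" "s < 1" and n: "2 \<le> DIM('a::euclidean_space)" and k: "0 \<le> k" "k = 0 \<or> 1 / 2 < s"
  obtains C where "0 \<le> C"
    "\<And>L (x::'a). 1 \<le> L \<Longrightarrow> k * max ((norm x)\<^sup>2) (1 / L) powr (- 1 / 2) - frac_op s (\<lambda>x. barrier L x) x \<le> C"
proof -
  obtain c C where c: "0 < c"
    and C: "\<And>L (x::'a). 1 \<le> L \<Longrightarrow> c * max ((norm x)\<^sup>2) (1 / L) powr (- s) - C \<le> frac_op s (\<lambda>x. barrier L x) x"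
    using frac_op_barrier_ge[OF s n] by metis
  obtain K where K: "0 \<le> K" "\<And>T. 0 < T \<Longrightarrow> k * T powr (- 1 / 2) - c * T powr (- s) \<le> K"
  proof (cases "k = 0")
    case True
    then show ?thesis using c by (intro that[of 0]) auto
  next
    case False
    then have s2: "1 / 2 < s" and k0: "0 < k" using k by auto
    let ?q = "(k / c) powr (1 / (2 * s - 1))"
    show ?thesis
    proof (rule that[of "k * ?q"])
      fix T :: real assume T: "0 < T"
      define X where "X = T powr (- 1 / 2)"
      have X: "0 < X" using T by (simp add: X_def)
      \<comment> \<open>In terms of X the quantity is k X - c X powr (2 s), and 2 s > 1.\<close>
      have "T powr (- s) = X powr (2 * s)" by (simp add: X_def powr_powr)
      also have "\<dots> = X powr (2 * s - 1) * X"
        using X powr_add[of X "2 * s - 1" 1] by simp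
      finally have e: "k * T powr (- 1 / 2) - c * T powr (- s) = (k - c * X powr (2 * s - 1)) * X"
        by (simp add: X_def algebra_simps)
      show "k * T powr (- 1 / 2) - c * T powr (- s) \<le> k * ?q"
      proof (cases "X \<le> ?q")
        case True
        have "(k - c * X powr (2 * s - 1)) * X \<le> k * X"
          using c X by (intro mult_right_mono) auto
        also have "\<dots> \<le> k * ?q" using True k0 by (intro mult_left_mono) auto
        finally show ?thesis using e by simp
      next
        case False
        have "k / c = ?q powr (2 * s - 1)" using s2 k0 c by (simp add: powr_powr)
        also have "\<dots> \<le> X powr (2 * s - 1)" using False s2 by (intro powr_mono2) auto
        finally have "k \<le> c * X powr (2 * s - 1)" using c by (simp add: divide_le_eq mult.commute)
        then have "(k - c * X powr (2 * s - 1)) * X \<le> 0" using X by (intro mult_nonpos_nonneg) auto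
        also have "0 \<le> k * ?q" using k0 by simp
        finally show ?thesis using e by simp
      qed
    qed (use k0 in simp)
  qed
  show ?thesis
  proof (rule that[of "K + \<bar>C\<bar>"])
    fix L and x :: 'a assume L: "(1::real) \<le> L"
    have "0 < max ((norm x)\<^sup>2) (1 / L)" by (rule less_le_trans[of 0 "1/L"]) (use L in auto)
    from K(2)[OF this] C[OF L, of x]
    show "k * max ((norm x)\<^sup>2) (1 / L) powr (- 1 / 2) - frac_op s (\<lambda>x. barrier L x) x \<le> K + \<bar>C\<bar>"
      by linarith
  qed (use K in simp)
qed

text \<open>
  A bound for the directional derivative of the barrier through difference quotients: both Lipschitz
  estimates are used, the one with constant \<open>L\<close> near the origin and the one with constant
  \<open>1 / |x|\<^sup>2\<close> further out.
\<close>

lemma barrier_difference_quotient: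
  fixes x v :: "'a::euclidean_space"
  assumes L: "1 \<le> L" and v: "norm v \<le> b"
  obtains g where "g \<longlonglongrightarrow> 2 * b * max ((norm x)\<^sup>2) (1 / L) powr (- 1 / 2)"
    "\<forall>\<^sub>F k in sequentially. real k * \<bar>barrier L (x + (1 / real k) *\<^sub>R v) - barrier L x\<bar> \<le> g k"
proof -
  have b0: "0 \<le> b" using v norm_ge_zero[of v] by linarith
  define h where "h k = (1 / real k) *\<^sub>R v" for k
  have hn: "norm (h k) \<le> b / real k" for k using v by (simp add: h_def divide_right_mono)
  have inv0: "(\<lambda>k. b / real k) \<longlonglongrightarrow> 0" by (rule lim_const_over_n)
  have sq: "\<bar>(norm (x + h k))\<^sup>2 - (norm x)\<^sup>2\<bar> \<le> b / real k * (2 * norm x + b / real k)" for k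
  proof -
    have "(norm (x + h k))\<^sup>2 - (norm x)\<^sup>2 = (norm (x + h k) - norm x) * (norm (x + h k) + norm x)"
      by (simp add: power2_eq_square algebra_simps)
    then have "\<bar>(norm (x + h k))\<^sup>2 - (norm x)\<^sup>2\<bar> = \<bar>norm (x + h k) - norm x\<bar> * (norm (x + h k) + norm x)"
      by (simp only: abs_mult) simp
    moreover have "\<bar>norm (x + h k) - norm x\<bar> \<le> b / real k"
      using norm_triangle_ineq3[of "x + h k" x] hn[of k] by simp
    moreover have "norm (x + h k) + norm x \<le> 2 * norm x + b / real k"
      using norm_triangle_ineq[of x "h k"] hn[of k] by simp
    ultimately show ?thesis using b0 by (simp only:) (intro mult_mono; simp)
  qed
  show ?thesis
  proof (cases "(norm x)\<^sup>2 \<le> 1 / L")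
    case True
    define g where "g k = L * (b * (2 * norm x + b / real k))" for k
    have "real k * \<bar>barrier L (x + h k) - barrier L x\<bar> \<le> g k" if "0 < k" for k
    proof -
      have "\<bar>barrier L (x + h k) - barrier L x\<bar> \<le> L * \<bar>(norm (x + h k))\<^sup>2 - (norm x)\<^sup>2\<bar>"
        by (rule barrier_profile_lipschitz[OF L]) auto
      also have "\<dots> \<le> L * (b / real k * (2 * norm x + b / real k))"
        using L by (intro mult_left_mono sq) auto
      finally have "real k * \<bar>barrier L (x + h k) - barrier L x\<bar> \<le> real k * (L * (b / real k * (2 * norm x + b / real k)))"
        by (intro mult_left_mono) auto
      also have "\<dots> = g k" using that by (simp add: g_def)
      finally show ?thesis .
    qed
    then have ev: "\<forall>\<^sub>F k in sequentially. real k * \<bar>barrier L (x + h k) - barrier L x\<bar> \<le> g k"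
      by (intro eventually_sequentiallyI[of 1]) auto
    let ?l = "2 * b * max ((norm x)\<^sup>2) (1 / L) powr (- 1 / 2)"
    have glim: "g \<longlonglongrightarrow> L * (b * (2 * norm x + 0))"
      unfolding g_def by (intro tendsto_intros inv0)
    have m: "max ((norm x)\<^sup>2) (1 / L) = 1 / L" using True by simp
    have "L * norm x \<le> (1 / L) powr (- 1 / 2)"
    proof -
      have "norm x \<le> sqrt (1 / L)" using True by (rule real_le_rsqrt)
      then have "norm x \<le> 1 / sqrt L" by (simp add: real_sqrt_divide)
      then have "L * norm x \<le> L * (1 / sqrt L)" using L by (intro mult_left_mono) auto
      also have "L * (1 / sqrt L) = sqrt L" using L by (simp add: real_div_sqrt)
      also have "\<dots> = (1 / L) powr (- 1 / 2)" using L by (simp add: powr_half_sqrt[symmetric] powr_divide powr_minus field_simps)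
      finally show ?thesis .
    qed
    then have "2 * b * (L * norm x) \<le> ?l"
      unfolding m using b0 by (intro mult_left_mono) auto
    moreover have "L * (b * (2 * norm x + 0)) = 2 * b * (L * norm x)" by simp
    ultimately have le: "L * (b * (2 * norm x + 0)) \<le> ?l" by linarith
    \<comment> \<open>The bound is raised by a constant so that its limit is exactly the claimed value.\<close>
    have "(\<lambda>k. g k + (?l - L * (b * (2 * norm x + 0)))) \<longlonglongrightarrow> L * (b * (2 * norm x + 0)) + (?l - L * (b * (2 * norm x + 0)))"
      by (intro tendsto_intros glim)
    then have "(\<lambda>k. g k + (?l - L * (b * (2 * norm x + 0)))) \<longlonglongrightarrow> ?l" by simp
    moreover have "\<forall>\<^sub>F k in sequentially. real k * \<bar>barrier L (x + h k) - barrier L x\<bar> \<le> g k + (?l - L * (b * (2 * norm x + 0)))"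
      using ev by eventually_elim (use le in linarith)
    ultimately show ?thesis unfolding h_def by (rule that)
  next
    case False
    have "0 < 1 / L" using L by simp
    then have "0 < (norm x)\<^sup>2" using False by linarith
    then have nx: "0 < norm x" by simp
    define g where "g k = 1 / (norm x - b / real k)\<^sup>2 * (b * (2 * norm x + b / real k))" for k
    have "\<forall>\<^sub>F k in sequentially. b / real k < norm x"
      using order_tendstoD(2)[OF inv0 nx] .
    then have ev: "\<forall>\<^sub>F k in sequentially. real k * \<bar>barrier L (x + h k) - barrier L x\<bar> \<le> g k"
      using eventually_gt_at_top[of 0]
    proof eventually_elim
      fix k :: nat assume k: "b / real k < norm x" "0 < k"
      define d where "d = (norm x - b / real k)\<^sup>2"
      have d: "0 < d" using k by (simp add: d_def)
      have d1: "d \<le> (norm x)\<^sup>2" unfolding d_def using k b0 by (intro power_mono) auto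
      have "norm x - b / real k \<le> norm (x + h k)"
        using norm_triangle_ineq2[of x "- h k"] hn[of k] by simp
      then have d2: "d \<le> (norm (x + h k))\<^sup>2" unfolding d_def using k by (intro power_mono) auto
      have "\<bar>barrier L (x + h k) - barrier L x\<bar> \<le> (1 / d) * \<bar>(norm (x + h k))\<^sup>2 - (norm x)\<^sup>2\<bar>"
        by (rule barrier_profile_lipschitz'[OF L d d1 d2])
      also have "\<dots> \<le> (1 / d) * (b / real k * (2 * norm x + b / real k))"
        using d by (intro mult_left_mono sq) auto
      finally have "real k * \<bar>barrier L (x + h k) - barrier L x\<bar> \<le> real k * ((1 / d) * (b / real k * (2 * norm x + b / real k)))"
        by (intro mult_left_mono) auto
      also have "\<dots> = g k" using k by (simp add: g_def d_def)
      finally show "real k * \<bar>barrier L (x + h k) - barrier L x\<bar> \<le> g k" .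
    qed
    have "g \<longlonglongrightarrow> 1 / (norm x - 0)\<^sup>2 * (b * (2 * norm x + 0))"
      unfolding g_def using nx by (intro tendsto_intros inv0) auto
    also have "1 / (norm x - 0)\<^sup>2 * (b * (2 * norm x + 0)) = 2 * b * max ((norm x)\<^sup>2) (1 / L) powr (- 1 / 2)"
    proof -
      have m: "max ((norm x)\<^sup>2) (1 / L) = norm x powr 2" using False nx by simp
      have "max ((norm x)\<^sup>2) (1 / L) powr (- 1 / 2) = norm x powr (2 * (- 1 / 2))"
        unfolding m by (rule powr_powr)
      also have "\<dots> = 1 / norm x" using nx by (simp add: powr_neg_one)
      finally have "max ((norm x)\<^sup>2) (1 / L) powr (- 1 / 2) = 1 / norm x" .
      then show ?thesis using nx by (simp add: power2_eq_square)
    qed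
    finally show ?thesis using ev unfolding h_def by (rule that)
  qed
qed

text \<open>
  If \<open>W\<close>, the sum of \<open>U\<close> and \<open>\<delta>\<close> times the barrier, were below \<open>w\<close> somewhere, it would have a minimum
  below \<open>w\<close>. That point is not in the annulus, where \<open>U \<ge> m \<ge> w\<close>, and not within \<open>\<rho>\<close> of \<open>x0\<close>, where
  the barrier is large; so the inequality for \<open>U\<close> holds at it. There the gradient of \<open>U\<close> is that of
  \<open>- \<delta>\<close> times the barrier, and the gain from the annulus exceeds all other terms. The gradient
  appears as a limit of difference quotients, since only the derivative of \<open>U\<close> along the drift enters
  the equation.
\<close>

lemma nonlocal_minimum_principle:
  fixes U :: "'a::euclidean_space \<Rightarrow> real"
  assumes s: "0 < s" "s < 1" and r: "0 < r" "r \<le> 1" and L: "1 \<le> L" and \<delta>: "0 \<le> \<delta>"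
    and w: "0 \<le> w" "w \<le> m" and \<theta>0: "0 < \<theta>0" and M2: "0 \<le> M2" and b: "0 \<le> b" and C2: "0 \<le> C2"
    and Uc: "continuous_on UNIV U" and U: "\<And>y. 0 \<le> U y"
    and Um: "\<And>y. 5 / 8 * r \<le> norm (y - x0) \<Longrightarrow> norm (y - x0) \<le> 7 / 8 * r \<Longrightarrow> m \<le> U y"
    and Ui: "\<And>z. integrable lborel (\<lambda>y. second_diff U z y * frac_kernel s y)"
    and drift: "\<And>x::'a. 2 * b / \<theta>0 * max ((norm x)\<^sup>2) (1 / L) powr (- 1 / 2) - frac_op s (\<lambda>x. barrier L x) x \<le> C2"
    and near: "\<And>y. norm (y - x0) \<le> \<rho> \<Longrightarrow> w \<le> \<delta> * barrier L (y - x0)"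
    and eq: "\<And>z. \<rho> < norm (z - x0) \<Longrightarrow> norm (z - x0) < 5 / 8 * r \<Longrightarrow>
      \<exists>\<theta> D v. \<theta>0 \<le> \<theta> \<and> norm v \<le> b \<and> (\<lambda>k. real k * (U (z + (1 / real k) *\<^sub>R v) - U z)) \<longlonglongrightarrow> - D
        \<and> 0 \<le> \<theta> * frac_op s U z + D + M2 * U z"
    and small: "\<delta> * C2 + w * (8 powr (2 * s) * kernel_tail s TYPE('a) + M2 / \<theta>0) < m * annulus_const s TYPE('a)"
    and z: "norm (z - x0) \<le> 7 / 8 * r"
  shows "w \<le> U z + \<delta> * barrier L (z - x0)"
proof (rule ccontr)
  assume "\<not> ?thesis"
  then have neg: "U z + \<delta> * barrier L (z - x0) < w" by simp
  define W where "W y = U y + \<delta> * barrier L (y - x0)" for y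
  have bc: "continuous_on UNIV (\<lambda>y. barrier L (y - x0))"
    by (rule continuous_on_compose2[OF barrier_continuous[OF L]]) (auto intro!: continuous_intros)
  have Wc: "continuous_on (cball x0 (7 / 8 * r)) W"
    unfolding W_def by (rule continuous_on_subset[of UNIV]) (auto intro!: continuous_intros Uc bc)
  have "cball x0 (7 / 8 * r) \<noteq> {}" using r by simp
  then obtain p where p: "p \<in> cball x0 (7 / 8 * r)" "\<And>y. y \<in> cball x0 (7 / 8 * r) \<Longrightarrow> W p \<le> W y"
    using continuous_attains_inf[OF compact_cball _ Wc] by blast
  have mem: "y \<in> cball x0 R \<longleftrightarrow> norm (y - x0) \<le> R" for y R
    by (simp add: dist_norm norm_minus_commute)
  have "z \<in> cball x0 (7 / 8 * r)" unfolding mem by (rule z)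
  from p(2)[OF this] have pz: "W p < w" using neg by (simp add: W_def)
  have bn: "0 \<le> \<delta> * barrier L (y - x0)" for y using \<delta> barrier_profile_nonneg by (intro mult_nonneg_nonneg) auto
  have p1: "norm (p - x0) < 5 / 8 * r"
  proof (rule ccontr)
    assume "\<not> ?thesis"
    then have "m \<le> U p" using p(1)[unfolded mem] by (intro Um) auto
    then show False using pz bn[of p] w by (simp add: W_def)
  qed
  have p2: "\<rho> < norm (p - x0)"
  proof (rule ccontr)
    assume "\<not> ?thesis"
    then show False using near[of p] pz U[of p] by (simp add: W_def)
  qed
  obtain \<theta> D v where \<theta>: "\<theta>0 \<le> \<theta>" and v: "norm v \<le> b"
    and lim: "(\<lambda>k. real k * (U (p + (1 / real k) *\<^sub>R v) - U p)) \<longlonglongrightarrow> - D"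
    and ineq: "0 \<le> \<theta> * frac_op s U p + D + M2 * U p"
    using eq[OF p2 p1] by blast
  define T where "T = max ((norm (p - x0))\<^sup>2) (1 / L)"
  let ?S = "frac_op s (\<lambda>x. barrier L x) (p - x0)"
  obtain g where g: "g \<longlonglongrightarrow> 2 * b * T powr (- 1 / 2)"
    "\<forall>\<^sub>F k in sequentially. real k * \<bar>barrier L (p - x0 + (1 / real k) *\<^sub>R v) - barrier L (p - x0)\<bar> \<le> g k"
    unfolding T_def using barrier_difference_quotient[OF L v] by blast
  have h0: "(\<lambda>k. norm ((1 / real k) *\<^sub>R v)) \<longlonglongrightarrow> 0"
  proof -
    have "(\<lambda>k. norm v / real k) \<longlonglongrightarrow> 0" by (rule lim_const_over_n)
    then show ?thesis by (simp add: divide_inverse mult.commute)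
  qed
  have "\<forall>\<^sub>F k in sequentially. norm ((1 / real k) *\<^sub>R v) < 1 / 8 * r"
    using order_tendstoD(2)[OF h0, of "1 / 8 * r"] r by simp
  then have ev: "\<forall>\<^sub>F k in sequentially. - (\<delta> * g k) \<le> real k * (U (p + (1 / real k) *\<^sub>R v) - U p)"
    using g(2)
  proof eventually_elim
    fix k assume k: "norm ((1 / real k) *\<^sub>R v) < 1 / 8 * r"
      "real k * \<bar>barrier L (p - x0 + (1 / real k) *\<^sub>R v) - barrier L (p - x0)\<bar> \<le> g k"
    let ?q = "p + (1 / real k) *\<^sub>R v"
    have q: "?q - x0 = p - x0 + (1 / real k) *\<^sub>R v" by simp
    have "norm (?q - x0) \<le> norm (p - x0) + norm ((1 / real k) *\<^sub>R v)"
      unfolding q by (rule norm_triangle_ineq)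
    then have "?q \<in> cball x0 (7 / 8 * r)" using k(1) p1 r unfolding mem by linarith
    then have "W p \<le> W ?q" by (rule p(2))
    then have "- (\<delta> * \<bar>barrier L (?q - x0) - barrier L (p - x0)\<bar>) \<le> U ?q - U p"
      using mult_left_mono[OF abs_ge_self[of "barrier L (?q - x0) - barrier L (p - x0)"] \<delta>]
      by (simp add: W_def right_diff_distrib)
    then have "real k * (- (\<delta> * \<bar>barrier L (?q - x0) - barrier L (p - x0)\<bar>)) \<le> real k * (U ?q - U p)"
      by (intro mult_left_mono) auto
    moreover have "\<delta> * (real k * \<bar>barrier L (?q - x0) - barrier L (p - x0)\<bar>) \<le> \<delta> * g k"
      using k(2) \<delta> unfolding q by (intro mult_left_mono) auto
    ultimately show "- (\<delta> * g k) \<le> real k * (U ?q - U p)" by (simp add: mult.left_commute)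
  qed
  \<comment> \<open>Minimality turns the difference quotients of U into a lower bound, hence D into an upper bound.\<close>
  have "(\<lambda>k. - (\<delta> * g k)) \<longlonglongrightarrow> - (\<delta> * (2 * b * T powr (- 1 / 2)))"
    by (intro tendsto_intros g)
  from tendsto_le[OF _ lim this ev] have D: "D \<le> \<delta> * (2 * b * T powr (- 1 / 2))" by simp
  have frac: "frac_op s U p \<le> - \<delta> * ?S + w * ((1 / 8 * r) powr (- 2 * s) * kernel_tail s TYPE('a)) - m * (r powr (- 2 * s) * annulus_const s TYPE('a))"
  proof (rule frac_op_at_minimum[OF s r(1) L \<delta> w(1) _ U Um p1 _ _ Ui])
    show "0 \<le> m" using w by linarith
    show "U p + \<delta> * barrier L (p - x0) \<le> w" using pz by (simp add: W_def)
    show "U p + \<delta> * barrier L (p - x0) \<le> U y + \<delta> * barrier L (y - x0)" if "norm (y - x0) \<le> 7 / 8 * r" for y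
    proof -
      have "y \<in> cball x0 (7 / 8 * r)" unfolding mem by (rule that)
      from p(2)[OF this] show ?thesis by (simp add: W_def)
    qed
  qed
  have Up: "U p \<le> w" using pz bn[of p] by (simp add: W_def)
  let ?E = "\<delta> * (2 * b * T powr (- 1 / 2)) + M2 * w"
  have E0: "0 \<le> ?E" using \<delta> b M2 w by (intro add_nonneg_nonneg mult_nonneg_nonneg) auto
  have th: "0 < \<theta>" using \<theta> \<theta>0 by linarith
  have "0 \<le> \<theta> * frac_op s U p + ?E"
    using ineq D mult_left_mono[OF Up M2] by linarith
  then have "0 \<le> frac_op s U p + ?E / \<theta>" using th by (simp add: field_simps)
  also have "?E / \<theta> \<le> ?E / \<theta>0" using E0 \<theta> \<theta>0 th by (intro divide_left_mono) auto
  finally have 1: "0 \<le> frac_op s U p + ?E / \<theta>0" by simp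
  have e1: "?E / \<theta>0 = \<delta> * (2 * b / \<theta>0 * T powr (- 1 / 2)) + w * (M2 / \<theta>0)"
    by (simp add: add_divide_distrib)
  have "\<delta> * (2 * b / \<theta>0 * T powr (- 1 / 2) - ?S) \<le> \<delta> * C2"
    unfolding T_def by (intro mult_left_mono drift \<delta>)
  then have 2: "\<delta> * (2 * b / \<theta>0 * T powr (- 1 / 2)) - \<delta> * ?S \<le> \<delta> * C2" by (simp only: right_diff_distrib)
  \<comment> \<open>Since r \<le> 1 this factor is at least 1, so terms without it can be multiplied by it.\<close>
  define q where "q = r powr (- 2 * s)"
  have q: "1 \<le> q"
  proof -
    have "1 powr (- 2 * s) \<le> r powr (- 2 * s)" using r s by (intro powr_mono2') auto
    then show ?thesis by (simp add: q_def)
  qed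
  have q8: "(1 / 8 * r) powr (- 2 * s) = 8 powr (2 * s) * q"
  proof -
    have "(1 / 8 * r) powr (- 2 * s) = (1 / 8) powr (- 2 * s) * q" unfolding q_def using r by (intro powr_mult) 
    also have "(1 / 8 :: real) powr (- 2 * s) = 8 powr (2 * s)" by (simp add: powr_divide powr_minus)
    finally show ?thesis .
  qed
  let ?k = "8 powr (2 * s) * kernel_tail s TYPE('a)"
  have "m * (q * annulus_const s TYPE('a)) \<le> \<delta> * C2 + w * (M2 / \<theta>0) + w * (8 powr (2 * s) * q * kernel_tail s TYPE('a))"
    using 1 2 frac unfolding e1 q8 q_def[symmetric] by linarith
  also have "\<dots> \<le> q * (\<delta> * C2 + w * (M2 / \<theta>0)) + w * (8 powr (2 * s) * q * kernel_tail s TYPE('a))"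
  proof -
    have "0 \<le> \<delta> * C2 + w * (M2 / \<theta>0)" using \<delta> C2 w M2 \<theta>0 by (intro add_nonneg_nonneg mult_nonneg_nonneg) auto
    from mult_right_mono[OF q this] show ?thesis by simp
  qed
  also have "\<dots> = q * (\<delta> * C2 + w * (?k + M2 / \<theta>0))" by (simp add: algebra_simps)
  also have "\<dots> < q * (m * annulus_const s TYPE('a))"
    using small q by (intro mult_strict_left_mono) auto
  finally show False by (simp add: mult.left_commute)
qed

section \<open>Gradients of bumps and of mollifications\<close>

definition bump_gradient :: "real \<Rightarrow> 'a::euclidean_space \<Rightarrow> 'a \<Rightarrow> 'a" where
  "bump_gradient e z x = (- (2 / e\<^sup>2) * bump_profile 2 (1 - (norm (x - z))\<^sup>2 / e\<^sup>2)) *\<^sub>R (x - z)"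

lemma bump_has_gradient: "(bump e z has_derivative (\<lambda>v. bump_gradient e z x \<bullet> v)) (at x)"
  using bump_derivative[of e z x] by (simp add: bump_gradient_def ac_simps)

lemma bump_gradient_measurable [measurable]: "bump_gradient e z \<in> borel_measurable borel"
  unfolding bump_gradient_def[abs_def] by measurable

lemma bump_gradient_outside: "0 < e \<Longrightarrow> e \<le> norm (x - z) \<Longrightarrow> bump_gradient e z x = 0"
proof -
  assume "0 < e" "e \<le> norm (x - z)"
  then have "1 - (norm (x - z))\<^sup>2 / e\<^sup>2 \<le> 0" by (auto intro!: power_mono)
  then show ?thesis by (simp add: bump_gradient_def)
qed

lemma norm_bump_gradient:
  "norm (bump_gradient e z x) = 2 / e\<^sup>2 * bump_profile 2 (1 - (norm (x - z))\<^sup>2 / e\<^sup>2) * norm (x - z)"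
  by (simp add: bump_gradient_def abs_mult)

lemma norm_bump_gradient_le:
  fixes x z :: "'a::euclidean_space"
  assumes "0 < e" shows "norm (bump_gradient e z x) \<le> 54 / e"
proof (cases "norm (x - z) < e")
  case True
  have "bump_profile 2 (1 - (norm (x - z))\<^sup>2 / e\<^sup>2) \<le> 27"
    using bump_profile_bound[of 2] by (simp add: power3_eq_cube numeral_eq_Suc)
  then have "2 / e\<^sup>2 * bump_profile 2 (1 - (norm (x - z))\<^sup>2 / e\<^sup>2) * norm (x - z) \<le> 2 / e\<^sup>2 * 27 * e"
    using True assms by (intro mult_mono) auto
  also have "\<dots> = 54 / e" using assms by (simp add: power2_eq_square)
  finally show ?thesis by (simp add: norm_bump_gradient)
next
  case False
  then show ?thesis using bump_gradient_outside[OF assms, of x z] assms by simp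
qed

lemma bump_lipschitz:
  fixes x y z :: "'a::euclidean_space"
  assumes "0 < e" shows "\<bar>bump e z x - bump e z y\<bar> \<le> 54 / e * norm (x - y)"
proof -
  have "norm (bump e z x - bump e z y) \<le> 54 / e * norm (x - y)"
  proof (rule differentiable_bound[of UNIV])
    show "(bump e z has_derivative (\<lambda>v. bump_gradient e z x \<bullet> v)) (at x within UNIV)" for x
      by (rule bump_has_gradient)
    show "onorm (\<lambda>v. bump_gradient e z x \<bullet> v) \<le> 54 / e" for x
    proof (rule onorm_le)
      fix v
      have "norm (bump_gradient e z x \<bullet> v) \<le> norm (bump_gradient e z x) * norm v"
        using Cauchy_Schwarz_ineq2 by simp
      also have "\<dots> \<le> 54 / e * norm v" by (intro mult_right_mono norm_bump_gradient_le assms) auto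
      finally show "norm (bump_gradient e z x \<bullet> v) \<le> 54 / e * norm v" .
    qed
  qed auto
  then show ?thesis by simp
qed

lemma bump_gradient_le_indicator:
  assumes "0 < e" "norm z + e \<le> R"
  shows "\<bar>bump_gradient e z x \<bullet> v\<bar> \<le> (54 / e * norm v) * indicator (cball 0 R) x"
proof (cases "x \<in> cball 0 R")
  case True
  have "\<bar>bump_gradient e z x \<bullet> v\<bar> \<le> norm (bump_gradient e z x) * norm v" by (rule Cauchy_Schwarz_ineq2)
  also have "\<dots> \<le> 54 / e * norm v" by (intro mult_right_mono norm_bump_gradient_le assms) auto
  finally show ?thesis using True by simp
next
  case False
  then have "norm x > norm z + e" using assms by simp
  then have "e \<le> norm (x - z)" using norm_triangle_ineq2[of x z] by linarith
  then have "bump_gradient e z x = 0" by (rule bump_gradient_outside[OF assms(1)])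
  then show ?thesis using False by simp
qed

text \<open>
  Up to the Lipschitz constant of the drift \<open>b\<close>, this bounds the error made in the first order term
  when \<open>b x\<close> is replaced by \<open>b z\<close> under the integral.
\<close>

definition bump_commutator :: "real \<Rightarrow> 'a::euclidean_space \<Rightarrow> 'a \<Rightarrow> real" where
  "bump_commutator e z x = norm (x - z) * norm (bump_gradient e z x)"

lemma bump_commutator_measurable [measurable]: "bump_commutator e z \<in> borel_measurable borel"
  unfolding bump_commutator_def[abs_def] by measurable

lemma bump_commutator_le_indicator:
  assumes "0 < e" "norm z + e \<le> R"
  shows "\<bar>bump_commutator e z x\<bar> \<le> 54 * indicator (cball 0 R) x"
proof (cases "norm (x - z) < e")
  case True
  have "norm x \<le> norm (x - z) + norm z" using norm_triangle_ineq[of "x - z" z] by simp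
  then have "x \<in> cball 0 R" using True assms by simp
  moreover have "bump_commutator e z x \<le> e * (54 / e)"
    unfolding bump_commutator_def using True assms by (intro mult_mono norm_bump_gradient_le) auto
  moreover have "0 \<le> bump_commutator e z x" by (simp add: bump_commutator_def)
  ultimately show ?thesis using assms by simp
next
  case False
  then have "bump_gradient e z x = 0" using assms by (intro bump_gradient_outside) auto
  then show ?thesis by (simp add: bump_commutator_def)
qed

text \<open>
  The scaled form of the estimate for the unit bump. The factor \<open>e powr (2 * s)\<close> in front of the
  operator makes its contribution a small fraction of the fractional Laplacian.
\<close>

lemma bump_commutator_absorbed:
  assumes s: "0 < s" "s < 1"
  obtains A where "0 \<le> A"
    "\<And>e z (x::'a::euclidean_space). 0 < e \<Longrightarrow> bump_commutator e z x \<le> A * bump e z x - e powr (2 * s) * frac_op s (bump e z) x"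
proof -
  obtain A where A: "0 \<le> A"
    "\<And>x::'a. 2 * (norm x)\<^sup>2 * bump_profile 2 (1 - (norm x)\<^sup>2) + frac_op s (bump 1 0) x \<le> A * bump 1 0 x"
    using bump_absorbs_gradient[OF s] by metis
  show ?thesis
  proof (rule that[OF A(1)])
    fix e :: real and z x :: 'a assume e: "0 < e"
    define \<xi> where "\<xi> = (1 / e) *\<^sub>R (x - z)"
    have n: "(norm \<xi>)\<^sup>2 = (norm (x - z))\<^sup>2 / e\<^sup>2" using e by (simp add: \<xi>_def power_divide)
    have 1: "bump_commutator e z x = 2 * (norm \<xi>)\<^sup>2 * bump_profile 2 (1 - (norm \<xi>)\<^sup>2)"
      unfolding bump_commutator_def norm_bump_gradient n by (simp add: power2_eq_square)
    have 2: "bump 1 0 \<xi> = bump e z x" unfolding \<xi>_def by (rule bump_scale[OF e, symmetric])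
    have "e powr (2 * s) * (e powr (- 2 * s) * frac_op s (bump 1 0) \<xi>) = frac_op s (bump 1 0) \<xi>"
      using e by (simp add: powr_minus)
    then have 3: "e powr (2 * s) * frac_op s (bump e z) x = frac_op s (bump 1 0) \<xi>"
      by (simp only: frac_op_bump_scale[OF e s(1)] \<xi>_def[symmetric])
    show "bump_commutator e z x \<le> A * bump e z x - e powr (2 * s) * frac_op s (bump e z) x"
      using A(2)[of \<xi>] unfolding 1 2 3 by linarith
  qed
qed

context weighted_nonneg
begin

text \<open>
  Translating the centre of the bump is translating its argument the opposite way, hence the sign.
\<close>

lemma mollify_directional_derivative:
  assumes e: "0 < e"
  shows "(\<lambda>k. real k * (mollify e u (z + (1 / real k) *\<^sub>R v) - mollify e u z))
    \<longlonglongrightarrow> - (\<integral>x. u x * (bump_gradient e z x \<bullet> v) \<partial>lborel)"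
proof -
  let ?R = "norm z + norm v + e"
  let ?f = "\<lambda>k x. real k * (bump e (z + (1 / real k) *\<^sub>R v) x - bump e z x)"
  have eq: "real k * (mollify e u (z + (1 / real k) *\<^sub>R v) - mollify e u z) = (\<integral>x. u x * ?f k x \<partial>lborel)" for k
  proof -
    have "(\<integral>x. u x * ?f k x \<partial>lborel) = (\<integral>x. real k * (u x * bump e (z + (1 / real k) *\<^sub>R v) x - u x * bump e z x) \<partial>lborel)"
      by (intro Bochner_Integration.integral_cong) (auto simp: algebra_simps)
    then show ?thesis unfolding mollify_def using integrable_u_bump[OF e] by simp
  qed
  have "(\<lambda>k. \<integral>x. u x * ?f k x \<partial>lborel) \<longlonglongrightarrow> (\<integral>x. u x * - (bump_gradient e z x \<bullet> v) \<partial>lborel)"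
  proof (rule integral_dominated_convergence[where w = "\<lambda>x. u x * ((54 / e * norm v) * indicator (cball 0 ?R) x)"])
    show "integrable lborel (\<lambda>x. u x * ((54 / e * norm v) * indicator (cball 0 ?R) x))"
      by (rule integrable_u_mult[where K = "54 / e * norm v" and R = ?R], measurable) (use e in \<open>auto simp: indicator_def\<close>)
    show "AE x in lborel. (\<lambda>k. u x * ?f k x) \<longlonglongrightarrow> u x * - (bump_gradient e z x \<bullet> v)"
    proof (rule AE_I2)
      fix x
      define h where "h t = bump e z (x - t *\<^sub>R v)" for t
      have "(h has_derivative (\<lambda>t. bump_gradient e z (x - 0 *\<^sub>R v) \<bullet> (- (t *\<^sub>R v)))) (at 0)"
        unfolding h_def by (rule has_derivative_compose[OF _ bump_has_gradient]) (auto intro!: derivative_eq_intros)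
      then have "(h has_real_derivative - (bump_gradient e z x \<bullet> v)) (at 0)"
        by (rule has_derivative_imp_has_field_derivative) simp
      then have "((\<lambda>t. (h t - h 0) / (t - 0)) \<longlongrightarrow> - (bump_gradient e z x \<bullet> v)) (at 0)"
        unfolding has_field_derivative_iff .
      moreover have "filterlim (\<lambda>k. 1 / real (Suc k)) (at 0) sequentially"
      proof -
        have "(\<lambda>k. 1 / real (Suc k)) \<longlonglongrightarrow> 0" by (rule LIMSEQ_Suc[OF lim_const_over_n])
        then show ?thesis by (auto simp: filterlim_at intro!: always_eventually)
      qed
      ultimately have "(\<lambda>k. (h (1 / real (Suc k)) - h 0) / (1 / real (Suc k) - 0)) \<longlonglongrightarrow> - (bump_gradient e z x \<bullet> v)"
        by (rule filterlim_compose)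
      then have "(\<lambda>k. ?f (Suc k) x) \<longlonglongrightarrow> - (bump_gradient e z x \<bullet> v)"
        by (simp add: h_def bump_translate(2) mult.commute)
      then have "(\<lambda>k. ?f k x) \<longlonglongrightarrow> - (bump_gradient e z x \<bullet> v)"
        by (rule LIMSEQ_imp_Suc)
      then show "(\<lambda>k. u x * ?f k x) \<longlonglongrightarrow> u x * - (bump_gradient e z x \<bullet> v)"
        by (intro tendsto_intros)
    qed
    show "AE x in lborel. norm (u x * ?f k x) \<le> u x * ((54 / e * norm v) * indicator (cball 0 ?R) x)" for k
    proof (rule AE_I2)
      fix x
      have "\<bar>?f k x\<bar> \<le> (54 / e * norm v) * indicator (cball 0 ?R) x"
      \<comment> \<open>For k = 0 the quotient is zero, as 1 / 0 = 0.\<close>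
      proof (cases "k = 0")
        case True
        then show ?thesis using e by simp
      next
        case False
        let ?h = "(1 / real k) *\<^sub>R v"
        have hk: "norm ?h \<le> norm v" using False by (simp add: divide_le_eq mult_le_cancel_left1)
        show ?thesis
        proof (cases "x \<in> cball 0 ?R")
          case True
          have "\<bar>bump e (z + ?h) x - bump e z x\<bar> \<le> 54 / e * norm (x - ?h - x)"
            unfolding bump_translate(2)[symmetric] by (rule bump_lipschitz[OF e])
          then have "real k * \<bar>bump e (z + ?h) x - bump e z x\<bar> \<le> real k * (54 / e * norm (x - ?h - x))"
            by (intro mult_left_mono) auto
          also have "\<dots> = 54 / e * norm v" using False by simp
          finally show ?thesis using True by (simp add: abs_mult)
        next
          case out: False
          have "norm (z + ?h) + e \<le> ?R" using norm_triangle_ineq[of z ?h] hk by linarith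
          then have "\<bar>bump e (z + ?h) x\<bar> \<le> 1 * indicator (cball 0 ?R) x"
            by (rule bump_le_indicator[OF e])
          moreover have "norm z + e \<le> ?R" by simp
          then have "\<bar>bump e z x\<bar> \<le> 1 * indicator (cball 0 ?R) x"
            by (rule bump_le_indicator[OF e])
          ultimately have "bump e (z + ?h) x \<le> 0" "bump e z x \<le> 0" using out by simp_all
          then have "bump e (z + ?h) x = 0" "bump e z x = 0" by (auto intro: antisym)
          then show ?thesis using out by simp
        qed
      qed
      then show "norm (u x * ?f k x) \<le> u x * ((54 / e * norm v) * indicator (cball 0 ?R) x)"
        using u_nonneg[of x] by (simp only: real_norm_def abs_mult[of "u x"] abs_of_nonneg) (rule mult_left_mono)
    qed
  qed measurable
  then show ?thesis by (simp only: eq) simp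
qed

end

section \<open>The distributional inequality tested with bumps\<close>

lemma divergence_bump_field:
  fixes b :: "'a::euclidean_space \<Rightarrow> 'a"
  assumes "b differentiable (at x)"
  shows "divergence (\<lambda>y. bump e z y *\<^sub>R b y) x
    = bump_gradient e z x \<bullet> b x + bump e z x * (\<Sum>i\<in>Basis. frechet_derivative b (at x) i \<bullet> i)"
proof -
  let ?b' = "frechet_derivative b (at x)"
  have "(b has_derivative ?b') (at x)" using assms by (simp add: frechet_derivative_works)
  from has_derivative_scaleR[OF bump_has_gradient this, of e z]
  have "((\<lambda>y. bump e z y *\<^sub>R b y) has_derivative (\<lambda>h. bump e z x *\<^sub>R ?b' h + (bump_gradient e z x \<bullet> h) *\<^sub>R b x)) (at x)" .
  then have "frechet_derivative (\<lambda>y. bump e z y *\<^sub>R b y) (at x) = (\<lambda>h. bump e z x *\<^sub>R ?b' h + (bump_gradient e z x \<bullet> h) *\<^sub>R b x)"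
    by (rule frechet_derivative_at[symmetric])
  then have "divergence (\<lambda>y. bump e z y *\<^sub>R b y) x
     = (\<Sum>i\<in>Basis. bump e z x * (?b' i \<bullet> i) + (bump_gradient e z x \<bullet> i) * (b x \<bullet> i))"
    by (simp add: divergence_def inner_add_left)
  also have "\<dots> = bump e z x * (\<Sum>i\<in>Basis. ?b' i \<bullet> i) + (\<Sum>i\<in>Basis. (bump_gradient e z x \<bullet> i) * (b x \<bullet> i))"
    by (simp add: sum.distrib sum_distrib_left)
  also have "(\<Sum>i\<in>Basis. (bump_gradient e z x \<bullet> i) * (b x \<bullet> i)) = bump_gradient e z x \<bullet> b x"
    by (rule euclidean_inner[symmetric])
  finally show ?thesis by simp
qed

definition bump_mass :: "'a::euclidean_space itself \<Rightarrow> real \<Rightarrow> real" where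
  "bump_mass _ e = (\<integral>x. bump e (0::'a) x \<partial>lborel)"

lemma integral_bump: "(\<integral>x. bump e (z::'a::euclidean_space) x \<partial>lborel) = bump_mass TYPE('a) e"
proof -
  have "(\<lambda>x. bump e z (z + 1 *\<^sub>R x)) = bump e 0" by (simp add: bump_def fun_eq_iff)
  then show ?thesis
    using integral_affine_euclidean[OF bump_measurable, of 1 e z z] by (simp add: bump_mass_def)
qed

lemma bump_mass_pos: "0 < e \<Longrightarrow> 0 < bump_mass TYPE('a::euclidean_space) e"
proof -
  assume e: "0 < e"
  have i: "integrable lborel (bump e (0::'a))" by (rule integrable_bump[OF e])
  have "bump_mass TYPE('a) e \<noteq> 0"
  proof
    assume "bump_mass TYPE('a) e = 0"
    then have "AE x::'a in lborel. bump e 0 x = 0"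
      using integral_nonneg_eq_0_iff_AE[OF i] unfolding bump_mass_def by auto
    then have "AE x::'a in lborel. x \<notin> ball 0 e"
    proof eventually_elim
      fix x :: 'a assume "bump e 0 x = 0"
      then show "x \<notin> ball 0 e" using bump_pos[OF e, of x 0] by auto
    qed
    then have "ball (0::'a) e \<in> null_sets lborel"
      by (subst (asm) AE_iff_null_sets[symmetric]) auto
    then show False using unit_ball_vol_pos[of "real DIM('a)"] e
      by (simp add: null_sets_def emeasure_ball)
  qed
  moreover have "0 \<le> bump_mass TYPE('a) e" unfolding bump_mass_def by (intro Bochner_Integration.integral_nonneg) auto
  ultimately show ?thesis by simp
qed

lemma bump_symmetric: "bump e z x = bump e x z"
  by (simp add: bump_def norm_minus_commute)

context weighted_nonneg
begin

text \<open>
  The distributional inequality with a bump as test function. The divergence is expanded, \<open>b\<close> is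
  frozen at the centre of the bump with an error controlled by the commutator, and the zero order
  terms are estimated by the bounds on \<open>c\<close> and on the divergence of \<open>b\<close>. The last two steps
  give upper bounds because \<open>u\<close> and the bump are nonnegative. The function \<open>u0\<close> is the given Lebesgue
  measurable one, and \<open>u\<close> its Borel version.
\<close>

lemma weak_inequality_at_bump:
  fixes b :: "'a \<Rightarrow> 'a" and c u0 :: "'a \<Rightarrow> real"
  assumes sup: "distr_supersolution s b c (ball x0 r - {x0}) u0"
    and u0m: "u0 \<in> borel_measurable lebesgue" and ae: "AE x in lebesgue. u0 x = u x"
    and bd: "\<And>x. x \<in> ball x0 r \<Longrightarrow> b differentiable (at x)"
    and bo: "\<And>x. x \<in> ball x0 r \<Longrightarrow> onorm (frechet_derivative b (at x)) \<le> B"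
    and bc: "\<And>i. i \<in> Basis \<Longrightarrow> continuous_on (ball x0 r) (\<lambda>x. frechet_derivative b (at x) i)"
    and B: "0 \<le> B"
    and cM: "\<And>x. x \<in> ball x0 r \<Longrightarrow> c x \<le> M"
    and cu: "locally_integrable_on (\<lambda>x. c x * u0 x) (ball x0 r - {x0})"
    and e: "0 < e" and ze: "cball z e \<subseteq> ball x0 r - {x0}"
  shows "0 \<le> frac_laplacian_const DIM('a) s * (\<integral>x. u x * frac_op s (bump e z) x \<partial>lborel)
      - (\<integral>x. u x * (bump_gradient e z x \<bullet> b z) \<partial>lborel)
      + B * (\<integral>x. u x * bump_commutator e z x \<partial>lborel)
      + (real DIM('a) * B + M) * (\<integral>x. u x * bump e z x \<partial>lborel)"
proof -
  let ?U = "ball x0 r - {x0}" and ?K = "cball z e" and ?R = "norm z + e"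
  let ?\<kappa> = "frac_laplacian_const DIM('a) s"
  let ?\<phi> = "bump e z" and ?g = "bump_gradient e z"
  define dv where "dv x = (\<Sum>i\<in>Basis. frechet_derivative b (at x) i \<bullet> i)" for x
  define F where "F x = indicator ?U x *\<^sub>R (u0 x * (- divergence (\<lambda>y. ?\<phi> y *\<^sub>R b y) x + c x * ?\<phi> x))" for x
  have zK: "z \<in> ?K" using e by simp
  have outside: "?\<phi> x = 0" "?g x = 0" "bump_commutator e z x = 0" if "x \<notin> ?K" for x
  proof -
    have "e \<le> norm (x - z)" using that by (simp add: dist_norm norm_minus_commute)
    then show "?\<phi> x = 0" "?g x = 0" "bump_commutator e z x = 0"
      using bump_outside[OF e] bump_gradient_outside[OF e] by (auto simp: bump_commutator_def)
  qed
  obtain B' where B': "\<And>(z::'a) x y. \<bar>second_diff (bump e z) x y\<bar> \<le> B' * min 1 ((norm y)\<^sup>2)"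
    using second_diff_bump[OF e] by metis
  have fl: "frac_laplacian s ?\<phi> x = ?\<kappa> * frac_op s ?\<phi> x" for x
    by (rule frac_laplacian_eq_frac_op[OF s bump_measurable, of e z 1 B']) (use bump_le_1[of e z] B' in auto)
  have [measurable]: "frac_op s ?\<phi> \<in> borel_measurable borel"
    by (rule borel_measurable_continuous_onI[OF frac_op_continuous[OF s bump_continuous B']])
  have test: "0 \<le> (LINT x|lebesgue. u0 x * frac_laplacian s ?\<phi> x) + (LINT x|lebesgue. F x)"
    using sup test_function_bump[OF e ze] unfolding distr_supersolution_def F_def set_lebesgue_integral_def
    by auto
  have first: "(LINT x|lebesgue. u0 x * frac_laplacian s ?\<phi> x) = ?\<kappa> * (\<integral>x. u x * frac_op s ?\<phi> x \<partial>lborel)"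
  proof -
    have m: "(\<lambda>x. u x * frac_op s ?\<phi> x) \<in> borel_measurable lborel" by measurable
    have "(LINT x|lebesgue. u0 x * frac_laplacian s ?\<phi> x) = (LINT x|lebesgue. ?\<kappa> * (u x * frac_op s ?\<phi> x))"
    proof (rule integral_cong_AE)
      show "(\<lambda>x. u0 x * frac_laplacian s ?\<phi> x) \<in> borel_measurable lebesgue"
        unfolding fl by (intro borel_measurable_times u0m measurable_completion) measurable
      show "(\<lambda>x. ?\<kappa> * (u x * frac_op s ?\<phi> x)) \<in> borel_measurable lebesgue"
        by (intro borel_measurable_times measurable_completion) measurable
      show "AE x in lebesgue. u0 x * frac_laplacian s ?\<phi> x = ?\<kappa> * (u x * frac_op s ?\<phi> x)"
        using ae by eventually_elim (simp add: fl)
    qed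
    also have "\<dots> = ?\<kappa> * (LINT x|lebesgue. u x * frac_op s ?\<phi> x)" by simp
    also have "(LINT x|lebesgue. u x * frac_op s ?\<phi> x) = (\<integral>x. u x * frac_op s ?\<phi> x \<partial>lborel)"
      by (rule integral_completion[OF m])
    finally show ?thesis .
  qed
  define H where "H x = - (?g x \<bullet> (indicator (ball x0 r) x *\<^sub>R b x)
      + ?\<phi> x * (\<Sum>i\<in>Basis. (indicator (ball x0 r) x *\<^sub>R frechet_derivative b (at x) i) \<bullet> i))" for x
  have [measurable]: "(\<lambda>x. indicator (ball x0 r) x *\<^sub>R b x) \<in> borel_measurable borel"
    by (intro borel_measurable_continuous_on_indicator continuous_at_imp_continuous_on)
       (auto intro: differentiable_imp_continuous_within bd)
  have [measurable]: "(\<lambda>x. indicator (ball x0 r) x *\<^sub>R frechet_derivative b (at x) i) \<in> borel_measurable borel" if "i \<in> Basis" for i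
    by (intro borel_measurable_continuous_on_indicator bc that) auto
  have Hm [measurable]: "H \<in> borel_measurable borel"
    unfolding H_def[abs_def] by (intro borel_measurable_uminus borel_measurable_add borel_measurable_times borel_measurable_sum borel_measurable_inner) measurable
  have HK: "H x = - (?g x \<bullet> b x + ?\<phi> x * dv x)" if "x \<in> ball x0 r" for x
    using that by (simp add: H_def dv_def)
  have H0: "H x = 0" if "x \<notin> ?K" for x
    using outside[OF that] by (simp add: H_def)
  have KB: "x \<in> ball x0 r" if "x \<in> ?K" for x using that ze by auto
  have bder: "(b has_derivative frechet_derivative b (at x)) (at x)" if "x \<in> ball x0 r" for x
    using bd[OF that] by (simp add: frechet_derivative_works)
  have dvb: "\<bar>dv x\<bar> \<le> real DIM('a) * B" if "x \<in> ball x0 r" for x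
  proof -
    have "\<bar>dv x\<bar> \<le> (\<Sum>i\<in>(Basis::'a set). \<bar>frechet_derivative b (at x) i \<bullet> i\<bar>)"
      unfolding dv_def by (rule sum_abs)
    also have "\<dots> \<le> (\<Sum>i\<in>(Basis::'a set). B)"
    proof (rule sum_mono)
      fix i :: 'a assume i: "i \<in> Basis"
      have "\<bar>frechet_derivative b (at x) i \<bullet> i\<bar> \<le> norm (frechet_derivative b (at x) i)"
        using Cauchy_Schwarz_ineq2[of "frechet_derivative b (at x) i" i] i by simp
      also have "\<dots> \<le> onorm (frechet_derivative b (at x)) * norm i"
        by (rule onorm[OF has_derivative_bounded_linear[OF bder[OF that]]])
      also have "\<dots> \<le> B" using bo[OF that] i by simp
      finally show "\<bar>frechet_derivative b (at x) i \<bullet> i\<bar> \<le> B" .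
    qed
    finally show ?thesis by simp
  qed
  have blip: "norm (b x - b z) \<le> B * norm (x - z)" if "x \<in> ?K" for x
  proof (rule differentiable_bound[OF convex_cball _ _ that zK])
    show "(b has_derivative frechet_derivative b (at x)) (at x within ?K)" if "x \<in> ?K" for x
      using bder[OF KB[OF that]] by (rule has_derivative_at_withinI)
    show "onorm (frechet_derivative b (at x)) \<le> B" if "x \<in> ?K" for x
      by (rule bo[OF KB[OF that]])
  qed
  let ?C = "54 / e * (norm (b z) + B * e) + real DIM('a) * B"
  have Hb: "\<bar>H x\<bar> \<le> ?C * indicator (cball 0 ?R) x" for x
  proof (cases "x \<in> ?K")
    case True
    have xz: "norm (x - z) \<le> e" using True by (simp add: dist_norm norm_minus_commute)
    have "norm x \<le> norm (x - z) + norm z" using norm_triangle_ineq[of "x - z" z] by simp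
    then have R: "x \<in> cball 0 ?R" using xz by simp
    have "norm (b x) \<le> norm (b z) + norm (b x - b z)" using norm_triangle_ineq[of "b z" "b x - b z"] by simp
    also have "\<dots> \<le> norm (b z) + B * e"
      using order_trans[OF blip[OF True] mult_left_mono[OF xz B]] by simp
    finally have nb: "norm (b x) \<le> norm (b z) + B * e" .
    have "\<bar>?g x \<bullet> b x\<bar> \<le> norm (?g x) * norm (b x)" by (rule Cauchy_Schwarz_ineq2)
    also have "\<dots> \<le> 54 / e * (norm (b z) + B * e)"
      using norm_bump_gradient_le[OF e] nb e by (intro mult_mono) auto
    finally have 1: "\<bar>?g x \<bullet> b x\<bar> \<le> 54 / e * (norm (b z) + B * e)" .
    have "\<bar>?\<phi> x * dv x\<bar> = ?\<phi> x * \<bar>dv x\<bar>" by (simp add: abs_mult)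
    also have "\<dots> \<le> 1 * (real DIM('a) * B)"
      using bump_le_1[of e z x] dvb[OF KB[OF True]] by (intro mult_mono) auto
    finally have 2: "\<bar>?\<phi> x * dv x\<bar> \<le> real DIM('a) * B" by simp
    have "\<bar>H x\<bar> \<le> ?C" unfolding HK[OF KB[OF True]] using 1 2 by linarith
    then show ?thesis using R by simp
  next
    case False
    have "0 \<le> ?C" using e B by (intro add_nonneg_nonneg mult_nonneg_nonneg) auto
    then show ?thesis using H0[OF False] by simp
  qed
  have uH: "integrable lebesgue (\<lambda>x. u x * H x)"
  proof -
    have "integrable lborel (\<lambda>x. u x * H x)" by (rule integrable_u_mult[OF Hm Hb])
    then show ?thesis by (subst integrable_completion) measurable
  qed
  have cuK: "integrable lebesgue (\<lambda>x. indicator ?K x *\<^sub>R (c x * u0 x))"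
    using cu ze unfolding locally_integrable_on_def set_integrable_def by auto
  \<comment> \<open>The product c u is only known to be integrable on compact sets that avoid x0, such as the closed ball of the bump.\<close>
  have cuphi: "integrable lebesgue (\<lambda>x. (indicator ?K x *\<^sub>R (c x * u0 x)) * ?\<phi> x)"
  proof (rule Bochner_Integration.integrable_bound[OF cuK])
    show "(\<lambda>x. (indicator ?K x *\<^sub>R (c x * u0 x)) * ?\<phi> x) \<in> borel_measurable lebesgue"
      by (rule borel_measurable_times[OF borel_measurable_integrable[OF cuK] measurable_completion]) measurable
    show "AE x in lebesgue. norm ((indicator ?K x *\<^sub>R (c x * u0 x)) * ?\<phi> x) \<le> norm (indicator ?K x *\<^sub>R (c x * u0 x))"
    proof (rule AE_I2)
      fix x
      show "norm ((indicator ?K x *\<^sub>R (c x * u0 x)) * ?\<phi> x) \<le> norm (indicator ?K x *\<^sub>R (c x * u0 x))"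
        using mult_left_mono[OF bump_le_1[of e z x], of "norm (indicator ?K x *\<^sub>R (c x * u0 x))"]
        by (simp only: norm_mult[of _ "?\<phi> x"] real_norm_def[of "?\<phi> x"] abs_of_nonneg[OF bump_nonneg] mult_1_right norm_ge_zero)
    qed
  qed
  \<comment> \<open>Off the closed ball both sides vanish, in particular at x0.\<close>
  have Feq: "F x = u0 x * H x + (indicator ?K x *\<^sub>R (c x * u0 x)) * ?\<phi> x" for x
  proof (cases "x \<in> ?U")
    case True
    then have xb: "x \<in> ball x0 r" by simp
    have 1: "(indicator ?K x *\<^sub>R (c x * u0 x)) * ?\<phi> x = c x * u0 x * ?\<phi> x"
      using outside(1)[of x] by (cases "x \<in> ?K") auto
    have 2: "divergence (\<lambda>y. ?\<phi> y *\<^sub>R b y) x = - H x"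
      unfolding divergence_bump_field[OF bd[OF xb]] HK[OF xb] dv_def by simp
    show ?thesis unfolding 1 F_def 2 using True by (simp add: algebra_simps)
  next
    case False
    then have "x \<notin> ?K" using ze by auto
    then show ?thesis using False H0[of x] outside(1)[of x] by (simp add: F_def)
  qed
  have Fm: "F \<in> borel_measurable lebesgue"
    unfolding Feq[abs_def]
    by (intro borel_measurable_add borel_measurable_times u0m borel_measurable_integrable[OF cuK] measurable_completion) measurable
  have Fi: "integrable lebesgue F"
  proof (rule integrable_cong_AE_imp[OF Bochner_Integration.integrable_add[OF uH cuphi] Fm])
    show "AE x in lebesgue. u x * H x + (indicator ?K x *\<^sub>R (c x * u0 x)) * ?\<phi> x = F x"
      using ae by eventually_elim (simp add: Feq)
  qed
  define G where "G x = - (u x * (?g x \<bullet> b z)) + B * (u x * bump_commutator e z x) + (real DIM('a) * B + M) * (u x * ?\<phi> x)" for x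
  have i1: "integrable lborel (\<lambda>x. u x * (?g x \<bullet> b z))"
    by (rule integrable_u_mult[OF _ bump_gradient_le_indicator[OF e order_refl]]) measurable
  have i2: "integrable lborel (\<lambda>x. u x * bump_commutator e z x)"
    by (rule integrable_u_mult[OF _ bump_commutator_le_indicator[OF e order_refl]]) measurable
  have i3: "integrable lborel (\<lambda>x. u x * ?\<phi> x)" by (rule integrable_u_bump[OF e])
  have Gi: "integrable lborel G" unfolding G_def[abs_def] using i1 i2 i3 by simp
  have FG: "AE x in lebesgue. F x \<le> G x"
    using ae
  proof eventually_elim
    fix x assume ux: "u0 x = u x"
    show "F x \<le> G x"
    proof (cases "x \<in> ?K")
      case False
      then show ?thesis unfolding Feq G_def using outside[OF False] H0[OF False] by simp
    next
      case True
      note xb = KB[OF True]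
      have "?g x \<bullet> (b z - b x) \<le> norm (?g x) * norm (b z - b x)" by (rule norm_cauchy_schwarz)
      also have "\<dots> \<le> norm (?g x) * (B * norm (x - z))"
        using blip[OF True] by (intro mult_left_mono) (auto simp: norm_minus_commute)
      also have "\<dots> = B * bump_commutator e z x" by (simp add: bump_commutator_def)
      finally have 1: "?g x \<bullet> b z - ?g x \<bullet> b x \<le> B * bump_commutator e z x" by (simp add: inner_diff_right)
      have "- dv x + c x \<le> real DIM('a) * B + M" using dvb[OF xb] cM[OF xb] by linarith
      then have 2: "?\<phi> x * (- dv x + c x) \<le> ?\<phi> x * (real DIM('a) * B + M)" by (intro mult_left_mono) auto
      have "H x + c x * ?\<phi> x \<le> - (?g x \<bullet> b z) + B * bump_commutator e z x + (real DIM('a) * B + M) * ?\<phi> x"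
        unfolding HK[OF xb] using 1 2 by (simp add: algebra_simps)
      then have "u x * (H x + c x * ?\<phi> x) \<le> u x * (- (?g x \<bullet> b z) + B * bump_commutator e z x + (real DIM('a) * B + M) * ?\<phi> x)"
        by (intro mult_left_mono u_nonneg)
      moreover have "F x = u x * (H x + c x * ?\<phi> x)" unfolding Feq ux using True by (simp add: algebra_simps)
      moreover have "G x = u x * (- (?g x \<bullet> b z) + B * bump_commutator e z x + (real DIM('a) * B + M) * ?\<phi> x)"
        unfolding G_def by (simp add: algebra_simps)
      ultimately show ?thesis by simp
    qed
  qed
  have Gm: "G \<in> borel_measurable lborel" using Gi by simp
  have "(LINT x|lebesgue. F x) \<le> (LINT x|lebesgue. G x)"
    by (rule integral_mono_AE[OF Fi _ FG]) (use Gi integrable_completion[OF Gm] in simp)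
  also have "\<dots> = (\<integral>x. G x \<partial>lborel)" by (rule integral_completion[OF Gm])
  also have "\<dots> = - (\<integral>x. u x * (?g x \<bullet> b z) \<partial>lborel) + B * (\<integral>x. u x * bump_commutator e z x \<partial>lborel)
      + (real DIM('a) * B + M) * (\<integral>x. u x * ?\<phi> x \<partial>lborel)"
    unfolding G_def[abs_def] using i1 i2 i3 by simp
  finally show ?thesis using test unfolding first by linarith
qed

section \<open>Recovering a function from its mollifications\<close>

lemma mollify_ge:
  assumes e: "0 < e" and m: "0 \<le> m" and ge: "AE x in lborel. norm (x - z) < e \<longrightarrow> m \<le> u x"
  shows "m * bump_mass TYPE('a) e \<le> mollify e u z"
proof -
  have "m * bump_mass TYPE('a) e = (\<integral>x. m * bump e z x \<partial>lborel)" by (simp add: integral_bump)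
  also have "\<dots> \<le> mollify e u z"
    unfolding mollify_def
  proof (rule integral_mono_AE)
    show "integrable lborel (\<lambda>x. m * bump e z x)" by (intro integrable_mult_right integrable_bump e)
    show "AE x in lborel. m * bump e z x \<le> u x * bump e z x"
      using ge
    proof eventually_elim
      fix x assume x: "norm (x - z) < e \<longrightarrow> m \<le> u x"
      show "m * bump e z x \<le> u x * bump e z x"
        using x bump_outside[OF e, of x z] by (cases "norm (x - z) < e") (auto intro: mult_right_mono)
    qed
  qed (rule integrable_u_bump[OF e])
  finally show ?thesis .
qed

text \<open>
  By Fubini's theorem the left side is the integral of \<open>u\<close> against the mollified indicator of the box,
  which converges to the indicator off the boundary of the box.
\<close>

lemma mollify_box_average:
  assumes E: "\<And>k. 0 < E k" "\<And>k. E k \<le> 1" "E \<longlonglongrightarrow> 0"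
  shows "(\<lambda>k. (\<integral>z. indicator (cbox a b) z * mollify (E k) u z \<partial>lborel) / bump_mass TYPE('a) (E k))
    \<longlonglongrightarrow> (\<integral>x. indicator (cbox a b) x * u x \<partial>lborel)"
proof -
  let ?Q = "cbox a b"
  obtain R0 where R0: "\<And>z. z \<in> ?Q \<Longrightarrow> norm z \<le> R0"
    using bounded_cbox[of a b] unfolding bounded_iff by blast
  let ?R = "R0 + 1"
  have Qi: "integrable lborel (\<lambda>z. indicator ?Q z :: real)" by (intro integrable_real_indicator) (auto simp: emeasure_bounded_finite[OF bounded_cbox, unfolded infinity_ennreal_def])
  have Ri: "integrable lborel (\<lambda>x. u x * indicator (cball 0 ?R) x)"
    by (rule integrable_u_mult[where K = 1 and R = ?R], measurable) (auto simp: indicator_def)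
  define avg where "avg k x = (\<integral>z. indicator ?Q z * bump (E k) x z \<partial>lborel) / bump_mass TYPE('a) (E k)" for k x
  have sup: "indicator ?Q z * bump (E k) x z \<le> indicator ?Q z * indicator (cball 0 ?R) x" for z x k
  proof (cases "z \<in> ?Q")
    case True
    then have "norm z + E k \<le> ?R" using R0[OF True] E(2)[of k] by linarith
    then show ?thesis using bump_le_indicator[OF E(1), of z k ?R x] True by (simp add: bump_symmetric[of _ x z])
  qed simp
  have swap: "(\<integral>z. indicator ?Q z * mollify (E k) u z \<partial>lborel) / bump_mass TYPE('a) (E k) = (\<integral>x. u x * avg k x \<partial>lborel)" for k
  proof -
    define q where "q z = (indicator ?Q z :: real)" for z
    define g where "g x = u x * indicator (cball 0 ?R) x" for x
    have qm [measurable]: "q \<in> borel_measurable borel" unfolding q_def[abs_def] by (intro borel_measurable_indicator) auto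
    have gm [measurable]: "g \<in> borel_measurable borel" unfolding g_def[abs_def] by (intro borel_measurable_times borel_measurable_indicator u_measurable) auto
    have q0: "0 \<le> q z" for z by (simp add: q_def)
    have g0: "0 \<le> g x" for x using u_nonneg by (simp add: g_def)
    define f where "f z x = q z * (u x * bump (E k) x z)" for z x
    have dom: "integrable (lborel \<Otimes>\<^sub>M lborel) (\<lambda>(z, x). q z * g x)"
    proof (rule lborel_pair.Fubini_integrable)
      have *: "(\<integral>x. norm (case (z, x) of (z, x) \<Rightarrow> q z * g x) \<partial>lborel) = q z * (\<integral>x. g x \<partial>lborel)" for z
        using q0 g0 by (simp add: abs_mult)
      show "integrable lborel (\<lambda>z. \<integral>x. norm (case (z, x) of (z, x) \<Rightarrow> q z * g x) \<partial>lborel)"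
        unfolding * unfolding q_def by (rule integrable_mult_left[OF Qi])
      show "AE z in lborel. integrable lborel (\<lambda>x. case (z, x) of (z, x) \<Rightarrow> q z * g x)"
        unfolding prod.case g_def by (intro AE_I2 integrable_mult_right Ri)
    qed measurable
    have fi: "integrable (lborel \<Otimes>\<^sub>M lborel) (case_prod f)"
    proof (rule Bochner_Integration.integrable_bound[OF dom])
      show "case_prod f \<in> borel_measurable (lborel \<Otimes>\<^sub>M lborel)" unfolding f_def bump_def by measurable
      show "AE p in lborel \<Otimes>\<^sub>M lborel. norm (case_prod f p) \<le> norm (case p of (z, x) \<Rightarrow> q z * g x)"
      proof (rule AE_I2)
        fix p :: "'a \<times> 'a"
        obtain z x where p: "p = (z, x)" by (cases p)
        have "u x * (indicator ?Q z * bump (E k) x z) \<le> u x * (indicator ?Q z * indicator (cball 0 ?R) x)"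
          by (intro mult_left_mono sup u_nonneg)
        then have "f z x \<le> q z * g x" by (simp add: f_def q_def g_def mult.left_commute)
        moreover have "0 \<le> f z x" unfolding f_def by (intro mult_nonneg_nonneg q0 u_nonneg bump_nonneg)
        ultimately show "norm (case_prod f p) \<le> norm (case p of (z, x) \<Rightarrow> q z * g x)"
          by (simp add: p)
      qed
    qed
    have "(\<integral>z. indicator ?Q z * mollify (E k) u z \<partial>lborel) = (\<integral>z. (\<integral>x. f z x \<partial>lborel) \<partial>lborel)"
      by (simp add: f_def q_def mollify_def bump_symmetric)
    also have "\<dots> = (\<integral>x. (\<integral>z. f z x \<partial>lborel) \<partial>lborel)"
      by (rule lborel_pair.Fubini_integral[OF fi, symmetric])
    also have "\<dots> = (\<integral>x. u x * (\<integral>z. indicator ?Q z * bump (E k) x z \<partial>lborel) \<partial>lborel)"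
      by (simp add: f_def q_def mult.left_commute)
    finally show ?thesis by (simp add: avg_def)
  qed
  have bi: "integrable lborel (\<lambda>z. indicator ?Q z * bump (E k) x z)" for k x
    by (rule Bochner_Integration.integrable_bound[OF integrable_bump[OF E(1), of k x]]) (auto simp: indicator_def)
  have avg: "0 \<le> avg k x" "avg k x \<le> indicator (cball 0 ?R) x" for k x
  proof -
    show "0 \<le> avg k x" unfolding avg_def
      using bump_mass_pos[OF E(1), of k, where 'a='a] by (intro divide_nonneg_pos Bochner_Integration.integral_nonneg) auto
    show "avg k x \<le> indicator (cball 0 ?R) x"
    proof (cases "x \<in> cball 0 ?R")
      case True
      have "(\<integral>z. indicator ?Q z * bump (E k) x z \<partial>lborel) \<le> (\<integral>z. bump (E k) x z \<partial>lborel)"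
        by (rule integral_mono[OF bi integrable_bump[OF E(1)]]) (auto simp: indicator_def)
      then show ?thesis using True bump_mass_pos[OF E(1), of k, where 'a='a] by (simp add: avg_def integral_bump)
    next
      case False
      then have z0: "indicator ?Q z * bump (E k) x z = 0" for z
        using sup[of z k x] by (intro antisym) auto
      show ?thesis by (simp only: avg_def z0) simp
    qed
  qed
  have avgm [measurable]: "avg k \<in> borel_measurable borel" for k
    unfolding avg_def[abs_def] bump_def by measurable
  have "cbox a b - box a b \<in> null_sets lborel"
    using negligible_frontier_interval[of a b] by (simp add: negligible_iff_null_sets null_sets_completion_iff)
  then have fr: "AE x in lborel. x \<notin> cbox a b - box a b" by (rule AE_not_in)
  have small: "\<forall>\<^sub>F k in sequentially. E k < d" if "0 < d" for d
    using order_tendstoD(2)[OF E(3) that] .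
  have "(\<lambda>k. \<integral>x. u x * avg k x \<partial>lborel) \<longlonglongrightarrow> (\<integral>x. u x * indicator ?Q x \<partial>lborel)"
  proof (rule integral_dominated_convergence[OF _ _ Ri])
    show "AE x in lborel. (\<lambda>k. u x * avg k x) \<longlonglongrightarrow> u x * indicator ?Q x"
      using fr
    proof eventually_elim
      fix x assume x: "x \<notin> cbox a b - box a b"
      have "(\<lambda>k. avg k x) \<longlonglongrightarrow> indicator ?Q x"
      proof (cases "x \<in> ?Q")
        case True
        then have "x \<in> box a b" using x by simp
        then obtain d where d: "0 < d" "ball x d \<subseteq> ?Q"
          using open_contains_ball[of "box a b"] open_box box_subset_cbox by (meson order_trans)
        from small[OF d(1)] have "\<forall>\<^sub>F k in sequentially. avg k x = indicator ?Q x"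
        proof eventually_elim
          fix k assume k: "E k < d"
          have z1: "indicator ?Q z * bump (E k) x z = bump (E k) x z" for z
          proof (cases "z \<in> ?Q")
            case False
            then have "z \<notin> ball x d" using d by auto
            then have "bump (E k) x z = 0" using k by (intro bump_outside E) (auto simp: dist_norm norm_minus_commute)
            then show ?thesis by simp
          qed simp
          show "avg k x = indicator ?Q x"
            using True bump_mass_pos[OF E(1), of k, where 'a='a] by (simp only: avg_def z1 integral_bump) simp
        qed
        then show ?thesis by (rule tendsto_eventually)
      next
        case False
        then obtain d where d: "0 < d" "ball x d \<subseteq> - ?Q"
          using open_contains_ball[of "- ?Q"] by (auto simp: open_Compl closed_cbox)
        from small[OF d(1)] have "\<forall>\<^sub>F k in sequentially. avg k x = indicator ?Q x"
        proof eventually_elim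
          fix k assume k: "E k < d"
          have z0: "indicator ?Q z * bump (E k) x z = 0" for z
          proof (cases "z \<in> ?Q")
            case True
            then have "z \<notin> ball x d" using d by auto
            then have "bump (E k) x z = 0" using k by (intro bump_outside E) (auto simp: dist_norm norm_minus_commute)
            then show ?thesis by simp
          qed simp
          show "avg k x = indicator ?Q x"
            using False by (simp only: avg_def z0) simp
        qed
        then show ?thesis by (rule tendsto_eventually)
      qed
      then show "(\<lambda>k. u x * avg k x) \<longlonglongrightarrow> u x * indicator ?Q x" by (intro tendsto_intros)
    qed
    show "AE x in lborel. norm (u x * avg k x) \<le> u x * indicator (cball 0 ?R) x" for k
    proof (rule AE_I2)
      fix x
      have "norm (u x * avg k x) = u x * avg k x" using u_nonneg[of x] avg(1)[of k x] by simp
      also have "\<dots> \<le> u x * indicator (cball 0 ?R) x" by (intro mult_left_mono avg u_nonneg)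
      finally show "norm (u x * avg k x) \<le> u x * indicator (cball 0 ?R) x" .
    qed
  qed measurable
  then show ?thesis by (simp add: swap mult.commute)
qed

text \<open>
  Lebesgue's differentiation theorem for cubes.
\<close>

lemma AE_ge_if_box_integrals_ge:
  fixes S :: "'a set"
  assumes S: "open S" "bounded S"
    and ge: "\<And>a b. cbox a b \<subseteq> S \<Longrightarrow> w * measure lborel (cbox a b) \<le> (\<integral>x. indicator (cbox a b) x * u x \<partial>lborel)"
  shows "AE x in lebesgue. x \<in> S \<longrightarrow> w \<le> u x"
proof -
  obtain R where "\<forall>x\<in>S. norm x \<le> R" using S(2) unfolding bounded_iff by blast
  then have R: "S \<subseteq> cball 0 R" by auto
  define f where "f x = u x * indicator (cball 0 R) x" for x
  have fi: "integrable lborel f"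
    unfolding f_def by (rule integrable_u_mult[where K = 1 and R = R], measurable) (auto simp: indicator_def)
  have "f integrable_on UNIV" by (rule integrable_on_lborel[OF fi])
  then have fcb: "f integrable_on cbox a b" for a b by (rule integrable_on_subcbox) simp
  then obtain N where N: "negligible N"
    "\<And>x e. x \<notin> N \<Longrightarrow> 0 < e \<Longrightarrow> \<exists>d>0. \<forall>h. 0 < h \<and> h < d \<longrightarrow>
        norm (integral (cbox x (x + h *\<^sub>R One)) f /\<^sub>R h ^ DIM('a) - f x) < e"
    using integrable_ccontinuous_explicit[of f, OF fcb] by blast
  have pt: "w \<le> u x" if x: "x \<in> S" "x \<notin> N" for x
  proof (rule field_le_epsilon)
    fix \<epsilon> :: real assume \<epsilon>: "0 < \<epsilon>"
    obtain d where d: "0 < d" "\<And>h. 0 < h \<Longrightarrow> h < d \<Longrightarrow> norm (integral (cbox x (x + h *\<^sub>R One)) f /\<^sub>R h ^ DIM('a) - f x) < \<epsilon>"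
      using N(2)[OF x(2) \<epsilon>] by blast
    obtain \<eta> where \<eta>: "0 < \<eta>" "ball x \<eta> \<subseteq> S" using S(1) x(1) open_contains_ball by blast
    have One0: "0 < norm (One::'a)" by (simp add: One_non_0)
    define h where "h = min (d / 2) (\<eta> / (2 * norm (One::'a)))"
    have h: "0 < h" "h < d" "h * norm (One::'a) < \<eta>"
    proof -
      show "0 < h" "h < d" using d(1) \<eta>(1) One0 by (auto simp: h_def)
      have "h * norm (One::'a) \<le> \<eta> / (2 * norm (One::'a)) * norm (One::'a)"
        by (intro mult_right_mono) (auto simp: h_def)
      also have "\<dots> < \<eta>" using \<eta>(1) One0 by simp
      finally show "h * norm (One::'a) < \<eta>" .
    qed
    let ?Q = "cbox x (x + h *\<^sub>R One)"
    have QS: "?Q \<subseteq> S"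
    proof
      fix y assume y: "y \<in> ?Q"
      have "norm (y - x) \<le> norm (h *\<^sub>R (One::'a))"
      proof (rule norm_le_componentwise)
        fix i :: 'a assume i: "i \<in> Basis"
        then have "x \<bullet> i \<le> y \<bullet> i" "y \<bullet> i \<le> x \<bullet> i + h" using y by (auto simp: mem_box inner_add_left)
        then show "\<bar>(y - x) \<bullet> i\<bar> \<le> \<bar>(h *\<^sub>R (One::'a)) \<bullet> i\<bar>" using i h(1) by (simp add: inner_diff_left)
      qed
      then have "norm (y - x) < \<eta>" using h by simp
      then show "y \<in> S" using \<eta>(2) by (auto simp: dist_norm norm_minus_commute)
    qed
    have vol: "measure lborel ?Q = h ^ DIM('a)"
      using h(1) by (subst measure_lborel_cbox_eq) (auto simp: inner_add_left)
    have "integral ?Q f = (\<integral>y. indicator ?Q y * f y \<partial>lborel)"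
    proof -
      have "set_integrable lborel ?Q f"
        unfolding set_integrable_def by (rule integrable_mult_indicator[OF _ fi]) simp
      from set_borel_integral_eq_integral(2)[OF this] show ?thesis
        by (simp add: set_lebesgue_integral_def)
    qed
    also have "\<dots> = (\<integral>y. indicator ?Q y * u y \<partial>lborel)"
      using QS R by (intro Bochner_Integration.integral_cong) (auto simp: f_def indicator_def)
    finally have "w * h ^ DIM('a) \<le> integral ?Q f" using ge[OF QS] vol by simp
    then have "w \<le> integral ?Q f /\<^sub>R h ^ DIM('a)" using h(1) by (simp add: field_simps)
    moreover have "f x = u x" using x R by (auto simp: f_def)
    ultimately show "w \<le> u x + \<epsilon>" using d(2)[OF h(1,2)] by (simp add: abs_if split: if_splits)
  qed
  have "AE x in lebesgue. x \<notin> N" using N(1) by (simp add: negligible_iff_null_sets AE_not_in)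
  then show ?thesis by eventually_elim (use pt in blast)
qed

end

section \<open>The uniform lower bound\<close>

lemma frac_laplacian_const_pos: "0 < s \<Longrightarrow> s < 1 \<Longrightarrow> 0 < frac_laplacian_const n s"
  unfolding frac_laplacian_const_def
  by (intro divide_pos_pos mult_pos_pos Gamma_real_pos) (auto simp: add_nonneg_pos)

text \<open>
  The value \<open>ln L\<close> at the centre can be made as large as desired, and by the Lipschitz bound it drops
  by at most \<open>1\<close> within the distance \<open>1 / sqrt L\<close>.
\<close>

lemma barrier_large_near_center:
  assumes "0 < \<delta>" "0 \<le> w"
  obtains L \<rho> where "1 \<le> L" "0 < \<rho>" "\<And>y::'a::euclidean_space. norm y \<le> \<rho> \<Longrightarrow> w \<le> \<delta> * barrier L y"
proof -
  define L where "L = exp (w / \<delta> + 1)"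
  have L: "1 \<le> L" using assms by (simp add: L_def)
  show ?thesis
  proof (rule that[OF L])
    show "0 < sqrt (1 / L)" using L by simp
    fix y :: 'a assume "norm y \<le> sqrt (1 / L)"
    then have "(norm y)\<^sup>2 \<le> (sqrt (1 / L))\<^sup>2" by (intro power_mono) auto
    then have y: "L * (norm y)\<^sup>2 \<le> 1" using L by (simp add: field_simps)
    have "\<bar>barrier L y - barrier_profile L 0\<bar> \<le> L * \<bar>(norm y)\<^sup>2 - 0\<bar>"
      by (rule barrier_profile_lipschitz[OF L]) auto
    then have "ln L - 1 \<le> barrier L y" using y L by (simp add: barrier_profile_0)
    then have "w / \<delta> \<le> barrier L y" by (simp add: L_def)
    then have "\<delta> * (w / \<delta>) \<le> \<delta> * barrier L y" using assms by (intro mult_left_mono) auto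
    then show "w \<le> \<delta> * barrier L y" using assms by simp
  qed
qed

lemma powr_small:
  assumes "0 < s" "0 \<le> B" "0 < (\<kappa>::real)"
  obtains \<rho> where "0 < \<rho>" "\<And>e. 0 < e \<Longrightarrow> e < \<rho> \<Longrightarrow> B * e powr (2 * s) \<le> \<kappa>"
proof -
  let ?t = "\<kappa> / (B + 1)"
  have t: "0 < ?t" using assms by simp
  show ?thesis
  proof (rule that[of "?t powr (1 / (2 * s))"])
    show "0 < ?t powr (1 / (2 * s))" by (rule powr_gt_zero[THEN iffD2, OF less_imp_neq[OF t, symmetric]])
    fix e :: real assume e: "0 < e" "e < ?t powr (1 / (2 * s))"
    have "e powr (2 * s) \<le> (?t powr (1 / (2 * s))) powr (2 * s)" using e assms by (intro powr_mono2) auto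
    also have "\<dots> = ?t powr 1" using assms by (simp only: powr_powr) simp
    also have "\<dots> = ?t" by (rule powr_one[OF less_imp_le[OF t]])
    finally have "B * e powr (2 * s) \<le> B * ?t" using assms by (intro mult_left_mono) auto
    also have "B * ?t \<le> (B + 1) * ?t" using t by (intro mult_right_mono) auto
    also have "\<dots> = \<kappa>" using assms by simp
    finally show "B * e powr (2 * s) \<le> \<kappa>" .
  qed
qed

text \<open>
  The regularity used of the drift, in a form that also covers a drift vanishing on \<open>S\<close> with bound
  \<open>0\<close>.
\<close>

definition admissible_drift :: "real \<Rightarrow> 'a::euclidean_space set \<Rightarrow> ('a \<Rightarrow> 'a) \<Rightarrow> bool" where
  "admissible_drift B S b \<longleftrightarrow>
     (\<forall>x\<in>S. b differentiable (at x) \<and> norm (b x) \<le> B \<and> onorm (frechet_derivative b (at x)) \<le> B) \<and>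
     (\<forall>i\<in>Basis. continuous_on S (\<lambda>x. frechet_derivative b (at x) i))"

lemma nonneg_borel_version:
  fixes u :: "'a::euclidean_space \<Rightarrow> real"
  assumes s: "0 < s" "s < 1" and u: "u \<in> weighted_L1 (2 * s)" and nn: "AE x in lebesgue. 0 \<le> u x"
  obtains v where "weighted_nonneg s v" "AE x in lebesgue. u x = v x"
proof -
  have um: "u \<in> borel_measurable lebesgue"
    and ui: "integrable lebesgue (\<lambda>y. \<bar>u y\<bar> / (1 + norm y powr (real DIM('a) + 2 * s)))"
    using u by (auto simp: weighted_L1_def)
  obtain g where g: "g \<in> borel_measurable lborel" "AE x in lborel. u x = g x"
    using completion_ex_borel_measurable_real[OF um] by blast
  define v where "v x = max 0 (g x)" for x
  have vm [measurable]: "v \<in> borel_measurable borel" using g(1) unfolding v_def[abs_def] by simp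
  have ae: "AE x in lebesgue. u x = v x"
    using AE_completion[OF g(2)] nn by eventually_elim (simp add: v_def)
  have m: "(\<lambda>y. v y / (1 + norm y powr (real DIM('a) + 2 * s))) \<in> borel_measurable lborel" by measurable
  have "integrable lebesgue (\<lambda>y. v y / (1 + norm y powr (real DIM('a) + 2 * s)))"
  proof (rule integrable_cong_AE_imp[OF ui measurable_completion[OF m]])
    show "AE y in lebesgue. \<bar>u y\<bar> / (1 + norm y powr (real DIM('a) + 2 * s)) = v y / (1 + norm y powr (real DIM('a) + 2 * s))"
      using ae by eventually_elim (simp add: v_def)
  qed
  then have "integrable lborel (\<lambda>y. v y / (1 + norm y powr (real DIM('a) + 2 * s)))"
    using integrable_completion[OF m] by simp
  then have "weighted_nonneg s v" using s by unfold_locales (auto simp: v_def[abs_def] intro: vm[unfolded v_def[abs_def]])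
  then show ?thesis using ae by (rule that)
qed

context weighted_nonneg
begin

text \<open>
  The inequality satisfied by the mollification. Absorbing the commutator costs a zero order term and
  a fraction of the fractional Laplacian that vanishes with \<open>e\<close>.
\<close>

lemma mollified_inequality:
  fixes b :: "'a \<Rightarrow> 'a" and c u0 :: "'a \<Rightarrow> real"
  assumes sup: "distr_supersolution s b c (ball x0 r - {x0}) u0"
    and u0m: "u0 \<in> borel_measurable lebesgue" and ae: "AE x in lebesgue. u0 x = u x"
    and b: "admissible_drift B (ball x0 r) b" and B: "0 \<le> B"
    and cM: "\<And>x. x \<in> ball x0 r \<Longrightarrow> c x \<le> M"
    and cu: "locally_integrable_on (\<lambda>x. c x * u0 x) (ball x0 r - {x0})"
    and A: "\<And>e z (x::'a). 0 < e \<Longrightarrow> bump_commutator e z x \<le> A * bump e z x - e powr (2 * s) * frac_op s (bump e z) x"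
    and e: "0 < e" and ze: "cball z e \<subseteq> ball x0 r - {x0}"
  shows "0 \<le> (frac_laplacian_const DIM('a) s - B * e powr (2 * s)) * frac_op s (mollify e u) z
      + - (\<integral>x. u x * (bump_gradient e z x \<bullet> b z) \<partial>lborel)
      + (real DIM('a) * B + M + B * A) * mollify e u z"
proof -
  have i2: "integrable lborel (\<lambda>x. u x * bump_commutator e z x)"
    by (rule integrable_u_mult[OF _ bump_commutator_le_indicator[OF e order_refl]]) measurable
  note i3 = integrable_u_bump[OF e, of z]
  note fr = frac_op_mollify[OF e, of z]
  have "(\<integral>x. u x * bump_commutator e z x \<partial>lborel)
     \<le> (\<integral>x. A * (u x * bump e z x) - e powr (2 * s) * (u x * frac_op s (bump e z) x) \<partial>lborel)"
  proof (rule integral_mono[OF i2])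
    show "integrable lborel (\<lambda>x. A * (u x * bump e z x) - e powr (2 * s) * (u x * frac_op s (bump e z) x))"
      using i3 fr(1) by (intro Bochner_Integration.integrable_diff integrable_mult_right)
    show "u x * bump_commutator e z x \<le> A * (u x * bump e z x) - e powr (2 * s) * (u x * frac_op s (bump e z) x)" for x
      using mult_left_mono[OF A[OF e, of z x] u_nonneg[of x]] by (simp add: algebra_simps)
  qed
  also have "\<dots> = A * mollify e u z - e powr (2 * s) * frac_op s (mollify e u) z"
    using i3 fr(1) by (simp add: fr(3) mollify_def[of e u z, symmetric])
  finally have "B * (\<integral>x. u x * bump_commutator e z x \<partial>lborel) \<le> B * (A * mollify e u z - e powr (2 * s) * frac_op s (mollify e u) z)"
    using B by (rule mult_left_mono)
  moreover have "0 \<le> frac_laplacian_const DIM('a) s * frac_op s (mollify e u) z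
      - (\<integral>x. u x * (bump_gradient e z x \<bullet> b z) \<partial>lborel)
      + B * (\<integral>x. u x * bump_commutator e z x \<partial>lborel)
      + (real DIM('a) * B + M) * mollify e u z"
    using weak_inequality_at_bump[OF sup u0m ae _ _ _ B cM cu e ze] b
    unfolding fr(3) mollify_def[of e u z, symmetric] admissible_drift_def by blast
  ultimately show ?thesis by (simp add: algebra_simps)
qed

end

definition supersolution_data ::
    "real \<Rightarrow> real \<Rightarrow> real \<Rightarrow> 'a::euclidean_space \<Rightarrow> real \<Rightarrow> ('a \<Rightarrow> 'a) \<Rightarrow> ('a \<Rightarrow> real) \<Rightarrow> real \<Rightarrow> ('a \<Rightarrow> real) \<Rightarrow> bool" where
  "supersolution_data s B M x0 r b c m u \<longleftrightarrow>
     0 < r \<and> r \<le> 1 \<and> admissible_drift B (ball x0 r) b \<and> (\<forall>x\<in>ball x0 r. c x \<le> M) \<and>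
     locally_integrable_on (\<lambda>x. c x * u x) (ball x0 r - {x0}) \<and> 0 < m \<and> u \<in> weighted_L1 (2 * s) \<and>
     distr_supersolution s b c (ball x0 r - {x0}) u \<and>
     (AE x in lebesgue. x \<in> ball x0 r - ball x0 (r / 2) \<longrightarrow> m \<le> u x) \<and>
     (AE x in lebesgue. 0 \<le> u x)"

text \<open>
  The minimum principle is applied to the mollifications of \<open>u\<close>, normalised by the mass of the bump.
  For fixed \<open>\<delta>\<close> the barrier is chosen first and then the radius \<open>e\<close> of the bump, small enough that
  bumps centred outside the region where the barrier is large avoid \<open>x0\<close>. Averaging over boxes that
  avoid \<open>x0\<close> and letting first \<open>e\<close> and then \<open>\<delta>\<close> tend to zero gives the bound for the integral of
  \<open>u\<close> over every such box.
\<close>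

lemma uniform_lower_bound:
  assumes s: "0 < s" "s < 1" and n: "2 \<le> DIM('a::euclidean_space)" and B: "0 \<le> B" "B = 0 \<or> 1 / 2 < s" and M: "0 < M"
  shows "\<exists>\<alpha>>0. \<forall>(x0::'a) r b c m u. supersolution_data s B M x0 r b c m u \<longrightarrow>
    (AE x in lebesgue. x \<in> ball x0 r \<longrightarrow> \<alpha> * m \<le> u x)"
proof -
  define \<kappa> where "\<kappa> = frac_laplacian_const DIM('a) s"
  have \<kappa>: "0 < \<kappa>" unfolding \<kappa>_def by (rule frac_laplacian_const_pos[OF s])
  define \<theta>0 where "\<theta>0 = \<kappa> / 2"
  have \<theta>0: "0 < \<theta>0" using \<kappa> by (simp add: \<theta>0_def)
  obtain A where A: "0 \<le> A"
    "\<And>e z (x::'a). 0 < e \<Longrightarrow> bump_commutator e z x \<le> A * bump e z x - e powr (2 * s) * frac_op s (bump e z) x"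
    using bump_commutator_absorbed[OF s, where 'a='a] by blast
  define M2 where "M2 = real DIM('a) * B + M + B * A"
  have M2: "0 < M2" unfolding M2_def using B M A(1) by (simp add: add_nonneg_pos add_pos_nonneg)
  have k: "0 \<le> 2 * B / \<theta>0" "2 * B / \<theta>0 = 0 \<or> 1 / 2 < s" using B \<theta>0 by auto
  obtain C2 where C2: "0 \<le> C2"
    "\<And>L (x::'a). 1 \<le> L \<Longrightarrow> 2 * B / \<theta>0 * max ((norm x)\<^sup>2) (1 / L) powr (- 1 / 2) - frac_op s (\<lambda>x. barrier L x) x \<le> C2"
    using barrier_dominates_drift[OF s n k] by blast
  let ?ac = "annulus_const s TYPE('a)"
  \<comment> \<open>The coefficient of w in the smallness condition of the minimum principle; \<alpha> spends half of the gain from the annulus on it, and \<delta> spends less than the other half.\<close>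
  define P where "P = 8 powr (2 * s) * kernel_tail s TYPE('a) + M2 / \<theta>0"
  have P: "0 < P" unfolding P_def using M2 \<theta>0 kernel_tail_nonneg by (intro add_nonneg_pos mult_nonneg_nonneg) auto
  have ac: "0 < ?ac" by (rule annulus_const_pos)
  define \<alpha> where "\<alpha> = min 1 (?ac / (2 * P))"
  have \<alpha>: "0 < \<alpha>" "\<alpha> \<le> 1" using P ac by (auto simp: \<alpha>_def)
  have \<alpha>P: "\<alpha> * P \<le> ?ac / 2"
  proof -
    have "\<alpha> * P \<le> ?ac / (2 * P) * P" using P by (intro mult_right_mono) (auto simp: \<alpha>_def)
    then show ?thesis using P by simp
  qed
  show ?thesis
  proof (intro exI[of _ \<alpha>] conjI \<alpha>(1) allI impI)
    fix x0 :: 'a and r and b :: "'a \<Rightarrow> 'a" and c :: "'a \<Rightarrow> real" and m and u :: "'a \<Rightarrow> real"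
    assume "supersolution_data s B M x0 r b c m u"
    then have r: "0 < r" "r \<le> 1" and b: "admissible_drift B (ball x0 r) b" and cM: "\<forall>x\<in>ball x0 r. c x \<le> M"
      and cu: "locally_integrable_on (\<lambda>x. c x * u x) (ball x0 r - {x0})" and m: "0 < m"
      and u: "u \<in> weighted_L1 (2 * s)" and sup: "distr_supersolution s b c (ball x0 r - {x0}) u"
      and um: "AE x in lebesgue. x \<in> ball x0 r - ball x0 (r / 2) \<longrightarrow> m \<le> u x"
      and u0: "AE x in lebesgue. 0 \<le> u x"
      unfolding supersolution_data_def by simp_all
    obtain v where vv: "weighted_nonneg s v" and uv: "AE x in lebesgue. u x = v x"
      using nonneg_borel_version[OF s u u0] by blast
    interpret weighted_nonneg s v by (rule vv)
    have umeas: "u \<in> borel_measurable lebesgue" using u by (simp add: weighted_L1_def)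
    let ?N = "bump_mass TYPE('a)"
    have vm: "AE x in lborel. x \<in> ball x0 r - ball x0 (r / 2) \<longrightarrow> m \<le> v x"
    proof -
      have "AE x in lebesgue. x \<in> ball x0 r - ball x0 (r / 2) \<longrightarrow> m \<le> v x"
        using um uv by eventually_elim auto
      then show ?thesis by (simp add: AE_completion_iff)
    qed
    have mollified: "\<exists>\<rho>>0. \<forall>e z. 0 < e \<longrightarrow> e < \<rho> \<longrightarrow> norm (z - x0) \<le> 7 / 8 * r \<longrightarrow> z \<noteq> x0 \<longrightarrow>
        \<alpha> * m * ?N e \<le> mollify e v z + \<delta> * ?N e / (norm (z - x0))\<^sup>2"
      if \<delta>: "0 < \<delta>" "\<delta> * C2 < m * ?ac / 2" for \<delta>
    proof -
      have w0: "0 \<le> \<alpha> * m" using \<alpha> m by simp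
      obtain L \<rho> where L: "1 \<le> L" and \<rho>: "0 < \<rho>" and near: "\<And>y::'a. norm y \<le> \<rho> \<Longrightarrow> \<alpha> * m \<le> \<delta> * barrier L y"
        using barrier_large_near_center[OF \<delta>(1) w0] by metis
      obtain \<rho>1 where \<rho>1: "0 < \<rho>1" "\<And>e. 0 < e \<Longrightarrow> e < \<rho>1 \<Longrightarrow> B * e powr (2 * s) \<le> \<theta>0"
        using powr_small[OF s(1) B(1) \<theta>0] by metis
      show ?thesis
      proof (intro exI[of _ "min \<rho> (min \<rho>1 (r / 8))"] conjI allI impI)
        show "0 < min \<rho> (min \<rho>1 (r / 8))" using \<rho> \<rho>1 r by simp
        fix e :: real and z :: 'a
        assume e: "0 < e" "e < min \<rho> (min \<rho>1 (r / 8))" and z: "norm (z - x0) \<le> 7 / 8 * r" "z \<noteq> x0"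
        have N: "0 < ?N e" by (rule bump_mass_pos[OF e(1)])
        have "\<alpha> * m * ?N e \<le> mollify e v z + \<delta> * ?N e * barrier L (z - x0)"
        proof (rule nonlocal_minimum_principle[OF s r L, of "\<delta> * ?N e" "\<alpha> * m * ?N e" "m * ?N e" \<theta>0 M2 B C2 "mollify e v" x0 \<rho>])
          show "0 \<le> \<delta> * ?N e" using \<delta> N by simp
          show "0 \<le> \<alpha> * m * ?N e" using w0 N by simp
          show "\<alpha> * m * ?N e \<le> m * ?N e" using \<alpha> m N by simp
          show "0 < \<theta>0" by (rule \<theta>0)
          show "0 \<le> M2" using M2 by simp
          show "0 \<le> B" by (rule B)
          show "0 \<le> C2" by (rule C2)
          show "continuous_on UNIV (mollify e v)" by (rule mollify_continuous[OF e(1)])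
          show "0 \<le> mollify e v y" for y by (rule mollify_nonneg)
          show "integrable lborel (\<lambda>y. second_diff (mollify e v) z y * frac_kernel s y)" for z
            by (rule frac_op_mollify(2)[OF e(1)])
          show "2 * B / \<theta>0 * max ((norm x)\<^sup>2) (1 / L) powr (- 1 / 2) - frac_op s (\<lambda>x. barrier L x) x \<le> C2" for x :: 'a
            by (rule C2(2)[OF L])
          show "norm (z - x0) \<le> 7 / 8 * r" by (rule z)
          show "m * ?N e \<le> mollify e v y" if y: "5 / 8 * r \<le> norm (y - x0)" "norm (y - x0) \<le> 7 / 8 * r" for y
          proof (rule mollify_ge[OF e(1)])
            show "AE x in lborel. norm (x - y) < e \<longrightarrow> m \<le> v x"
              using vm
            proof eventually_elim
              fix x assume x: "x \<in> ball x0 r - ball x0 (r / 2) \<longrightarrow> m \<le> v x"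
              show "norm (x - y) < e \<longrightarrow> m \<le> v x"
              proof
                assume xy: "norm (x - y) < e"
                have "norm (x - x0) \<le> norm (x - y) + norm (y - x0)"
                  using norm_triangle_ineq[of "x - y" "y - x0"] by simp
                moreover have "norm (y - x0) \<le> norm (x - y) + norm (x - x0)"
                  using norm_triangle_ineq4[of "x - x0" "x - y"] by simp
                ultimately have "norm (x - x0) < r" "r / 2 \<le> norm (x - x0)" using xy y e(2) by auto
                then show "m \<le> v x" using x by (auto simp: dist_norm norm_minus_commute)
              qed
            qed
          qed (use m in simp)
          show "\<alpha> * m * ?N e \<le> \<delta> * ?N e * barrier L (y - x0)" if "norm (y - x0) \<le> \<rho>" for y
            using mult_right_mono[OF near[OF that], of "?N e"] N by (simp add: ac_simps)
          show "\<delta> * ?N e * C2 + \<alpha> * m * ?N e * (8 powr (2 * s) * kernel_tail s TYPE('a) + M2 / \<theta>0) < m * ?N e * ?ac"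
          proof -
            have "m * (\<alpha> * P) \<le> m * (?ac / 2)" using m by (intro mult_left_mono \<alpha>P) auto
            moreover have "m * (?ac / 2) = m * ?ac / 2" "\<alpha> * m * P = m * (\<alpha> * P)" by simp_all
            ultimately have "\<delta> * C2 + \<alpha> * m * P < m * ?ac" using \<delta>(2) by linarith
            then have "(\<delta> * C2 + \<alpha> * m * P) * ?N e < (m * ?ac) * ?N e" using N by (rule mult_strict_right_mono)
            then show ?thesis unfolding P_def[symmetric] by (simp add: algebra_simps)
          qed
          show "\<exists>\<theta> D w. \<theta>0 \<le> \<theta> \<and> norm w \<le> B \<and>
              (\<lambda>k. real k * (mollify e v (p + (1 / real k) *\<^sub>R w) - mollify e v p)) \<longlonglongrightarrow> - D \<and>
              0 \<le> \<theta> * frac_op s (mollify e v) p + D + M2 * mollify e v p"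
            if p: "\<rho> < norm (p - x0)" "norm (p - x0) < 5 / 8 * r" for p
          proof (intro exI conjI)
            have ze: "cball p e \<subseteq> ball x0 r - {x0}"
            proof
              fix x assume "x \<in> cball p e"
              then have x: "norm (x - p) \<le> e" by (simp add: dist_norm norm_minus_commute)
              have "norm (x - x0) \<le> norm (x - p) + norm (p - x0)"
                using norm_triangle_ineq[of "x - p" "p - x0"] by simp
              then have "norm (x - x0) < r" using x p e(2) by auto
              moreover have "x \<noteq> x0" using x p e(2) by (auto simp: norm_minus_commute)
              ultimately show "x \<in> ball x0 r - {x0}" by (simp add: dist_norm norm_minus_commute)
            qed
            have "p \<in> cball p e" using e(1) by simp
            then have pb: "p \<in> ball x0 r" using ze by blast
            show "\<theta>0 \<le> \<kappa> - B * e powr (2 * s)" using \<rho>1(2)[OF e(1)] e(2) by (simp add: \<theta>0_def)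
            show "norm (- b p) \<le> B" using b pb by (simp add: admissible_drift_def)
            show "(\<lambda>k. real k * (mollify e v (p + (1 / real k) *\<^sub>R (- b p)) - mollify e v p))
               \<longlonglongrightarrow> - (- (\<integral>x. v x * (bump_gradient e p x \<bullet> b p) \<partial>lborel))"
              using mollify_directional_derivative[OF e(1), of p "- b p"] by simp
            show "0 \<le> (\<kappa> - B * e powr (2 * s)) * frac_op s (mollify e v) p
               + - (\<integral>x. v x * (bump_gradient e p x \<bullet> b p) \<partial>lborel) + M2 * mollify e v p"
              unfolding \<kappa>_def M2_def
              by (rule mollified_inequality[OF sup umeas uv b B(1) _ cu A(2) e(1) ze]) (use cM in auto)
          qed
        qed
        also have "\<delta> * ?N e * barrier L (z - x0) \<le> \<delta> * ?N e * (1 / (norm (z - x0))\<^sup>2)"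
          using \<delta> N z by (intro mult_left_mono barrier_profile_le[OF L]) auto
        finally show "\<alpha> * m * ?N e \<le> mollify e v z + \<delta> * ?N e / (norm (z - x0))\<^sup>2" by simp
      qed
    qed
    define S where "S = ball x0 (7 / 8 * r) - {x0}"
    have "AE x in lebesgue. x \<in> S \<longrightarrow> \<alpha> * m \<le> v x"
    proof (rule AE_ge_if_box_integrals_ge)
      show "open S" unfolding S_def by (intro open_Diff) auto
      show "bounded S" unfolding S_def by (rule bounded_subset[OF bounded_ball]) auto
      fix a b' :: 'a assume Q: "cbox a b' \<subseteq> S"
      let ?Q = "cbox a b'" and ?X = "\<integral>x. indicator (cbox a b') x * v x \<partial>lborel"
      let ?vol = "measure lborel ?Q"
      have "open (- ?Q)" "x0 \<in> - ?Q" using Q by (auto simp: S_def open_Compl closed_cbox)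
      then obtain \<sigma> where \<sigma>: "0 < \<sigma>" "ball x0 \<sigma> \<subseteq> - ?Q" using open_contains_ball by blast
      have far: "\<sigma> \<le> norm (z - x0)" "norm (z - x0) \<le> 7 / 8 * r" "z \<noteq> x0" if "z \<in> ?Q" for z
      proof -
        have "z \<in> S" "z \<notin> ball x0 \<sigma>" using that Q \<sigma> by auto
        then show "\<sigma> \<le> norm (z - x0)" "norm (z - x0) \<le> 7 / 8 * r" "z \<noteq> x0"
          by (auto simp: S_def dist_norm norm_minus_commute)
      qed
      have step: "(\<alpha> * m - \<delta> / \<sigma>\<^sup>2) * ?vol \<le> ?X" if \<delta>: "0 < \<delta>" "\<delta> * C2 < m * ?ac / 2" for \<delta>
      proof -
        obtain \<rho> where \<rho>: "0 < \<rho>" and lb: "\<And>e z. 0 < e \<Longrightarrow> e < \<rho> \<Longrightarrow> norm (z - x0) \<le> 7 / 8 * r \<Longrightarrow> z \<noteq> x0 \<Longrightarrow>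
            \<alpha> * m * ?N e \<le> mollify e v z + \<delta> * ?N e / (norm (z - x0))\<^sup>2"
          using mollified[OF \<delta>] by blast
        define E where "E k = 1 / real (Suc k)" for k
        have E: "0 < E k" "E k \<le> 1" for k by (auto simp: E_def divide_le_eq)
        have E0: "E \<longlonglongrightarrow> 0" unfolding E_def by (rule LIMSEQ_Suc[OF lim_const_over_n])
        have "\<forall>\<^sub>F k in sequentially. E k < \<rho>" using order_tendstoD(2)[OF E0 \<rho>] .
        then have ev: "\<forall>\<^sub>F k in sequentially. (\<alpha> * m - \<delta> / \<sigma>\<^sup>2) * ?vol
           \<le> (\<integral>z. indicator ?Q z * mollify (E k) v z \<partial>lborel) / ?N (E k)"
        proof eventually_elim
          fix k assume k: "E k < \<rho>"
          have N: "0 < ?N (E k)" by (rule bump_mass_pos[OF E(1)])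
          have "(\<integral>z. indicator ?Q z * ((\<alpha> * m - \<delta> / \<sigma>\<^sup>2) * ?N (E k)) \<partial>lborel) \<le> (\<integral>z. indicator ?Q z * mollify (E k) v z \<partial>lborel)"
          proof (rule integral_mono)
            show "integrable lborel (\<lambda>z. indicator ?Q z * ((\<alpha> * m - \<delta> / \<sigma>\<^sup>2) * ?N (E k)))"
              by (intro integrable_mult_left integrable_real_indicator)
                 (auto simp: emeasure_bounded_finite[OF bounded_cbox, unfolded infinity_ennreal_def])
            show "integrable lborel (\<lambda>z. indicator ?Q z * mollify (E k) v z)"
              using borel_integrable_compact[of ?Q "mollify (E k) v"] continuous_on_subset[OF mollify_continuous[OF E(1)], of ?Q k]
              by simp
            show "indicator ?Q z * ((\<alpha> * m - \<delta> / \<sigma>\<^sup>2) * ?N (E k)) \<le> indicator ?Q z * mollify (E k) v z" for z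
            proof (cases "z \<in> ?Q")
              case True
              have "\<sigma>\<^sup>2 \<le> (norm (z - x0))\<^sup>2" using far(1)[OF True] \<sigma>(1) by (intro power_mono) auto
              then have "\<delta> * ?N (E k) / (norm (z - x0))\<^sup>2 \<le> \<delta> * ?N (E k) / \<sigma>\<^sup>2"
                using \<delta> N \<sigma>(1) far(3)[OF True] by (intro divide_left_mono mult_pos_pos) auto
              with lb[OF E(1) k far(2,3)[OF True]] show ?thesis using True by (simp add: left_diff_distrib)
            qed simp
          qed
          then have "((\<alpha> * m - \<delta> / \<sigma>\<^sup>2) * ?vol) * ?N (E k) \<le> (\<integral>z. indicator ?Q z * mollify (E k) v z \<partial>lborel)"
            by (simp add: ac_simps)
          then show "(\<alpha> * m - \<delta> / \<sigma>\<^sup>2) * ?vol \<le> (\<integral>z. indicator ?Q z * mollify (E k) v z \<partial>lborel) / ?N (E k)"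
            using N by (simp add: pos_le_divide_eq)
        qed
        show ?thesis
          by (rule tendsto_lowerbound[OF mollify_box_average[OF E E0] ev]) simp
      qed
      show "\<alpha> * m * ?vol \<le> ?X"
      proof (rule tendsto_upperbound)
        show "((\<lambda>\<delta>. (\<alpha> * m - \<delta> / \<sigma>\<^sup>2) * ?vol) \<longlongrightarrow> \<alpha> * m * ?vol) (at_right 0)"
          using \<sigma>(1) by (auto intro!: tendsto_eq_intros)
        have "((\<lambda>\<delta>. \<delta> * C2) \<longlongrightarrow> 0) (at_right 0)" by (auto intro!: tendsto_eq_intros)
        moreover have "0 < m * ?ac / 2" using m ac by simp
        ultimately have "\<forall>\<^sub>F \<delta> in at_right 0. \<delta> * C2 < m * ?ac / 2" by (rule order_tendstoD)
        moreover have "\<forall>\<^sub>F \<delta>::real in at_right 0. 0 < \<delta>" by (rule eventually_at_right_less)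
        ultimately show "\<forall>\<^sub>F \<delta> in at_right 0. (\<alpha> * m - \<delta> / \<sigma>\<^sup>2) * ?vol \<le> ?X"
          by eventually_elim (rule step)
      qed simp
    qed
    moreover have "AE x in lebesgue. x \<noteq> x0"
    proof -
      have "{x0} \<in> null_sets lebesgue" using negligible_sing[of x0] by (simp add: negligible_iff_null_sets)
      from AE_not_in[OF this] show ?thesis by simp
    qed
    ultimately show "AE x in lebesgue. x \<in> ball x0 r \<longrightarrow> \<alpha> * m \<le> u x"
      using um uv
    proof eventually_elim
      fix x assume x: "x \<in> S \<longrightarrow> \<alpha> * m \<le> v x" "x \<noteq> x0"
        "x \<in> ball x0 r - ball x0 (r / 2) \<longrightarrow> m \<le> u x" "u x = v x"
      have "\<alpha> * m \<le> m" using \<alpha> m by simp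
      then show "x \<in> ball x0 r \<longrightarrow> \<alpha> * m \<le> u x"
        using x r by (cases "dist x0 x < 7 / 8 * r") (auto simp: S_def)
    qed
  qed
qed

lemma admissible_drift_C1:
  fixes b :: "'a::euclidean_space \<Rightarrow> 'a"
  assumes "C_on 1 S b" "C1_norm S b \<le> ennreal M" "0 \<le> M"
  shows "admissible_drift M S b"
proof -
  have "norm (b x) \<le> M" "onorm (frechet_derivative b (at x)) \<le> M" if x: "x \<in> S" for x
  proof -
    have "ennreal (norm (b x)) \<le> (SUP x\<in>S. ennreal (norm (b x)))" by (rule SUP_upper[OF x])
    also have "\<dots> \<le> C1_norm S b" unfolding C1_norm_def by simp
    finally show "norm (b x) \<le> M" using assms(2,3) by (simp add: order_trans[of _ "C1_norm S b"] flip: ennreal_le_iff)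
    have "ennreal (onorm (frechet_derivative b (at x))) \<le> (SUP x\<in>S. ennreal (onorm (frechet_derivative b (at x))))"
      by (rule SUP_upper[OF x])
    also have "\<dots> \<le> C1_norm S b" unfolding C1_norm_def by simp
    finally show "onorm (frechet_derivative b (at x)) \<le> M" using assms(2,3) by (simp add: order_trans[of _ "C1_norm S b"] flip: ennreal_le_iff)
  qed
  then show ?thesis using assms(1) by (simp add: admissible_drift_def)
qed

lemma admissible_drift_zero:
  fixes b :: "'a::euclidean_space \<Rightarrow> 'a"
  assumes S: "open S" and b: "\<And>x. x \<in> S \<Longrightarrow> b x = 0"
  shows "admissible_drift 0 S b"
proof -
  have d: "(b has_derivative (\<lambda>_. 0)) (at x)" if "x \<in> S" for x
    by (rule has_derivative_transform_within_open[OF has_derivative_const[of 0] S that]) (simp add: b)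
  then have f: "frechet_derivative b (at x) = (\<lambda>_. 0)" if "x \<in> S" for x
    using frechet_derivative_at[OF d[OF that]] by simp
  have "continuous_on S (\<lambda>x. frechet_derivative b (at x) i)" for i
    by (subst continuous_on_cong[OF refl, of _ _ "\<lambda>_. 0"]) (auto simp: f)
  then show ?thesis unfolding admissible_drift_def using d by (auto simp: f b differentiable_def onorm_zero)
qed

theorem theorem1p5:
  fixes s M :: real
  assumes "CARD('n::finite) \<ge> 2" and "0 < s" and "s < 1" and "0 < M"
  shows
    "(1 / 2 < s \<longrightarrow>
       (\<exists>\<alpha>>0. \<forall>(x0::real^'n) r (b::real^'n \<Rightarrow> real^'n) (c::real^'n \<Rightarrow> real) m (u::real^'n \<Rightarrow> real).
          0 < r \<and> r \<le> 1 \<and>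
          C_on 1 (ball x0 r) b \<and> C1_norm (ball x0 r) b \<le> ennreal M \<and>
          c \<in> borel_measurable (lebesgue_on (ball x0 r)) \<and> (\<forall>x\<in>ball x0 r. c x \<le> M) \<and>
          locally_integrable_on (\<lambda>x. c x * u x) (ball x0 r - {x0}) \<and>
          0 < m \<and> u \<in> weighted_L1 (2 * s) \<and>
          distr_supersolution s b c (ball x0 r - {x0}) u \<and>
          (AE x in lebesgue. x \<in> ball x0 r - ball x0 (r / 2) \<longrightarrow> m \<le> u x) \<and>
          (AE x in lebesgue. 0 \<le> u x)
          \<longrightarrow> (AE x in lebesgue. x \<in> ball x0 r \<longrightarrow> \<alpha> * m \<le> u x))) \<and>
     (\<exists>\<alpha>>0. \<forall>(x0::real^'n) r (b::real^'n \<Rightarrow> real^'n) (c::real^'n \<Rightarrow> real) m (u::real^'n \<Rightarrow> real).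
          0 < r \<and> r \<le> 1 \<and>
          (\<forall>x\<in>ball x0 r. b x = 0) \<and>
          c \<in> borel_measurable (lebesgue_on (ball x0 r)) \<and> (\<forall>x\<in>ball x0 r. c x \<le> M) \<and>
          locally_integrable_on (\<lambda>x. c x * u x) (ball x0 r - {x0}) \<and>
          0 < m \<and> u \<in> weighted_L1 (2 * s) \<and>
          distr_supersolution s b c (ball x0 r - {x0}) u \<and>
          (AE x in lebesgue. x \<in> ball x0 r - ball x0 (r / 2) \<longrightarrow> m \<le> u x) \<and>
          (AE x in lebesgue. 0 \<le> u x)
          \<longrightarrow> (AE x in lebesgue. x \<in> ball x0 r \<longrightarrow> \<alpha> * m \<le> u x))"
proof (intro conjI impI, goal_cases)
  have n: "2 \<le> DIM(real^'n)" using assms(1) by simp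
  have M: "0 \<le> M" using assms(4) by simp
  {
    case 1
    obtain \<alpha> where \<alpha>: "0 < \<alpha>" "\<And>(x0::real^'n) r b c m u. supersolution_data s M M x0 r b c m u \<Longrightarrow>
        (AE x in lebesgue. x \<in> ball x0 r \<longrightarrow> \<alpha> * m \<le> u x)"
      using uniform_lower_bound[OF assms(2,3) n M disjI2[OF 1] assms(4)] by blast
    show ?case
    proof (intro exI[of _ \<alpha>] conjI \<alpha>(1) allI impI, goal_cases)
      case (1 x0 r b c m u)
      then have "supersolution_data s M M x0 r b c m u"
        by (simp add: supersolution_data_def admissible_drift_C1[OF _ _ M])
      then show ?case by (rule \<alpha>(2))
    qed
  next
    case 2
    obtain \<alpha> where \<alpha>: "0 < \<alpha>" "\<And>(x0::real^'n) r b c m u. supersolution_data s 0 M x0 r b c m u \<Longrightarrow>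
        (AE x in lebesgue. x \<in> ball x0 r \<longrightarrow> \<alpha> * m \<le> u x)"
      using uniform_lower_bound[OF assms(2,3) n order_refl disjI1[OF refl] assms(4)] by blast
    show ?case
    proof (intro exI[of _ \<alpha>] conjI \<alpha>(1) allI impI, goal_cases)
      case (1 x0 r b c m u)
      then have "admissible_drift 0 (ball x0 r) b"
        by (intro admissible_drift_zero[OF open_ball]) blast
      with 1 have "supersolution_data s 0 M x0 r b c m u"
        by (simp add: supersolution_data_def)
      then show ?case by (rule \<alpha>(2))
    qed
  }
qed

end
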